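(* Let $T_n$ be a real Toeplitz matrix to which corresponds an unknown complex-valued generating function $f$ with zeros in the interval $(-\pi,\pi]$ (so $T_n=T_n(f)$). Let $F_{n-1}$ be the Fourier expansion of $T_n$ and $g_n$ the trigonometric polynomial which eliminates the roots estimated by the technique described in the context. Suppose that the estimated nonzero roots $\widetilde{x}_i$, $i=1,2,\dots,\rho$, have an error $\varepsilon_i=\widetilde{x}_i-x_i$ and that their multiplicities have been estimated exactly, and that the matrices whose inverses appear below are invertible. Then the preconditioned matrix $$C_n^{-1}\left(\frac{F_{n-1}}{g_n}\right)T_n^{-1}(g_n)T_n$$ has: 1. a general cluster of its singular values in an interval around $1$ of length $o(1)$, and $o(n)$ singular values outside the cluster, if $f$ is continuous; 2. a general cluster of its singular values in the interval $[0.6847,1.2374]$, and $o(n)$ singular values outside the cluster, if $f$ is piecewise continuous.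
   Context: For integrable $2\pi$-periodic $h$, $T_n(h)$ is the $n\times n$ Toeplitz matrix with $(j,k)$ entry $t_{j-k}=\frac{1}{2\pi}\int_{-\pi}^{\pi}h(x)\mathrm{e}^{-\mathrm{i}(j-k)x}\,\mathrm{d}x$. The generating function is $f=f_1+\mathrm{i}f_2$, $2\pi$-periodic, $f_1$ real and even, $f_2$ real and odd. $F_{n-1}(x)=\sum_{k=-n+1}^{n-1}t_k\mathrm{e}^{\mathrm{i}kx}$ is built from the entries $t_k$ of $T_n$. $C_n(h)=\mathcal{F}_n^H\Lambda_n(h)\mathcal{F}_n$ is the circulant matrix whose eigenvalues are the values of $h$ on the grid $G_n=\{\theta_j=\frac{2(j-1)\pi}{n}: j=1,\dots,n\}$, with $\Lambda_n(h)=\operatorname{diag}(h(\theta_1),\dots,h(\theta_n))$ and $\mathcal{F}_n=\frac{1}{\sqrt n}\left(\omega^{(j-1)(k-1)}\right)_{j,k=1}^n$, $\omega=\mathrm{e}^{2\pi\mathrm{i}/n}$. A superscript $-1$ denotes matrix inverse. Technique for $g_n$. Points of $G_n$ at local minima of $|\operatorname{Re}F_{n-1}|$ or $|\operatorname{Im}F_{n-1}|$ on $G_n$ whose value is nearly $0$ are taken as estimated roots (if two adjacent grid points give the same near-zero value, their midpoint is taken); via $2\pi$-periodicity they are considered in $(-\pi,\pi]$. The exact nonzero roots are $\pm x_i$, $x_i\in(0,\pi]$, and $\pm\widetilde{x}_i$ are their estimates, $i=1,\dots,\rho$. Let $m_i^1,m_i^2$ be the multiplicities of $x_i$ as a root of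 $f_1,f_2$, and $m_0^1,m_0^2$ those of the root at $0$ (multiplicity $0$ if not a root). If $m_i^1\le m_i^2$ for all $i$, then $g_n(x)=s_1(2-2\cos x)^{m_0^1/2}\prod_{i=1}^{\rho}(\cos\widetilde{x}_i-\cos x)^{m_i^1}$; otherwise $g_n(x)=s_1(2-2\cos x)^{m_0^1/2}\prod_{i=1}^{\rho}(\cos\widetilde{x}_i-\cos x)^{m_i^1}+\mathrm{i}s_2(\sin x)^{m_0^2}\prod_{i=1}^{\rho}(\cos\widetilde{x}_i-\cos x)^{m_i^2}$, with signs $s_1,s_2\in\{\pm1\}$ chosen so that $\operatorname{Re}(F_{n-1}/g_n)>0$ on the grid. At a grid point $\theta_i$ where $g_n$ vanishes, the value of $F_{n-1}/g_n$ used in $C_n(F_{n-1}/g_n)$ is replaced by its value at a neighbouring grid point $\theta_{i\pm1}$ (or the average of the two). General clustering in an interval $I_n$ with $o(n)$ singular values outside means: for every $\varepsilon>0$ the number of singular values of the $n\times n$ matrix at distance more than $\varepsilon$ from $I_n$ is $o(n)$. *)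

theory Defs
  imports
    "HOL-Analysis.Analysis"
    "HOL-Library.Landau_Symbols"
    "Jordan_Normal_Form.Schur_Decomposition"
    "Jordan_Normal_Form.Gauss_Jordan_Elimination"
begin

section \<open>Functions on the circle\<close>

definition fourier_coeff :: "(real \<Rightarrow> complex) \<Rightarrow> int \<Rightarrow> complex" where
  "fourier_coeff h k =
     complex_of_real (1 / (2 * pi)) * (LBINT x:{-pi..pi}. h x * exp (- \<i> * of_int k * of_real x))"

text \<open>The Fourier expansion of an \<open>n \<times> n\<close> Toeplitz matrix; in the usual notation this
  is \<open>F\<^sub>n\<^sub>-\<^sub>1\<close>. It only involves the entries of the matrix.\<close>

definition fourier_expansion :: "nat \<Rightarrow> (real \<Rightarrow> complex) \<Rightarrow> real \<Rightarrow> complex" where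
  "fourier_expansion n h x =
     (\<Sum>k\<in>{- int n + 1 .. int n - 1}. fourier_coeff h k * exp (\<i> * of_int k * of_real x))"

text \<open>To be used for \<open>2\<pi>\<close>-periodic functions, for which it suffices to count the
  discontinuities in \<open>[-\<pi>, \<pi>]\<close>.\<close>

definition piecewise_continuous :: "(real \<Rightarrow> complex) \<Rightarrow> bool" where
  "piecewise_continuous h \<longleftrightarrow>
     finite {x \<in> {-pi..pi}. \<not> isCont h x} \<and>
     (\<forall>x. (\<exists>l. (h \<longlongrightarrow> l) (at_left x)) \<and> (\<exists>r. (h \<longlongrightarrow> r) (at_right x)))"

text \<open>\<open>h\<close> behaves like \<open>|x - a|\<^sup>m\<close> near \<open>a\<close>. No smoothness of \<open>h\<close> is presupposed, and
  \<open>m = 0\<close> if \<open>h\<close> is continuous at \<open>a\<close> and \<open>a\<close> is not a root.\<close>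

definition has_multiplicity :: "(real \<Rightarrow> real) \<Rightarrow> real \<Rightarrow> nat \<Rightarrow> bool" where
  "has_multiplicity h a m \<longleftrightarrow>
     (\<exists>c C. 0 < c \<and> (\<forall>\<^sub>F x in at a. c * \<bar>x - a\<bar> ^ m \<le> \<bar>h x\<bar> \<and> \<bar>h x\<bar> \<le> C * \<bar>x - a\<bar> ^ m))"


section \<open>Structured matrices\<close>

text \<open>Matrix indices, and accordingly the indices of grid points, start at \<open>0\<close>.
  Grid indices are integers, so that the two neighbours of the \<open>j\<close>-th grid point have indices
  \<open>j \<plusminus> 1\<close>; indices outside \<open>{0..<n}\<close> denote the same points up to \<open>2\<pi>\<close>-periodicity.\<close>

definition grid_point :: "nat \<Rightarrow> int \<Rightarrow> real" where
  "grid_point n j = 2 * of_int j * pi / of_nat n"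

definition toeplitz :: "nat \<Rightarrow> (real \<Rightarrow> complex) \<Rightarrow> complex mat" where
  "toeplitz n h = mat n n (\<lambda>(j, k). fourier_coeff h (int j - int k))"

definition fourier_mat :: "nat \<Rightarrow> complex mat" where
  "fourier_mat n = mat n n (\<lambda>(j, k).
     complex_of_real (1 / sqrt (real n)) * exp (2 * of_real pi * \<i> / of_nat n) ^ (j * k))"

text \<open>The circulant matrix with prescribed eigenvalues \<open>v 0, \<dots>, v (n - 1)\<close>.\<close>

definition circulant :: "nat \<Rightarrow> (nat \<Rightarrow> complex) \<Rightarrow> complex mat" where
  "circulant n v = mat_adjoint (fourier_mat n) * mat_diag n v * fourier_mat n"

text \<open>Meaningful for invertible matrices only.\<close>

definition inv_mat :: "complex mat \<Rightarrow> complex mat" where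
  "inv_mat A = the (mat_inverse A)"


section \<open>Singular values and clustering\<close>

definition singular_values :: "complex mat \<Rightarrow> real multiset" where
  "singular_values A = image_mset (\<lambda>z. sqrt (Re z)) (proots (char_poly (mat_adjoint A * A)))"

text \<open>To be used for nonempty sets \<open>I n\<close>: \<open>infdist s {} = 0\<close>.\<close>

definition sv_cluster :: "(nat \<Rightarrow> complex mat) \<Rightarrow> (nat \<Rightarrow> real set) \<Rightarrow> bool" where
  "sv_cluster A I \<longleftrightarrow>
     (\<forall>\<epsilon>>0. (\<lambda>n. real (size {#s \<in># singular_values (A n). infdist s (I n) > \<epsilon>#}))
              \<in> o(\<lambda>n. real n))"


section \<open>Elimination of the estimated roots\<close>

text \<open>\<open>y\<close> is picked as an estimated root of \<open>F\<close> on the \<open>n\<close>-point grid, where values up to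
  \<open>\<tau>\<close> in modulus count as nearly zero.\<close>

definition estimated_root :: "nat \<Rightarrow> real \<Rightarrow> (real \<Rightarrow> complex) \<Rightarrow> real \<Rightarrow> bool" where
  "estimated_root n \<tau> F y \<longleftrightarrow>
     (\<exists>p\<in>{\<lambda>x. \<bar>Re (F x)\<bar>, \<lambda>x. \<bar>Im (F x)\<bar>}. \<exists>j::int.
        (y = grid_point n j \<and>
         p (grid_point n j) \<le> \<tau> \<and>
         p (grid_point n j) < p (grid_point n (j - 1)) \<and>
         p (grid_point n j) < p (grid_point n (j + 1)))
      \<or> (y = (grid_point n j + grid_point n (j + 1)) / 2 \<and>
         p (grid_point n j) \<le> \<tau> \<and>
         p (grid_point n j) = p (grid_point n (j + 1)) \<and>
         p (grid_point n j) \<le> p (grid_point n (j - 1)) \<and>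
         p (grid_point n (j + 1)) \<le> p (grid_point n (j + 2))))"

text \<open>\<open>m1 i\<close> and \<open>m2 i\<close> are the multiplicities belonging to the root at \<open>0\<close> (for \<open>i = 0\<close>)
  and to the nonzero roots estimated by \<open>\<plusminus> y i\<close> (for \<open>1 \<le> i \<le> \<rho>\<close>). The exponent
  \<open>m1 0 div 2\<close> is meant for even \<open>m1 0\<close>; otherwise \<open>(2 - 2 cos x)\<^bsup>m1 0 / 2\<^esup>\<close> would not
  be a trigonometric polynomial.\<close>

definition eliminator ::
  "nat \<Rightarrow> (nat \<Rightarrow> nat) \<Rightarrow> (nat \<Rightarrow> nat) \<Rightarrow> (nat \<Rightarrow> real) \<Rightarrow> real \<Rightarrow> real \<Rightarrow> real \<Rightarrow> complex" where
  "eliminator \<rho> m1 m2 y s1 s2 x =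
     (let g1 = s1 * (2 - 2 * cos x) ^ (m1 0 div 2) * (\<Prod>i=1..\<rho>. (cos (y i) - cos x) ^ m1 i);
          g2 = s2 * sin x ^ m2 0 * (\<Prod>i=1..\<rho>. (cos (y i) - cos x) ^ m2 i)
      in if \<forall>i\<le>\<rho>. m1 i \<le> m2 i then complex_of_real g1
         else complex_of_real g1 + \<i> * complex_of_real g2)"

definition positive_quotient :: "nat \<Rightarrow> (real \<Rightarrow> complex) \<Rightarrow> (real \<Rightarrow> complex) \<Rightarrow> bool" where
  "positive_quotient n F g \<longleftrightarrow>
     (\<forall>j::int. g (grid_point n j) \<noteq> 0 \<longrightarrow> Re (F (grid_point n j) / g (grid_point n j)) > 0)"

text \<open>\<open>v\<close> lists values of \<open>F / g\<close> on the grid. At grid points where \<open>g\<close> vanishes the value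
  at one of the neighbouring grid points, or the average of both, is taken instead; this
  requires that \<open>g\<close> does not vanish at the neighbours used.\<close>

definition quotient_samples ::
  "nat \<Rightarrow> (real \<Rightarrow> complex) \<Rightarrow> (real \<Rightarrow> complex) \<Rightarrow> (nat \<Rightarrow> complex) \<Rightarrow> bool" where
  "quotient_samples n F g v \<longleftrightarrow>
     (let q = (\<lambda>j::int. F (grid_point n j) / g (grid_point n j));
          ok = (\<lambda>j::int. g (grid_point n j) \<noteq> 0)
      in \<forall>j<n.
           if ok (int j) then v j = q (int j)
           else (ok (int j - 1) \<and> v j = q (int j - 1))
              \<or> (ok (int j + 1) \<and> v j = q (int j + 1))
              \<or> (ok (int j - 1) \<and> ok (int j + 1) \<and> v j = (q (int j - 1) + q (int j + 1)) / 2))"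

end

theory Submission
  imports Defs
begin

text \<open>
  The singular values cluster at the single point \<open>1\<close>, for continuous and for piecewise continuous
  \<open>f\<close> alike; as \<open>1\<close> lies in both intervals of the theorem, both parts follow. The reason is that,
  up to a subspace of dimension \<open>o(n)\<close> and up to errors that are small in norm, all matrices
  involved may be replaced by circulant matrices, for which the preconditioner is an exact inverse.

  Three facts make this precise. First, \<open>T\<^sub>n(f)\<close> differs from \<open>C\<^sub>n(F\<^sub>n\<^sub>-\<^sub>1)\<close> only by aliased Fourier
  coefficients: the squared Frobenius norm of the difference is \<open>\<Sum> \<bar>m\<bar> \<bar>t\<^sub>m\<bar>\<^sup>2\<close> over \<open>\<bar>m\<bar> < n\<close>, which by
  Bessel's inequality is \<open>o(n)\<close> (\<open>toeplitz_minus_circulant_frobenius\<close>, \<open>toeplitz_circulant_close\<close>).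
  Second, \<open>g\<^sub>n\<close> is a trigonometric polynomial of bounded degree, so \<open>T\<^sub>n(g\<^sub>n)\<close> and \<open>C\<^sub>n(g\<^sub>n)\<close> agree
  outside a bounded number of rows (\<open>toeplitz_circulant_banded\<close>), and \<open>g\<^sub>n\<close> has a bounded number of
  zeros on the grid (\<open>card_eliminator_zeros\<close>); both bounds are uniform in \<open>n\<close>. Away from
  these zeros the prescribed samples of \<open>F\<^sub>n\<^sub>-\<^sub>1 / g\<^sub>n\<close> multiply with \<open>g\<^sub>n\<close> to \<open>F\<^sub>n\<^sub>-\<^sub>1\<close>. Third, since the
  zeros and the discontinuities of \<open>f\<close> form a finite set in one period, \<open>\<bar>F\<^sub>n\<^sub>-\<^sub>1\<bar>\<close> exceeds some \<open>\<eta> > 0\<close> at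
  all but a small proportion of the grid points (\<open>fourier_expansion_rarely_small\<close>). This is shown
  by comparing \<open>F\<^sub>n\<^sub>-\<^sub>1\<close> in the mean square on the grid with a trigonometric polynomial close to \<open>f\<close>.

  The difference \<open>M\<^sub>n - 1\<close> solves a linear system whose matrix is, by these facts, nearly \<open>C\<^sub>n(F\<^sub>n\<^sub>-\<^sub>1)\<close>
  and whose right hand side is nearly \<open>T\<^sub>n(f) - C\<^sub>n(F\<^sub>n\<^sub>-\<^sub>1)\<close>. So \<open>\<parallel>M\<^sub>n x - x\<parallel> \<le> \<epsilon> \<parallel>x\<parallel>\<close> on a subspace of
  codimension \<open>o(n)\<close> (\<open>preconditioned_near_identity\<close>), and a Courant-Fischer argument
  (\<open>singular_values_near_1\<close>) turns this into the cluster of the singular values.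
\<close>

section \<open>Unitary matrices and the spectral theorem\<close>

lemma mat_adjoint_dim [simp]:
  "dim_row (mat_adjoint A) = dim_col A" "dim_col (mat_adjoint A) = dim_row A"
  unfolding mat_adjoint_def by (auto simp: mat_of_rows_def)

lemma mat_adjoint_carrier [simp]: "A \<in> carrier_mat m n \<Longrightarrow> mat_adjoint A \<in> carrier_mat n m"
  by (intro carrier_matI) auto

lemma mat_adjoint_index [simp]:
  fixes A :: "complex mat"
  assumes "i < dim_col A" "j < dim_row A"
  shows "mat_adjoint A $$ (i, j) = cnj (A $$ (j, i))"
  using assms unfolding mat_adjoint_def by (auto simp: mat_of_rows_def)

lemma mat_adjoint_mult:
  fixes A B :: "complex mat"
  assumes "A \<in> carrier_mat m n" "B \<in> carrier_mat n k"
  shows "mat_adjoint (A * B) = mat_adjoint B * mat_adjoint A"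
  using assms by (intro eq_matI) (auto simp: scalar_prod_def mult.commute)

lemma mat_adjoint_adjoint [simp]:
  fixes A :: "complex mat"
  shows "mat_adjoint (mat_adjoint A) = A"
  by (intro eq_matI) auto

definition sqnorm :: "complex vec \<Rightarrow> real" where
  "sqnorm x = (\<Sum>i<dim_vec x. (cmod (x $ i))\<^sup>2)"

lemma sqnorm_nonneg [simp]: "0 \<le> sqnorm x"
  unfolding sqnorm_def by (intro sum_nonneg) auto

lemma sqnorm_cscalar_prod: "x \<bullet>c x = complex_of_real (sqnorm x)"
  unfolding sqnorm_def scalar_prod_def
  by (simp add: complex_norm_square lessThan_atLeast0 del: of_real_power)

lemma sqnorm_pos:
  assumes "x \<in> carrier_vec n" "x \<noteq> 0\<^sub>v n"
  shows "sqnorm x > 0"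
proof (rule ccontr)
  assume "\<not> sqnorm x > 0"
  then have "sqnorm x = 0" using sqnorm_nonneg[of x] by linarith
  then have "\<forall>i<n. x $ i = 0" using assms unfolding sqnorm_def by (subst (asm) sum_nonneg_eq_0_iff) auto
  then have "x = 0\<^sub>v n" using assms by (intro eq_vecI) auto
  with assms show False by simp
qed

lemma cscalar_prod_adjoint:
  fixes A :: "complex mat"
  assumes A: "A \<in> carrier_mat m n" and x: "x \<in> carrier_vec n" and y: "y \<in> carrier_vec m"
  shows "(A *\<^sub>v x) \<bullet>c y = x \<bullet>c (mat_adjoint A *\<^sub>v y)"
proof -
  have c: "mat_adjoint A \<in> carrier_mat n m" using A by simp
  have "(A *\<^sub>v x) \<bullet>c y = (\<Sum>i<m. \<Sum>j<n. A $$ (i,j) * x $ j * cnj (y $ i))"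
    using A x y by (auto simp: scalar_prod_def sum_distrib_right lessThan_atLeast0 row_def intro!: sum.cong)
  also have "\<dots> = (\<Sum>j<n. \<Sum>i<m. A $$ (i,j) * x $ j * cnj (y $ i))" by (rule sum.swap)
  also have "\<dots> = x \<bullet>c (mat_adjoint A *\<^sub>v y)"
    using A x y c by (auto simp: scalar_prod_def sum_distrib_left lessThan_atLeast0 row_def algebra_simps intro!: sum.cong)
  finally show ?thesis .
qed

lemma sqnorm_isometry:
  assumes U: "U \<in> carrier_mat n n" "mat_adjoint U * U = 1\<^sub>m n" and x: "x \<in> carrier_vec n"
  shows "sqnorm (U *\<^sub>v x) = sqnorm x"
proof -
  have "complex_of_real (sqnorm (U *\<^sub>v x)) = x \<bullet>c (mat_adjoint U *\<^sub>v (U *\<^sub>v x))"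
    unfolding sqnorm_cscalar_prod[symmetric] using U x by (intro cscalar_prod_adjoint) auto
  also have "mat_adjoint U *\<^sub>v (U *\<^sub>v x) = x"
    using U x by (subst assoc_mult_mat_vec[symmetric, of _ n n _ n]) auto
  finally show ?thesis unfolding sqnorm_cscalar_prod of_real_eq_iff .
qed

lemma unitary_columns:
  fixes W :: "complex mat"
  assumes W: "W \<in> carrier_mat n n" and
    o: "\<And>i j. i < n \<Longrightarrow> j < n \<Longrightarrow> col W j \<bullet>c col W i = (if i = j then 1 else 0)"
  shows "mat_adjoint W * W = 1\<^sub>m n"
proof (rule eq_matI)
  have c: "mat_adjoint W \<in> carrier_mat n n" using W by simp
  show "dim_row (mat_adjoint W * W) = dim_row (1\<^sub>m n)" "dim_col (mat_adjoint W * W) = dim_col (1\<^sub>m n)"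
    using c W by auto
  fix i j assume "i < dim_row (1\<^sub>m n :: complex mat)" "j < dim_col (1\<^sub>m n :: complex mat)"
  then have ij: "i < n" "j < n" by auto
  have "(mat_adjoint W * W) $$ (i,j) = col W j \<bullet>c col W i"
    using ij W c by (auto simp: scalar_prod_def row_def col_def mult.commute intro!: sum.cong)
  with o[OF ij] show "(mat_adjoint W * W) $$ (i,j) = 1\<^sub>m n $$ (i,j)" using ij by auto
qed

text \<open>Gram-Schmidt yields an orthogonal basis starting with the given vector; dividing by the
  norms makes it orthonormal, so that only the direction of the first column is prescribed.\<close>

lemma unit_vector_extends_to_unitary:
  fixes v :: "complex vec"
  assumes v: "v \<in> carrier_vec n" "v \<noteq> 0\<^sub>v n" and n: "0 < n"
  obtains W c where "W \<in> carrier_mat n n" "mat_adjoint W * W = 1\<^sub>m n" "col W 0 = c \<cdot>\<^sub>v v"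
proof -
  interpret cof_vec_space n "TYPE(complex)" .
  define b where "b = basis_completion v"
  define ws where "ws = gram_schmidt n b"
  from basis_completion[OF v, folded b_def]
  have dist_b: "distinct b" and indep: "\<not> lin_dep (set b)" and b: "set b \<subseteq> carrier_vec n"
    and hdb: "hd b = v" and len_b: "length b = n" by auto
  from hdb len_b n obtain vs where bv: "b = v # vs" by (cases b, auto)
  from gram_schmidt_result[OF b dist_b indep refl, folded ws_def]
  have ws: "set ws \<subseteq> carrier_vec n" "corthogonal ws" "length ws = n" by (auto simp: len_b)
  from gram_schmidt_hd[OF v(1), of vs, folded bv] have hdws: "hd ws = v" unfolding ws_def .
  then have ws0: "ws ! 0 = v" using ws(3) n by (cases ws) auto
  define r where "r i = complex_of_real (1 / sqrt (sqnorm (ws ! i)))" for i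
  define W where "W = mat_of_cols n (map (\<lambda>i. r i \<cdot>\<^sub>v ws ! i) [0..<n])"
  have wsi: "ws ! i \<in> carrier_vec n" if "i < n" for i using ws that by auto
  have W: "W \<in> carrier_mat n n" unfolding W_def by auto
  have cW: "col W i = r i \<cdot>\<^sub>v ws ! i" if "i < n" for i
    unfolding W_def using that wsi by (subst col_mat_of_cols) auto
  have "col W j \<bullet>c col W i = (if i = j then 1 else 0)" if "i < n" "j < n" for i j
  proof -
    have 1: "col W j \<bullet>c col W i = r j * cnj (r i) * (ws ! j \<bullet>c ws ! i)"
      unfolding cW[OF that(1)] cW[OF that(2)] using wsi[OF that(1)] wsi[OF that(2)]
      by (auto simp: scalar_prod_def sum_distrib_left intro!: sum.cong)
    show ?thesis
    proof (cases "i = j")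
      case False
      then have "ws ! j \<bullet>c ws ! i = 0" using ws(2,3) that unfolding corthogonal_def by auto
      with 1 False show ?thesis by simp
    next
      case True
      have "ws ! i \<bullet>c ws ! i \<noteq> 0" using ws(2,3) that unfolding corthogonal_def by auto
      then have "sqnorm (ws ! i) \<noteq> 0" unfolding sqnorm_cscalar_prod by simp
      then have p: "sqnorm (ws ! i) > 0" using sqnorm_nonneg[of "ws ! i"] by linarith
      have "r i * cnj (r i) * complex_of_real (sqnorm (ws ! i)) =
          complex_of_real (1 / sqrt (sqnorm (ws ! i)) * (1 / sqrt (sqnorm (ws ! i))) * sqnorm (ws ! i))"
        unfolding r_def by (simp only: of_real_mult complex_cnj_complex_of_real)
      also have "1 / sqrt (sqnorm (ws ! i)) * (1 / sqrt (sqnorm (ws ! i))) * sqnorm (ws ! i) = 1"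
        using p by (simp add: field_simps)
      finally show ?thesis using 1 True sqnorm_cscalar_prod[of "ws ! i"] by (simp add: mult.assoc)
    qed
  qed
  from unitary_columns[OF W this] W cW[OF n] ws0 that show ?thesis by metis
qed

lemma unitary_mult:
  fixes U W :: "complex mat"
  assumes U: "U \<in> carrier_mat n n" "mat_adjoint U * U = 1\<^sub>m n"
    and W: "W \<in> carrier_mat n n" "mat_adjoint W * W = 1\<^sub>m n"
  shows "mat_adjoint (U * W) * (U * W) = 1\<^sub>m n"
proof -
  have c: "mat_adjoint U \<in> carrier_mat n n" "mat_adjoint W \<in> carrier_mat n n" using U W by auto
  have "mat_adjoint (U * W) * (U * W) = mat_adjoint W * (mat_adjoint U * U) * W"
    unfolding mat_adjoint_mult[OF U(1) W(1)] using U(1) W(1) c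
    by (simp add: assoc_mult_mat[of _ n n _ n _ n] mult_carrier_mat[of _ n n _ n])
  then show ?thesis using U W c by simp
qed

lemma unitary_right_inverse:
  fixes U :: "complex mat"
  assumes U: "U \<in> carrier_mat n n" "mat_adjoint U * U = 1\<^sub>m n"
  shows "U * mat_adjoint U = 1\<^sub>m n"
  using mat_mult_left_right_inverse[OF mat_adjoint_carrier[OF U(1)] U(1) U(2)] .

text \<open>By induction on the size: in an orthonormal basis whose first vector is an eigenvector the
  first column of the matrix is a multiple of the first unit vector. Since the matrix stays
  Hermitian, the same holds for the first row, and a Hermitian block of smaller size remains.\<close>

lemma hermitian_spectral:
  fixes A :: "complex mat"
  assumes "A \<in> carrier_mat n n" "mat_adjoint A = A"
  shows "\<exists>U e. U \<in> carrier_mat n n \<and> mat_adjoint U * U = 1\<^sub>m n \<and> mat_adjoint U * A * U = mat_diag n e"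
  using assms
proof (induction n arbitrary: A)
  case 0
  show ?case
    by (rule exI[of _ "1\<^sub>m 0"], rule exI[of _ "\<lambda>_. 0"])
       (use 0 in \<open>auto simp: mat_diag_def mat_adjoint_def mat_of_rows_def intro!: eq_matI\<close>)
next
  case (Suc n A)
  note A = Suc.prems(1)
  obtain as where as: "char_poly A = (\<Prod>a\<leftarrow>as. [:- a, 1:])" "length as = Suc n"
    using char_poly_factorized[OF A] by blast
  then obtain e0 as' where "as = e0 # as'" by (cases as) auto
  then have "poly (char_poly A) e0 = 0" using as by simp
  then have "eigenvalue A e0" using eigenvalue_root_char_poly[OF A] by simp
  then obtain v where v: "v \<in> carrier_vec (Suc n)" "v \<noteq> 0\<^sub>v (Suc n)" "A *\<^sub>v v = e0 \<cdot>\<^sub>v v"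
    unfolding eigenvalue_def eigenvector_def using A by auto
  obtain W c where W: "W \<in> carrier_mat (Suc n) (Suc n)" "mat_adjoint W * W = 1\<^sub>m (Suc n)"
    and W0: "col W 0 = c \<cdot>\<^sub>v v"
    using unit_vector_extends_to_unitary[OF v(1,2)] by auto
  define W' where "W' = mat_adjoint W"
  have W': "W' \<in> carrier_mat (Suc n) (Suc n)" unfolding W'_def using W by simp
  define B where "B = W' * A * W"
  have B: "B \<in> carrier_mat (Suc n) (Suc n)" unfolding B_def using W W' A by auto
  have adjW': "mat_adjoint W' = W" unfolding W'_def by simp
  have Bh: "mat_adjoint B = B"
    unfolding B_def using W W' A Suc.prems(2) adjW'
    by (subst mat_adjoint_mult[of _ "Suc n" "Suc n" _ "Suc n"], simp_all,
        subst mat_adjoint_mult[of _ "Suc n" "Suc n" _ "Suc n"], simp_all add: W'_def[symmetric])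
  have AW0: "A *\<^sub>v col W 0 = e0 \<cdot>\<^sub>v col W 0"
    unfolding W0 using v A by (auto simp: mult_mat_vec smult_smult_assoc mult.commute)
  have cW: "col W 0 \<in> carrier_vec (Suc n)" using W by (auto intro!: carrier_vecI)
  have colB: "col B 0 = e0 \<cdot>\<^sub>v unit_vec (Suc n) 0"
  proof -
    have "col B 0 = (W' * A) *\<^sub>v col W 0" unfolding B_def using W W' A by (intro col_mult2[of _ "Suc n" "Suc n" _ "Suc n"]) auto
    also have "\<dots> = W' *\<^sub>v (A *\<^sub>v col W 0)" using W' A cW by (intro assoc_mult_mat_vec)
    also have "\<dots> = e0 \<cdot>\<^sub>v (W' *\<^sub>v col W 0)" unfolding AW0 by (rule mult_mat_vec[OF W' cW])
    also have "W' *\<^sub>v col W 0 = col (W' * W) 0" using W W' by (intro col_mult2[of _ "Suc n" "Suc n" _ "Suc n", symmetric]) auto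
    also have "\<dots> = unit_vec (Suc n) 0" using W unfolding W'_def by simp
    finally show ?thesis .
  qed
  have Bi0: "B $$ (i, 0) = (if i = 0 then e0 else 0)" if "i < Suc n" for i
    using arg_cong[OF colB, of "\<lambda>v. v $ i"] that B by (auto simp: unit_vec_def)
  have B0i: "B $$ (0, i) = (if i = 0 then e0 else 0)" if "i < Suc n" for i
  proof -
    have "B $$ (0, i) = cnj (B $$ (i, 0))"
      using mat_adjoint_index[of 0 B i] Bh B that by simp
    then show ?thesis using Bi0[OF that] Bi0[of 0] by (auto split: if_splits)
  qed
  define B3 where "B3 = mat n n (\<lambda>(i,j). B $$ (Suc i, Suc j))"
  have B3: "B3 \<in> carrier_mat n n" unfolding B3_def by simp
  have B3h: "mat_adjoint B3 = B3"
  proof (rule eq_matI)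
    fix i j assume "i < dim_row B3" "j < dim_col B3"
    then have ij: "i < n" "j < n" using B3 by auto
    show "mat_adjoint B3 $$ (i, j) = B3 $$ (i, j)"
      using mat_adjoint_index[of "Suc i" B "Suc j"] Bh B ij
      unfolding B3_def by simp
  qed (use B3 in auto)
  obtain U e where U: "U \<in> carrier_mat n n" "mat_adjoint U * U = 1\<^sub>m n" "mat_adjoint U * B3 * U = mat_diag n e"
    using Suc.IH[OF B3 B3h] by blast
  define V where "V = four_block_mat (1\<^sub>m 1) (0\<^sub>m 1 n) (0\<^sub>m n 1) U"
  define V' where "V' = four_block_mat (1\<^sub>m 1) (0\<^sub>m 1 n) (0\<^sub>m n 1) (mat_adjoint U)"
  have V: "V \<in> carrier_mat (Suc n) (Suc n)" unfolding V_def using U(1) by (intro carrier_matI) auto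
  have U': "mat_adjoint U \<in> carrier_mat n n" using U(1) by simp
  have V': "V' \<in> carrier_mat (Suc n) (Suc n)" unfolding V'_def using U' by (intro carrier_matI) auto
  have VV': "mat_adjoint V = V'"
  proof (rule eq_matI)
    fix i j assume "i < dim_row V'" "j < dim_col V'"
    then have ij: "i < Suc n" "j < Suc n" using V' by auto
    show "mat_adjoint V $$ (i, j) = V' $$ (i, j)"
      using mat_adjoint_index[of i V j] ij U(1) V
      unfolding V_def V'_def by auto
  qed (use V V' in auto)
  have Bblock: "B = four_block_mat (mat 1 1 (\<lambda>_. e0)) (0\<^sub>m 1 n) (0\<^sub>m n 1) B3"
  proof (rule eq_matI, goal_cases)
    case (1 i j)
    then have ij: "i < Suc n" "j < Suc n" using B3 by auto
    show ?case using ij Bi0 B0i B3 by (auto simp: B3_def)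
  qed (use B B3 in auto)
  have 1: "V' * V = 1\<^sub>m (Suc n)"
    unfolding V'_def V_def using U(1,2) U'
    by (subst mult_four_block_mat[of _ 1 1 _ n _ n _ _ 1 _ n]) (auto simp: four_block_one_mat intro!: eq_matI)
  have 2: "V' * B * V = mat_diag (Suc n) (\<lambda>i. if i = 0 then e0 else e (i - 1))"
  proof -
    let ?e = "mat 1 1 (\<lambda>_. e0)"
    have "V' * B = four_block_mat ?e (0\<^sub>m 1 n) (0\<^sub>m n 1) (mat_adjoint U * B3)"
      unfolding V'_def Bblock using U' B3 right_mult_zero_mat[OF U', of 1]
      by (subst mult_four_block_mat[of _ 1 1 _ n _ n _ _ 1 _ n]) auto
    also have "\<dots> * V = four_block_mat ?e (0\<^sub>m 1 n) (0\<^sub>m n 1) (mat_adjoint U * B3 * U)"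
      unfolding V_def using U' B3 U(1)
      by (subst mult_four_block_mat[of _ 1 1 _ n _ n _ _ 1 _ n])
         (auto intro!: arg_cong2[of _ _ _ _ "four_block_mat _ _"] left_add_zero_mat)
    finally show ?thesis unfolding U(3) by (auto simp: mat_diag_def intro!: eq_matI)
  qed
  have W'V: "mat_adjoint (W * V) = V' * W'"
    using mat_adjoint_mult[OF W(1) V] VV' by (simp add: W'_def)
  have "mat_adjoint (W * V) * A * (W * V) = V' * B * V"
    unfolding W'V B_def using V' W' A W(1) V
    by (simp add: assoc_mult_mat[of _ "Suc n" "Suc n" _ "Suc n" _ "Suc n"] mult_carrier_mat[of _ "Suc n" "Suc n" _ "Suc n"])
  moreover have "mat_adjoint (W * V) * (W * V) = 1\<^sub>m (Suc n)"
    by (rule unitary_mult) (use W V 1 VV' in auto)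
  ultimately show ?case using 2 W(1) V by (intro exI[of _ "W * V"]) auto
qed

section \<open>Subspaces of small codimension and singular values\<close>

text \<open>A property that holds on a subspace of codimension at most \<open>k\<close>, the subspace being given by
  at most \<open>k\<close> linear equations. This takes the place of statements about ranks: bounds for the
  codimension add up under conjunction and are inherited by preimages under any matrix, so no
  dimension of a sum or an intersection has to be computed. The bound is real because it will
  also arise as a quotient of a Frobenius norm by a threshold.\<close>

definition holds_on_codim :: "nat \<Rightarrow> real \<Rightarrow> (complex vec \<Rightarrow> bool) \<Rightarrow> bool" where
  "holds_on_codim n k P \<longleftrightarrow>
     (\<exists>C. finite C \<and> C \<subseteq> carrier_vec n \<and> real (card C) \<le> k \<and>
          (\<forall>x\<in>carrier_vec n. (\<forall>c\<in>C. c \<bullet> x = 0) \<longrightarrow> P x))"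

lemma holds_on_codim_mono:
  assumes "holds_on_codim n k P" "k \<le> l" "\<And>x. x \<in> carrier_vec n \<Longrightarrow> P x \<Longrightarrow> Q x"
  shows "holds_on_codim n l Q"
  using assms unfolding holds_on_codim_def by (meson order_trans)

lemma holds_on_codim_conj:
  assumes "holds_on_codim n k P" "holds_on_codim n l Q"
  shows "holds_on_codim n (k + l) (\<lambda>x. P x \<and> Q x)"
proof -
  obtain C where C: "finite C" "C \<subseteq> carrier_vec n" "real (card C) \<le> k"
      "\<forall>x\<in>carrier_vec n. (\<forall>c\<in>C. c \<bullet> x = 0) \<longrightarrow> P x"
    using assms(1) unfolding holds_on_codim_def by blast
  obtain D where D: "finite D" "D \<subseteq> carrier_vec n" "real (card D) \<le> l"
      "\<forall>x\<in>carrier_vec n. (\<forall>c\<in>D. c \<bullet> x = 0) \<longrightarrow> Q x"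
    using assms(2) unfolding holds_on_codim_def by blast
  have "real (card (C \<union> D)) \<le> real (card C + card D)" using card_Un_le[of C D] by (simp only: of_nat_le_iff)
  then have "real (card (C \<union> D)) \<le> k + l" using C(3) D(3) by simp
  with C D show ?thesis unfolding holds_on_codim_def by (intro exI[of _ "C \<union> D"]) auto
qed

lemma scalar_prod_mult_mat_vec:
  fixes A :: "complex mat"
  assumes A: "A \<in> carrier_mat m n" and c: "c \<in> carrier_vec m" and x: "x \<in> carrier_vec n"
  shows "(transpose_mat A *\<^sub>v c) \<bullet> x = c \<bullet> (A *\<^sub>v x)"
proof -
  have "(transpose_mat A *\<^sub>v c) \<bullet> x = (\<Sum>j<n. \<Sum>i<m. A $$ (i,j) * c $ i * x $ j)"
    using A c x by (auto simp: scalar_prod_def sum_distrib_right lessThan_atLeast0 col_def intro!: sum.cong)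
  also have "\<dots> = (\<Sum>i<m. \<Sum>j<n. A $$ (i,j) * c $ i * x $ j)" by (rule sum.swap)
  also have "\<dots> = c \<bullet> (A *\<^sub>v x)"
    using A c x by (auto simp: scalar_prod_def sum_distrib_left lessThan_atLeast0 row_def mult_ac intro!: sum.cong)
  finally show ?thesis .
qed

lemma holds_on_codim_preimage:
  assumes "holds_on_codim m k P" and A: "A \<in> carrier_mat m n"
  shows "holds_on_codim n k (\<lambda>x. P (A *\<^sub>v x))"
proof -
  obtain C where C: "finite C" "C \<subseteq> carrier_vec m" "real (card C) \<le> k"
      "\<forall>x\<in>carrier_vec m. (\<forall>c\<in>C. c \<bullet> x = 0) \<longrightarrow> P x"
    using assms(1) unfolding holds_on_codim_def by blast
  have "P (A *\<^sub>v x)" if x: "x \<in> carrier_vec n" "\<forall>c\<in>(\<lambda>c. transpose_mat A *\<^sub>v c) ` C. c \<bullet> x = 0" for x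
  proof -
    have "c \<bullet> (A *\<^sub>v x) = 0" if "c \<in> C" for c
      using scalar_prod_mult_mat_vec[OF A _ x(1), of c] C(2) x(2) that by auto
    moreover have "A *\<^sub>v x \<in> carrier_vec m" using A x by auto
    ultimately show ?thesis using C(4) by blast
  qed
  moreover have "real (card ((\<lambda>c. transpose_mat A *\<^sub>v c) ` C)) \<le> k"
    using card_image_le[OF C(1), of "\<lambda>c. transpose_mat A *\<^sub>v c"] C(3) by linarith
  moreover have "(\<lambda>c. transpose_mat A *\<^sub>v c) ` C \<subseteq> carrier_vec n" using A C(2) by auto
  ultimately show ?thesis unfolding holds_on_codim_def using C(1) by blast
qed

lemma holds_on_codim_rows:
  assumes "S \<subseteq> {..<m}" and A: "A \<in> carrier_mat m n"
  shows "holds_on_codim n (card S) (\<lambda>x. \<forall>i\<in>S. (A *\<^sub>v x) $ i = 0)"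
proof -
  have f: "finite S" using assms(1) finite_subset by blast
  show ?thesis unfolding holds_on_codim_def
    by (rule exI[of _ "Matrix.row A ` S"]) (use f assms card_image_le[OF f, of "Matrix.row A"] in auto)
qed

lemma mat_unit_vec_col:
  fixes A :: "complex mat"
  assumes "A \<in> carrier_mat m n" "j < n"
  shows "A *\<^sub>v unit_vec n j = col A j"
  using assms by (intro eq_vecI) auto

text \<open>Fewer equations than unknowns: filled up with zero rows, the coefficient matrix becomes square
  with determinant zero.\<close>

lemma nonzero_solution:
  fixes C :: "complex vec set"
  assumes C: "finite C" "C \<subseteq> carrier_vec n" "card C < n"
  shows "\<exists>a\<in>carrier_vec n. a \<noteq> 0\<^sub>v n \<and> (\<forall>c\<in>C. c \<bullet> a = 0)"
proof -
  obtain cs where cs: "set cs = C" "length cs = card C"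
    using finite_distinct_list[OF C(1)] distinct_card by metis
  define A where "A = mat n n (\<lambda>(i, j). if i < length cs then cs ! i $ j else 0)"
  have A: "A \<in> carrier_mat n n" unfolding A_def by simp
  have "Determinant.det A = 0"
  proof -
    have "Matrix.row A (card C) = 0\<^sub>v n" using cs C(3) unfolding A_def by (intro eq_vecI) auto
    then have "transpose_mat A *\<^sub>v unit_vec n (card C) = 0\<^sub>v n"
      using A C(3) by (simp add: mat_unit_vec_col)
    then have "Determinant.det (transpose_mat A) = 0"
      using A C(3) by (subst det_0_iff_vec_prod_zero[of _ n]) (auto intro!: exI[of _ "unit_vec n (card C)"])
    then show ?thesis using det_transpose[OF A] by simp
  qed
  then obtain a where a: "a \<in> carrier_vec n" "a \<noteq> 0\<^sub>v n" "A *\<^sub>v a = 0\<^sub>v n"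
    using det_0_iff_vec_prod_zero[OF A] by auto
  have "c \<bullet> a = 0" if "c \<in> C" for c
  proof -
    obtain i where i: "i < length cs" "cs ! i = c" using \<open>c \<in> C\<close> cs(1) by (auto simp: in_set_conv_nth)
    then have "i < n" using cs C by simp
    have "c = Matrix.row A i" using i \<open>i < n\<close> \<open>c \<in> C\<close> C(2) unfolding A_def by (intro eq_vecI) auto
    then have "c \<bullet> a = (A *\<^sub>v a) $ i" using A \<open>i < n\<close> by simp
    then show ?thesis using a(3) \<open>i < n\<close> by simp
  qed
  with a show ?thesis by blast
qed

text \<open>Vanishing outside \<open>J\<close> costs \<open>n - card J\<close> further equations, which leaves a nonzero solution.\<close>

lemma holds_on_codim_supported:
  assumes "holds_on_codim n k P" and J: "J \<subseteq> {..<n}" "k < card J"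
  shows "\<exists>a\<in>carrier_vec n. a \<noteq> 0\<^sub>v n \<and> (\<forall>i<n. i \<notin> J \<longrightarrow> a $ i = 0) \<and> P a"
proof -
  obtain C where C: "finite C" "C \<subseteq> carrier_vec n" "real (card C) \<le> k"
      "\<forall>x\<in>carrier_vec n. (\<forall>c\<in>C. c \<bullet> x = 0) \<longrightarrow> P x"
    using assms(1) unfolding holds_on_codim_def by blast
  define D :: "complex vec set" where "D = unit_vec n ` ({..<n} - J)"
  have cJ: "card J \<le> n" using card_mono[OF _ J(1)] by simp
  have "card D \<le> card ({..<n} - J)" unfolding D_def by (intro card_image_le) auto
  also have "\<dots> = n - card J" using J(1) finite_subset[OF J(1)] by (subst card_Diff_subset) auto
  finally have "card (C \<union> D) \<le> card C + (n - card J)" using card_Un_le[of C D] by linarith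
  moreover have "card C < card J" using C(3) J(2) by linarith
  ultimately have "card (C \<union> D) < n" using cJ by linarith
  moreover have "finite (C \<union> D)" "C \<union> D \<subseteq> carrier_vec n" using C unfolding D_def by auto
  ultimately obtain a where a: "a \<in> carrier_vec n" "a \<noteq> 0\<^sub>v n" "\<forall>c\<in>C \<union> D. c \<bullet> a = 0"
    using nonzero_solution[of "C \<union> D" n] by blast
  have "a $ i = 0" if "i < n" "i \<notin> J" for i
  proof -
    have "unit_vec n i \<bullet> a = 0" using a(3) that unfolding D_def by blast
    then show ?thesis using a(1) that by simp
  qed
  with a C(4) show ?thesis by blast
qed

lemma proots_linear_factors: "proots (\<Prod>a\<leftarrow>as. [:- a, 1:]) = mset (as :: complex list)"
proof (induction as)
  case (Cons a as)
  have "(\<Prod>a\<leftarrow>as. [:- a, 1:]) \<noteq> 0" by (auto simp: prod_list_zero_iff)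
  then show ?case using Cons by (simp add: proots_mult del: mult_pCons_left)
qed simp

text \<open>The orthonormal eigenbasis of \<open>M\<^sup>* M\<close> turns the quadratic form \<open>\<parallel>M x\<parallel>\<^sup>2\<close> into a weighted sum of
  squares; the weights are the eigenvalues, hence real and nonnegative.\<close>

lemma singular_value_decomposition:
  fixes M :: "complex mat"
  assumes M: "M \<in> carrier_mat n n"
  obtains U s where "U \<in> carrier_mat n n" "mat_adjoint U * U = 1\<^sub>m n" "\<And>i. s i \<ge> 0"
    "\<And>x. x \<in> carrier_vec n \<Longrightarrow> sqnorm (M *\<^sub>v (U *\<^sub>v x)) = (\<Sum>i<n. (s i)\<^sup>2 * (cmod (x $ i))\<^sup>2)"
    "singular_values M = image_mset s (mset_set {..<n})"
proof -
  define A where "A = mat_adjoint M * M"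
  have A: "A \<in> carrier_mat n n" unfolding A_def using M by (auto intro!: mult_carrier_mat)
  have "mat_adjoint A = A" unfolding A_def using M by (subst mat_adjoint_mult[of _ n n _ n]) auto
  then obtain U e where U: "U \<in> carrier_mat n n" "mat_adjoint U * U = 1\<^sub>m n" "mat_adjoint U * A * U = mat_diag n e"
    using hermitian_spectral[OF A] by blast
  have U': "mat_adjoint U \<in> carrier_mat n n" using U by simp
  have quad: "complex_of_real (sqnorm (M *\<^sub>v (U *\<^sub>v x))) = (\<Sum>i<n. cnj (e i) * (cmod (x $ i))\<^sup>2)"
    if x: "x \<in> carrier_vec n" for x
  proof -
    have M': "mat_adjoint M \<in> carrier_mat n n" using M by simp
    have MU: "M * U \<in> carrier_mat n n" using M U by simp
    have "M *\<^sub>v (U *\<^sub>v x) = (M * U) *\<^sub>v x" using M U x by (subst assoc_mult_mat_vec) auto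
    then have "complex_of_real (sqnorm (M *\<^sub>v (U *\<^sub>v x))) = x \<bullet>c (mat_adjoint (M * U) *\<^sub>v ((M * U) *\<^sub>v x))"
      unfolding sqnorm_cscalar_prod[symmetric] using cscalar_prod_adjoint[OF MU x, of "(M * U) *\<^sub>v x"] MU x by simp
    also have "mat_adjoint (M * U) *\<^sub>v ((M * U) *\<^sub>v x) = (mat_adjoint (M * U) * (M * U)) *\<^sub>v x"
      using MU x by (subst assoc_mult_mat_vec[of _ n n _ n]) auto
    also have "mat_adjoint (M * U) * (M * U) = mat_adjoint U * A * U"
      unfolding A_def mat_adjoint_mult[OF M U(1)] using M M' U U'
      by (simp add: assoc_mult_mat[of _ n n _ n _ n] mult_carrier_mat[of _ n n _ n])
    also have "\<dots> = mat_diag n e" by (rule U(3))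
    also have "x \<bullet>c (mat_diag n e *\<^sub>v x) = (\<Sum>i<n. cnj (e i) * (cmod (x $ i))\<^sup>2)"
    proof -
      have "(mat_diag n e *\<^sub>v x) $ i = e i * x $ i" if "i < n" for i
      proof -
        have "(mat_diag n e *\<^sub>v x) $ i = (\<Sum>j = 0..<n. (if i = j then e j else 0) * x $ j)"
          using that x by (simp add: mat_diag_def scalar_prod_def)
        also have "\<dots> = (\<Sum>j = 0..<n. if i = j then e i * x $ i else 0)" by (intro sum.cong) auto
        finally show ?thesis using that by simp
      qed
      moreover define y where "y = mat_diag n e *\<^sub>v x"
      moreover have y: "y \<in> carrier_vec n" unfolding y_def using x by (intro mult_mat_vec_carrier[of _ n n]) simp_all
      ultimately have "y $ i = e i * x $ i" if "i < n" for i using that by simp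
      moreover have "x \<bullet>c y = (\<Sum>i<n. x $ i * cnj (y $ i))"
        using y x by (simp add: scalar_prod_def lessThan_atLeast0)
      ultimately have "x \<bullet>c y = (\<Sum>i<n. x $ i * cnj (e i * x $ i))" by simp
      also have "\<dots> = (\<Sum>i<n. cnj (e i) * (cmod (x $ i))\<^sup>2)"
        by (simp add: complex_norm_square mult_ac del: of_real_power)
      finally show ?thesis unfolding y_def .
    qed
    finally show ?thesis .
  qed
  have e: "e i = complex_of_real (sqnorm (M *\<^sub>v (U *\<^sub>v unit_vec n i)))" if "i < n" for i
  proof -
    have "(\<Sum>j<n. cnj (e j) * (cmod (unit_vec n i $ j :: complex))\<^sup>2) = (\<Sum>j<n. if j = i then cnj (e i) else 0)"
      using that by (intro sum.cong) (auto simp: unit_vec_def)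
    then have "complex_of_real (sqnorm (M *\<^sub>v (U *\<^sub>v unit_vec n i))) = cnj (e i)"
      using quad[of "unit_vec n i"] that by simp
    then show ?thesis by (metis complex_cnj_cnj complex_cnj_complex_of_real)
  qed
  define s where "s i = sqrt (if i < n then Re (e i) else 0)" for i
  have s: "s i \<ge> 0" for i unfolding s_def using e by auto
  have s2: "complex_of_real ((s i)\<^sup>2) = e i" "cnj (e i) = e i" if "i < n" for i
    unfolding s_def using e[OF that] that by auto
  have nU: "sqnorm (M *\<^sub>v (U *\<^sub>v x)) = (\<Sum>i<n. (s i)\<^sup>2 * (cmod (x $ i))\<^sup>2)" if x: "x \<in> carrier_vec n" for x
  proof -
    have "complex_of_real (sqnorm (M *\<^sub>v (U *\<^sub>v x))) = complex_of_real (\<Sum>i<n. (s i)\<^sup>2 * (cmod (x $ i))\<^sup>2)"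
      unfolding quad[OF x] of_real_sum using s2 by (intro sum.cong) (simp_all only: of_real_mult lessThan_iff)
    then show ?thesis unfolding of_real_eq_iff .
  qed
  have "singular_values M = image_mset s (mset_set {..<n})"
  proof -
    have "similar_mat_wit (mat_diag n e) A (mat_adjoint U) U"
    proof (rule similar_mat_witI[of _ _ n])
      show "mat_diag n e = mat_adjoint U * A * U" by (rule U(3)[symmetric])
    qed (use U(1,2) A U' unitary_right_inverse[OF U(1,2)] in simp_all)
    then have "similar_mat (mat_diag n e) A" unfolding similar_mat_def by blast
    then have "char_poly A = char_poly (mat_diag n e)" by (rule char_poly_similar[symmetric])
    also have "\<dots> = (\<Prod>a\<leftarrow>diag_mat (mat_diag n e). [:- a, 1:])"
      by (rule char_poly_upper_triangular[of _ n]) (auto simp: mat_diag_def upper_triangular_def)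
    also have "diag_mat (mat_diag n e) = map e [0..<n]"
      unfolding diag_mat_def mat_diag_def by simp
    finally have "proots (char_poly A) = mset (map e [0..<n])" by (simp only: proots_linear_factors)
    then have "singular_values M = image_mset (\<lambda>z. sqrt (Re z)) (image_mset e (mset_set {..<n}))"
      unfolding singular_values_def A_def[symmetric] by (simp add: lessThan_atLeast0)
    also have "\<dots> = image_mset s (mset_set {..<n})"
      unfolding multiset.map_comp by (intro image_mset_cong) (auto simp: s_def)
    finally show ?thesis .
  qed
  with U(1,2) s nU show ?thesis by (rule that)
qed

text \<open>A Courant-Fischer argument. If more than \<open>k\<close> singular values exceeded \<open>1 + \<delta>\<close>, the span of the
  corresponding right singular vectors would meet the given subspace in a nonzero \<open>x\<close>, and
  \<open>\<parallel>M x\<parallel> > (1 + \<delta>) \<parallel>x\<parallel>\<close> would contradict \<open>\<parallel>M x - x\<parallel> \<le> \<delta> \<parallel>x\<parallel>\<close>; likewise for those below \<open>1 - \<delta>\<close>.\<close>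

lemma singular_values_near_1:
  fixes M :: "complex mat"
  assumes M: "M \<in> carrier_mat n n" and d: "0 < \<delta>"
    and P: "holds_on_codim n k (\<lambda>x. sqnorm (M *\<^sub>v x - x) \<le> \<delta>\<^sup>2 * sqnorm x)"
  shows "real (size {#s \<in># singular_values M. \<bar>s - 1\<bar> > \<delta>#}) \<le> 2 * k"
proof -
  obtain U s where U: "U \<in> carrier_mat n n" "mat_adjoint U * U = 1\<^sub>m n" and s: "\<And>i. s i \<ge> 0"
    and MU: "\<And>x. x \<in> carrier_vec n \<Longrightarrow> sqnorm (M *\<^sub>v (U *\<^sub>v x)) = (\<Sum>i<n. (s i)\<^sup>2 * (cmod (x $ i))\<^sup>2)"
    and sv: "singular_values M = image_mset s (mset_set {..<n})"
    using singular_value_decomposition[OF M] by blast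
  have tri: "sqrt (sqnorm x) - \<delta> * sqrt (sqnorm x) \<le> sqrt (sqnorm (M *\<^sub>v x)) \<and>
      sqrt (sqnorm (M *\<^sub>v x)) \<le> sqrt (sqnorm x) + \<delta> * sqrt (sqnorm x)"
    if x: "x \<in> carrier_vec n" "sqnorm (M *\<^sub>v x - x) \<le> \<delta>\<^sup>2 * sqnorm x" for x
  proof -
    have Mx: "M *\<^sub>v x \<in> carrier_vec n" using M x by simp
    have L: "sqrt (sqnorm y) = L2_set (\<lambda>i. cmod (y $ i)) {..<n}" if "y \<in> carrier_vec n" for y
      using that unfolding sqnorm_def L2_set_def by simp
    have 1: "sqrt (sqnorm (y + z)) \<le> sqrt (sqnorm y) + sqrt (sqnorm z)"
      if "y \<in> carrier_vec n" "z \<in> carrier_vec n" for y z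
    proof -
      have "sqrt (sqnorm (y + z)) = L2_set (\<lambda>i. cmod (y $ i + z $ i)) {..<n}"
        using that by (subst L) (auto intro!: L2_set_cong)
      also have "\<dots> \<le> L2_set (\<lambda>i. cmod (y $ i) + cmod (z $ i)) {..<n}"
        by (intro L2_set_mono norm_triangle_ineq) auto
      also have "\<dots> \<le> sqrt (sqnorm y) + sqrt (sqnorm z)"
        unfolding L[OF that(1)] L[OF that(2)] by (rule L2_set_triangle_ineq)
      finally show ?thesis .
    qed
    have "sqrt (sqnorm (M *\<^sub>v x - x)) \<le> sqrt (\<delta>\<^sup>2 * sqnorm x)" using x(2) by simp
    also have "\<dots> = \<delta> * sqrt (sqnorm x)" using d by (simp add: real_sqrt_mult)
    finally have 2: "sqrt (sqnorm (M *\<^sub>v x - x)) \<le> \<delta> * sqrt (sqnorm x)" .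
    have "sqnorm (y - z) = sqnorm (z - y)" if "y \<in> carrier_vec n" "z \<in> carrier_vec n" for y z
      using that unfolding sqnorm_def by (auto simp: norm_minus_commute)
    from this[OF x(1) Mx] have 3: "sqnorm (x - M *\<^sub>v x) = sqnorm (M *\<^sub>v x - x)" .
    have "y + (z - y) = z" if "y \<in> carrier_vec n" "z \<in> carrier_vec n" for y z :: "complex vec"
      using that by (intro eq_vecI) auto
    from this[OF x(1) Mx] this[OF Mx x(1)]
    have "x + (M *\<^sub>v x - x) = M *\<^sub>v x" "M *\<^sub>v x + (x - M *\<^sub>v x) = x" .
    then show ?thesis using 1[of x "M *\<^sub>v x - x"] 1[of "M *\<^sub>v x" "x - M *\<^sub>v x"] x Mx 2 3 by auto
  qed
  define P where "P x \<longleftrightarrow> sqnorm (M *\<^sub>v (U *\<^sub>v x) - U *\<^sub>v x) \<le> \<delta>\<^sup>2 * sqnorm (U *\<^sub>v x)" for x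
  have PU: "holds_on_codim n k P"
    unfolding P_def by (rule holds_on_codim_preimage[OF P U(1)])
  define Jp where "Jp = {i. i < n \<and> s i > 1 + \<delta>}"
  define Jm where "Jm = {i. i < n \<and> s i < 1 - \<delta>}"
  have J: "Jp \<subseteq> {..<n}" "Jm \<subseteq> {..<n}" unfolding Jp_def Jm_def by auto
  have "real (card Jp) \<le> k"
  proof (rule ccontr)
    assume "\<not> real (card Jp) \<le> k"
    then obtain a where a: "a \<in> carrier_vec n" "a \<noteq> 0\<^sub>v n" "\<forall>i<n. i \<notin> Jp \<longrightarrow> a $ i = 0" "P a"
      using holds_on_codim_supported[OF PU J(1)] by auto
    have Ua: "U *\<^sub>v a \<in> carrier_vec n" "sqnorm (U *\<^sub>v a) = sqnorm a"
      using U a sqnorm_isometry by auto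
    have pos: "sqnorm a > 0" using sqnorm_pos[OF a(1,2)] .
    have "sqrt (sqnorm (M *\<^sub>v (U *\<^sub>v a))) \<le> (1 + \<delta>) * sqrt (sqnorm a)"
      using tri[OF Ua(1)] a(4) Ua(2) unfolding P_def by (simp add: algebra_simps)
    then have "sqnorm (M *\<^sub>v (U *\<^sub>v a)) \<le> ((1 + \<delta>) * sqrt (sqnorm a))\<^sup>2"
      by (metis sqrt_le_D)
    then have le: "sqnorm (M *\<^sub>v (U *\<^sub>v a)) \<le> (1 + \<delta>)\<^sup>2 * sqnorm a" by (simp add: power_mult_distrib)
    have "(\<Sum>i<n. (1 + \<delta>)\<^sup>2 * (cmod (a $ i))\<^sup>2) < (\<Sum>i<n. (s i)\<^sup>2 * (cmod (a $ i))\<^sup>2)"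
    proof (rule sum_strict_mono_ex1)
      show "\<forall>i\<in>{..<n}. (1 + \<delta>)\<^sup>2 * (cmod (a $ i))\<^sup>2 \<le> (s i)\<^sup>2 * (cmod (a $ i))\<^sup>2"
      proof
        fix i assume "i \<in> {..<n}"
        show "(1 + \<delta>)\<^sup>2 * (cmod (a $ i))\<^sup>2 \<le> (s i)\<^sup>2 * (cmod (a $ i))\<^sup>2"
        proof (cases "i \<in> Jp")
          case True
          then have "(1 + \<delta>)\<^sup>2 \<le> (s i)\<^sup>2" using d unfolding Jp_def by (intro power_mono) auto
          then show ?thesis by (intro mult_right_mono) auto
        qed (use a(3) \<open>i \<in> {..<n}\<close> in simp)
      qed
      obtain i where i: "i < n" "a $ i \<noteq> 0" using a(1,2) by (metis carrier_vecD eq_vecI index_zero_vec(1) zero_carrier_vec)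
      then have "i \<in> Jp" using a(3) by blast
      then have "(1 + \<delta>)\<^sup>2 < (s i)\<^sup>2" using d unfolding Jp_def by (intro power_strict_mono) auto
      then show "\<exists>i\<in>{..<n}. (1 + \<delta>)\<^sup>2 * (cmod (a $ i))\<^sup>2 < (s i)\<^sup>2 * (cmod (a $ i))\<^sup>2"
        using i by (intro bexI[of _ i] mult_strict_right_mono) auto
    qed simp
    moreover have "(\<Sum>i<n. (1 + \<delta>)\<^sup>2 * (cmod (a $ i))\<^sup>2) = (1 + \<delta>)\<^sup>2 * sqnorm a"
      using a(1) unfolding sqnorm_def by (simp add: sum_distrib_left)
    ultimately show False using le MU[OF a(1)] by simp
  qed
  moreover have "real (card Jm) \<le> k"
  proof (rule ccontr)
    assume "\<not> real (card Jm) \<le> k"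
    then obtain a where a: "a \<in> carrier_vec n" "a \<noteq> 0\<^sub>v n" "\<forall>i<n. i \<notin> Jm \<longrightarrow> a $ i = 0" "P a"
      using holds_on_codim_supported[OF PU J(2)] by auto
    have Ua: "U *\<^sub>v a \<in> carrier_vec n" "sqnorm (U *\<^sub>v a) = sqnorm a"
      using U a sqnorm_isometry by auto
    obtain i where i: "i < n" "a $ i \<noteq> 0" using a(1,2) by (metis carrier_vecD eq_vecI index_zero_vec(1) zero_carrier_vec)
    then have iJ: "i \<in> Jm" using a(3) by blast
    then have d1: "0 < 1 - \<delta>" using s[of i] unfolding Jm_def by auto
    have "(1 - \<delta>) * sqrt (sqnorm a) \<le> sqrt (sqnorm (M *\<^sub>v (U *\<^sub>v a)))"
      using tri[OF Ua(1)] a(4) Ua(2) unfolding P_def by (simp add: algebra_simps)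
    then have "((1 - \<delta>) * sqrt (sqnorm a))\<^sup>2 \<le> (sqrt (sqnorm (M *\<^sub>v (U *\<^sub>v a))))\<^sup>2"
      using d1 by (intro power_mono) auto
    then have le: "(1 - \<delta>)\<^sup>2 * sqnorm a \<le> sqnorm (M *\<^sub>v (U *\<^sub>v a))" by (simp add: power_mult_distrib)
    have "(\<Sum>i<n. (s i)\<^sup>2 * (cmod (a $ i))\<^sup>2) < (\<Sum>i<n. (1 - \<delta>)\<^sup>2 * (cmod (a $ i))\<^sup>2)"
    proof (rule sum_strict_mono_ex1)
      show "\<forall>i\<in>{..<n}. (s i)\<^sup>2 * (cmod (a $ i))\<^sup>2 \<le> (1 - \<delta>)\<^sup>2 * (cmod (a $ i))\<^sup>2"
      proof
        fix i assume "i \<in> {..<n}"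
        show "(s i)\<^sup>2 * (cmod (a $ i))\<^sup>2 \<le> (1 - \<delta>)\<^sup>2 * (cmod (a $ i))\<^sup>2"
        proof (cases "i \<in> Jm")
          case True
          then have "(s i)\<^sup>2 \<le> (1 - \<delta>)\<^sup>2" using s unfolding Jm_def by (intro power_mono) auto
          then show ?thesis by (intro mult_right_mono) auto
        qed (use a(3) \<open>i \<in> {..<n}\<close> in simp)
      qed
      have "(s i)\<^sup>2 < (1 - \<delta>)\<^sup>2" using s iJ unfolding Jm_def by (intro power_strict_mono) auto
      then show "\<exists>i\<in>{..<n}. (s i)\<^sup>2 * (cmod (a $ i))\<^sup>2 < (1 - \<delta>)\<^sup>2 * (cmod (a $ i))\<^sup>2"
        using i by (intro bexI[of _ i] mult_strict_right_mono) auto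
    qed simp
    moreover have "(\<Sum>i<n. (1 - \<delta>)\<^sup>2 * (cmod (a $ i))\<^sup>2) = (1 - \<delta>)\<^sup>2 * sqnorm a"
      using a(1) unfolding sqnorm_def by (simp add: sum_distrib_left)
    ultimately show False using le MU[OF a(1)] by simp
  qed
  moreover have "size {#s \<in># singular_values M. \<bar>s - 1\<bar> > \<delta>#} \<le> card Jp + card Jm"
  proof -
    have "size {#s \<in># singular_values M. \<bar>s - 1\<bar> > \<delta>#} = card {i \<in> {..<n}. \<bar>s i - 1\<bar> > \<delta>}"
      unfolding sv filter_mset_image_mset by (simp add: filter_mset_mset_set)
    also have "{i \<in> {..<n}. \<bar>s i - 1\<bar> > \<delta>} \<subseteq> Jp \<union> Jm" unfolding Jp_def Jm_def by auto
    then have "card {i \<in> {..<n}. \<bar>s i - 1\<bar> > \<delta>} \<le> card (Jp \<union> Jm)"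
      by (intro card_mono) (auto simp: Jp_def Jm_def)
    also have "\<dots> \<le> card Jp + card Jm" by (rule card_Un_le)
    finally show ?thesis .
  qed
  ultimately show ?thesis by linarith
qed

text \<open>The squared singular values add up to the squared Frobenius norm, so at most \<open>b / t\<close> of them
  exceed \<open>t\<close>; orthogonality to the corresponding right singular vectors is the required
  system of equations.\<close>

lemma frobenius_small_on_codim:
  fixes N :: "complex mat"
  assumes N: "N \<in> carrier_mat n n" and b: "(\<Sum>i<n. \<Sum>j<n. (cmod (N $$ (i, j)))\<^sup>2) \<le> b" and t: "0 < t"
  shows "holds_on_codim n (b / t) (\<lambda>x. sqnorm (N *\<^sub>v x) \<le> t * sqnorm x)"
proof -
  obtain U s where U: "U \<in> carrier_mat n n" "mat_adjoint U * U = 1\<^sub>m n" and s: "\<And>i. s i \<ge> 0"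
    and NU: "\<And>x. x \<in> carrier_vec n \<Longrightarrow> sqnorm (N *\<^sub>v (U *\<^sub>v x)) = (\<Sum>i<n. (s i)\<^sup>2 * (cmod (x $ i))\<^sup>2)"
    and "singular_values N = image_mset s (mset_set {..<n})"
    using singular_value_decomposition[OF N] by blast
  have U': "mat_adjoint U \<in> carrier_mat n n" using U by simp
  have UU': "U * mat_adjoint U = 1\<^sub>m n" using unitary_right_inverse[OF U] .
  have fro: "(\<Sum>i<n. (s i)\<^sup>2) = (\<Sum>i<n. \<Sum>j<n. (cmod (N $$ (i, j)))\<^sup>2)"
  proof -
    have "(s i)\<^sup>2 = sqnorm (N *\<^sub>v (U *\<^sub>v unit_vec n i))" if "i < n" for i
    proof -
      have "sqnorm (N *\<^sub>v (U *\<^sub>v unit_vec n i)) = (\<Sum>j<n. if j = i then (s i)\<^sup>2 else 0)"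
        unfolding NU[OF unit_vec_carrier] using that by (intro sum.cong) (auto simp: unit_vec_def)
      then show ?thesis using that by simp
    qed
    moreover have "N *\<^sub>v (U *\<^sub>v unit_vec n i) = col (N * U) i" if "i < n" for i
      unfolding mat_unit_vec_col[OF U(1) that] by (rule col_mult2[symmetric, OF N U(1) that])
    ultimately have "(\<Sum>i<n. (s i)\<^sup>2) = (\<Sum>i<n. sqnorm (col (N * U) i))"
      by (intro sum.cong) auto
    also have "\<dots> = (\<Sum>i<n. \<Sum>j<n. (cmod ((N * U) $$ (j, i)))\<^sup>2)"
      using N U unfolding sqnorm_def by (intro sum.cong) auto
    also have "\<dots> = (\<Sum>j<n. \<Sum>i<n. (cmod ((N * U) $$ (j, i)))\<^sup>2)" by (rule sum.swap)
    also have "\<dots> = (\<Sum>j<n. sqnorm (mat_adjoint U *\<^sub>v col (mat_adjoint N) j))"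
    proof (intro sum.cong refl)
      fix j assume j: "j \<in> {..<n}"
      have "mat_adjoint U *\<^sub>v col (mat_adjoint N) j = col (mat_adjoint (N * U)) j"
        unfolding mat_adjoint_mult[OF N U(1)] using U' N j by (intro col_mult2[symmetric, of _ n n _ n]) auto
      then show "(\<Sum>i<n. (cmod ((N * U) $$ (j, i)))\<^sup>2) = sqnorm (mat_adjoint U *\<^sub>v col (mat_adjoint N) j)"
        using N U j unfolding sqnorm_def by auto
    qed
    also have "\<dots> = (\<Sum>j<n. sqnorm (col (mat_adjoint N) j))"
      using N U' UU' by (intro sum.cong refl sqnorm_isometry[of _ n]) (auto intro!: carrier_vecI)
    also have "\<dots> = (\<Sum>i<n. \<Sum>j<n. (cmod (N $$ (i, j)))\<^sup>2)"
      using N unfolding sqnorm_def by (intro sum.cong) auto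
    finally show ?thesis .
  qed
  define J where "J = {i. i < n \<and> (s i)\<^sup>2 > t}"
  have "t * real (card J) = (\<Sum>i\<in>J. t)" by simp
  also have "\<dots> \<le> (\<Sum>i\<in>J. (s i)\<^sup>2)" unfolding J_def by (intro sum_mono) auto
  also have "\<dots> \<le> (\<Sum>i<n. (s i)\<^sup>2)" unfolding J_def by (intro sum_mono2) auto
  finally have cJ: "real (card J) \<le> b / t" using fro b t by (simp add: field_simps)
  have "holds_on_codim n (card J) (\<lambda>x. \<forall>i\<in>J. (mat_adjoint U *\<^sub>v x) $ i = 0)"
    using U' by (intro holds_on_codim_rows[of _ n]) (auto simp: J_def)
  then show ?thesis
  proof (rule holds_on_codim_mono[OF _ cJ])
    fix x assume x: "x \<in> carrier_vec n" and J0: "\<forall>i\<in>J. (mat_adjoint U *\<^sub>v x) $ i = 0"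
    define y where "y = mat_adjoint U *\<^sub>v x"
    have y: "y \<in> carrier_vec n" unfolding y_def using U' x by simp
    have "U *\<^sub>v y = (U * mat_adjoint U) *\<^sub>v x" unfolding y_def using U U' x by (subst assoc_mult_mat_vec) auto
    then have Uy: "U *\<^sub>v y = x" using UU' x by simp
    have "sqnorm (N *\<^sub>v x) = (\<Sum>i<n. (s i)\<^sup>2 * (cmod (y $ i))\<^sup>2)" using NU[OF y] Uy by simp
    also have "\<dots> \<le> (\<Sum>i<n. t * (cmod (y $ i))\<^sup>2)"
    proof (intro sum_mono)
      fix i assume i: "i \<in> {..<n}"
      show "(s i)\<^sup>2 * (cmod (y $ i))\<^sup>2 \<le> t * (cmod (y $ i))\<^sup>2"
      proof (cases "i \<in> J")
        case True then show ?thesis using J0 unfolding y_def by simp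
      next
        case False then show ?thesis using i unfolding J_def by (intro mult_right_mono) auto
      qed
    qed
    also have "\<dots> = t * sqnorm y" using y unfolding sqnorm_def by (simp add: sum_distrib_left)
    also have "sqnorm y = sqnorm x" using sqnorm_isometry[OF U y] Uy by simp
    finally show "sqnorm (N *\<^sub>v x) \<le> t * sqnorm x" .
  qed
qed

section \<open>Circulant and Toeplitz matrices in the Fourier basis\<close>

lemma cis_grid_point_add: "cis (grid_point n (i + j)) = cis (grid_point n i) * cis (grid_point n j)"
  unfolding cis_mult grid_point_def by (simp add: ring_distribs add_divide_distrib)

lemma cis_grid_point_mult: "cis (grid_point n (i * int j)) = cis (grid_point n i) ^ j"
proof -
  have "grid_point n (i * int j) = real j * grid_point n i" unfolding grid_point_def by simp
  then show ?thesis by (simp only: Complex.DeMoivre)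
qed

lemma cnj_cis_grid_point: "cnj (cis (grid_point n i)) = cis (grid_point n (- i))"
  unfolding grid_point_def by (simp add: cis_cnj)

lemma cis_grid_point_eq_1:
  assumes "0 < n"
  shows "cis (grid_point n m) = 1 \<longleftrightarrow> int n dvd m"
proof
  assume "cis (grid_point n m) = 1"
  then have "cos (grid_point n m) = 1" by (metis cis.sel(1) one_complex.sel(1))
  then obtain k :: int where k: "grid_point n m = of_int k * 2 * pi" by (auto simp: cos_one_2pi_int)
  then have "real_of_int m = of_int k * of_int (int n)" using assms unfolding grid_point_def by (simp add: field_simps)
  then have "m = k * int n" by (simp only: of_int_mult[symmetric] of_int_eq_iff)
  then show "int n dvd m" by simp
next
  assume "int n dvd m"
  then obtain k where k: "m = int n * k" by (auto simp: dvd_def)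
  have "grid_point n m = 2 * pi * of_int k" using assms unfolding k grid_point_def by (simp add: field_simps)
  then show "cis (grid_point n m) = 1" using cis_multiple_2pi[of "of_int k"] by simp
qed

lemma sum_cis_grid_point:
  assumes "0 < n"
  shows "(\<Sum>l<n. cis (grid_point n (m * int l))) = (if int n dvd m then of_nat n else 0)"
proof (cases "int n dvd m")
  case True
  then have "cis (grid_point n (m * int l)) = 1" for l
    using cis_grid_point_eq_1[OF assms] by (simp add: dvd_mult2)
  then show ?thesis using True by simp
next
  case False
  define z where "z = cis (grid_point n m)"
  have "z \<noteq> 1" unfolding z_def using False cis_grid_point_eq_1[OF assms] by simp
  moreover have "z ^ n = 1"
    unfolding z_def cis_grid_point_mult[symmetric] using cis_grid_point_eq_1[OF assms] by simp
  ultimately have "(\<Sum>l<n. z ^ l) = 0" by (simp add: geometric_sum)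
  then show ?thesis using False unfolding z_def cis_grid_point_mult by simp
qed

lemma fourier_mat_carrier [simp]: "fourier_mat n \<in> carrier_mat n n"
  unfolding fourier_mat_def by simp

lemma fourier_mat_dim [simp]: "dim_row (fourier_mat n) = n" "dim_col (fourier_mat n) = n"
  unfolding fourier_mat_def by simp_all

lemma fourier_mat_index:
  assumes "j < n" "k < n"
  shows "fourier_mat n $$ (j, k) = complex_of_real (1 / sqrt (real n)) * cis (grid_point n (int j * int k))"
proof -
  have "exp (2 * complex_of_real pi * \<i> / of_nat n) = cis (grid_point n 1)"
    unfolding grid_point_def cis_conv_exp by (simp add: mult_ac)
  then have "exp (2 * complex_of_real pi * \<i> / of_nat n) ^ (j * k) = cis (grid_point n (int j * int k))"
    using cis_grid_point_mult[of n 1 "j * k"] by simp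
  then show ?thesis using assms unfolding fourier_mat_def by simp
qed

lemma inverse_sqrt_sq:
  "0 < n \<Longrightarrow> complex_of_real (1 / sqrt (real n)) * complex_of_real (1 / sqrt (real n)) = 1 / of_nat n"
  unfolding of_real_mult[symmetric] by simp

lemma circulant_carrier [simp]: "circulant n v \<in> carrier_mat n n"
  unfolding circulant_def by (intro mult_carrier_mat[of _ n n] mat_adjoint_carrier) simp_all

lemma circulant_dim [simp]: "dim_row (circulant n v) = n" "dim_col (circulant n v) = n"
  using circulant_carrier[of n v] by blast+

lemma circulant_index:
  assumes j: "j < n" and k: "k < n"
  shows "circulant n v $$ (j, k) = (\<Sum>l<n. v l * cis (grid_point n ((int k - int j) * int l))) / of_nat n"
proof -
  let ?F = "fourier_mat n"
  have n: "0 < n" using j by simp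
  have F: "?F \<in> carrier_mat n n" by simp
  have "circulant n v $$ (j, k) = (mat_adjoint ?F * (mat_diag n v * ?F)) $$ (j, k)"
    unfolding circulant_def by (subst assoc_mult_mat[of _ n n _ n _ n]) simp_all
  also have "mat_diag n v * ?F = mat n n (\<lambda>(i, j). v i * ?F $$ (i, j))" by (rule mat_diag_mult_left) simp
  also have "(mat_adjoint ?F * mat n n (\<lambda>(i, j). v i * ?F $$ (i, j))) $$ (j, k)
      = (\<Sum>l<n. cnj (?F $$ (l, j)) * (v l * ?F $$ (l, k)))"
    using j k by (simp add: scalar_prod_def lessThan_atLeast0)
  also have "\<dots> = (\<Sum>l<n. v l * cis (grid_point n ((int k - int j) * int l)) / of_nat n)"
  proof (intro sum.cong refl)
    fix l assume "l \<in> {..<n}"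
    then have l: "l < n" by simp
    have "cnj (?F $$ (l, j)) * (v l * ?F $$ (l, k)) =
        complex_of_real (1 / sqrt (real n)) * complex_of_real (1 / sqrt (real n)) * v l *
        (cnj (cis (grid_point n (int l * int j))) * cis (grid_point n (int l * int k)))"
      unfolding fourier_mat_index[OF l j] fourier_mat_index[OF l k] complex_cnj_mult complex_cnj_complex_of_real
      by (simp only: mult_ac)
    also have "cnj (cis (grid_point n (int l * int j))) * cis (grid_point n (int l * int k)) =
        cis (grid_point n ((int k - int j) * int l))"
      unfolding cnj_cis_grid_point cis_grid_point_add[symmetric] by (simp add: algebra_simps)
    finally show "cnj (?F $$ (l, j)) * (v l * ?F $$ (l, k)) = v l * cis (grid_point n ((int k - int j) * int l)) / of_nat n"
      unfolding inverse_sqrt_sq[OF n] by simp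
  qed
  finally show ?thesis by (simp add: sum_divide_distrib)
qed

lemma fourier_mat_unitary: "mat_adjoint (fourier_mat n) * fourier_mat n = 1\<^sub>m n"
proof (rule eq_matI)
  fix j k assume "j < dim_row (1\<^sub>m n :: complex mat)" "k < dim_col (1\<^sub>m n :: complex mat)"
  then have jk: "j < n" "k < n" and n: "0 < n" by auto
  have "mat_adjoint (fourier_mat n) * fourier_mat n = circulant n (\<lambda>_. 1)"
    unfolding circulant_def mat_diag_one by (subst right_mult_one_mat[of _ n n]) simp_all
  then have "(mat_adjoint (fourier_mat n) * fourier_mat n) $$ (j, k)
      = (\<Sum>l<n. cis (grid_point n ((int k - int j) * int l))) / of_nat n"
    using circulant_index[OF jk, of "\<lambda>_. 1"] by simp
  also have "\<dots> = (if int n dvd int k - int j then 1 else 0)"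
    unfolding sum_cis_grid_point[OF n] using n by simp
  also have "int n dvd int k - int j \<longleftrightarrow> j = k"
  proof
    assume "int n dvd int k - int j"
    moreover have "\<bar>int k - int j\<bar> < int n" using jk by linarith
    ultimately have "int k - int j = 0" using dvd_imp_le_int[of "int k - int j" "int n"] by force
    then show "j = k" by simp
  qed simp
  finally show "(mat_adjoint (fourier_mat n) * fourier_mat n) $$ (j, k) = 1\<^sub>m n $$ (j, k)" using jk by auto
qed (use fourier_mat_carrier[of n] in auto)

lemma sqnorm_fourier_mat: "x \<in> carrier_vec n \<Longrightarrow> sqnorm (fourier_mat n *\<^sub>v x) = sqnorm x"
  by (rule sqnorm_isometry[OF fourier_mat_carrier fourier_mat_unitary])

text \<open>A circulant matrix acts diagonally in the Fourier basis. All later computations with circulant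
  matrices use only this.\<close>

lemma fourier_mat_circulant:
  assumes x: "x \<in> carrier_vec n" and i: "i < n"
  shows "(fourier_mat n *\<^sub>v (circulant n v *\<^sub>v x)) $ i = v i * (fourier_mat n *\<^sub>v x) $ i"
proof -
  let ?F = "fourier_mat n"
  have F: "?F \<in> carrier_mat n n" "mat_adjoint ?F \<in> carrier_mat n n" by simp_all
  define y where "y = ?F *\<^sub>v x"
  have y: "y \<in> carrier_vec n" unfolding y_def by (rule mult_mat_vec_carrier[OF F(1) x])
  have D: "mat_diag n v \<in> carrier_mat n n" by simp
  have Dy: "mat_diag n v *\<^sub>v y \<in> carrier_vec n" by (rule mult_mat_vec_carrier[OF D y])
  have "circulant n v *\<^sub>v x = mat_adjoint ?F *\<^sub>v (mat_diag n v *\<^sub>v y)"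
    unfolding circulant_def assoc_mult_mat_vec[OF mult_carrier_mat[OF F(2) D] F(1) x]
      y_def[symmetric] assoc_mult_mat_vec[OF F(2) D y] ..
  then have "?F *\<^sub>v (circulant n v *\<^sub>v x) = (?F * mat_adjoint ?F) *\<^sub>v (mat_diag n v *\<^sub>v y)"
    using assoc_mult_mat_vec[OF F(1) F(2) Dy] by simp
  also have "\<dots> = mat_diag n v *\<^sub>v y"
    unfolding unitary_right_inverse[OF F(1) fourier_mat_unitary] using Dy by simp
  also have "(mat_diag n v *\<^sub>v y) $ i = (\<Sum>j = 0..<n. (if i = j then v j else 0) * y $ j)"
    using i y by (simp add: mat_diag_def scalar_prod_def)
  also have "\<dots> = (\<Sum>j = 0..<n. if i = j then v i * y $ i else 0)" by (intro sum.cong) auto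
  finally show ?thesis using i unfolding y_def by simp
qed

lemma sqnorm_circulant:
  assumes x: "x \<in> carrier_vec n"
  shows "sqnorm (circulant n v *\<^sub>v x) = (\<Sum>i<n. (cmod (v i * (fourier_mat n *\<^sub>v x) $ i))\<^sup>2)"
proof -
  have Cx: "circulant n v *\<^sub>v x \<in> carrier_vec n" by (rule mult_mat_vec_carrier[OF _ x]) simp
  have d: "dim_vec (fourier_mat n *\<^sub>v (circulant n v *\<^sub>v x)) = n"
    by simp
  show ?thesis unfolding sqnorm_fourier_mat[OF Cx, symmetric]
    unfolding sqnorm_def d using fourier_mat_circulant[OF x] by (intro sum.cong) auto
qed

lemma vec_eq_fourier_mat:
  assumes x: "x \<in> carrier_vec n" and y: "y \<in> carrier_vec n"
    and eq: "\<And>i. i < n \<Longrightarrow> (fourier_mat n *\<^sub>v x) $ i = (fourier_mat n *\<^sub>v y) $ i"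
  shows "x = y"
proof -
  let ?F = "fourier_mat n"
  have F: "?F \<in> carrier_mat n n" "mat_adjoint ?F \<in> carrier_mat n n" by simp_all
  have Fx: "?F *\<^sub>v x \<in> carrier_vec n" "?F *\<^sub>v y \<in> carrier_vec n"
    using mult_mat_vec_carrier[OF F(1)] x y by auto
  have "?F *\<^sub>v x = ?F *\<^sub>v y" using eq Fx by (intro eq_vecI) (auto simp del: index_mult_mat_vec)
  then have "mat_adjoint ?F *\<^sub>v (?F *\<^sub>v x) = mat_adjoint ?F *\<^sub>v (?F *\<^sub>v y)" by simp
  then show ?thesis
    unfolding assoc_mult_mat_vec[OF F(2) F(1) x, symmetric] assoc_mult_mat_vec[OF F(2) F(1) y, symmetric] fourier_mat_unitary
    using x y by simp
qed

text \<open>With the Fourier coefficients of \<open>h\<close> for \<open>u\<close> this is the Fourier expansion; arbitrary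
  coefficients are needed for differences of such expansions.\<close>

definition trig_sum :: "nat \<Rightarrow> (int \<Rightarrow> complex) \<Rightarrow> real \<Rightarrow> complex" where
  "trig_sum n u x = (\<Sum>k\<in>{- int n + 1 .. int n - 1}. u k * exp (\<i> * of_int k * of_real x))"

text \<open>Aliasing: on the grid, frequencies that differ by a multiple of \<open>n\<close> coincide. An entry of the
  circulant matrix thus collects all coefficients whose index is congruent to \<open>j - k\<close> modulo
  \<open>n\<close>, and in the given range there is at most one besides the Toeplitz entry itself.\<close>

lemma circulant_trig_sum_index:
  assumes j: "j < n" and k: "k < n"
  shows "circulant n (\<lambda>l. trig_sum n u (grid_point n (int l))) $$ (j, k) =
    u (int j - int k) + (if k < j then u (int j - int k - int n) else if j < k then u (int j - int k + int n) else 0)"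
proof -
  have n: "0 < n" using j by simp
  let ?I = "{- int n + 1 .. int n - 1}"
  define d where "d = int j - int k"
  have dn: "\<bar>d\<bar> < int n" unfolding d_def using j k by linarith
  have "circulant n (\<lambda>l. trig_sum n u (grid_point n (int l))) $$ (j, k) =
      (\<Sum>l<n. (\<Sum>m\<in>?I. u m * cis (grid_point n ((m - d) * int l)))) / of_nat n"
    unfolding circulant_index[OF j k]
  proof (intro arg_cong2[where f = "(/)"] sum.cong refl)
    fix l
    have "trig_sum n u (grid_point n (int l)) = (\<Sum>m\<in>?I. u m * cis (grid_point n (m * int l)))"
      unfolding trig_sum_def
    proof (intro sum.cong refl)
      fix m
      have "of_int m * grid_point n (int l) = grid_point n (m * int l)" unfolding grid_point_def by simp
      then show "u m * exp (\<i> * of_int m * of_real (grid_point n (int l))) = u m * cis (grid_point n (m * int l))"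
        unfolding cis_conv_exp by (metis mult.assoc of_real_mult of_real_of_int_eq)
    qed
    then show "trig_sum n u (grid_point n (int l)) * cis (grid_point n ((int k - int j) * int l)) =
        (\<Sum>m\<in>?I. u m * cis (grid_point n ((m - d) * int l)))"
      unfolding d_def by (simp add: sum_distrib_right mult.assoc cis_grid_point_add[symmetric] ring_distribs diff_diff_eq2
          add_diff_eq diff_add_eq flip: left_diff_distrib distrib_right)
  qed
  also have "\<dots> = (\<Sum>m\<in>?I. \<Sum>l<n. u m * cis (grid_point n ((m - d) * int l))) / of_nat n"
    by (subst sum.swap) (rule refl)
  also have "\<dots> = (\<Sum>m\<in>?I. u m * (if int n dvd m - d then of_nat n else 0)) / of_nat n"
    unfolding sum_distrib_left[symmetric] sum_cis_grid_point[OF n] ..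
  also have "\<dots> = (\<Sum>m\<in>?I. if int n dvd m - d then u m else 0)"
    unfolding sum_divide_distrib using n by (intro sum.cong) auto
  also have "\<dots> = (\<Sum>m\<in>{m \<in> ?I. int n dvd m - d}. u m)" by (rule sum.inter_filter[symmetric]) simp
  also have "{m \<in> ?I. int n dvd m - d} = (if 0 < d then {d, d - int n} else if d < 0 then {d, d + int n} else {0})"
    (is "?L = ?R")
  proof
    show "?R \<subseteq> ?L" using dn by (auto split: if_splits)
    show "?L \<subseteq> ?R"
    proof
      fix m assume m: "m \<in> ?L"
      then obtain q where q: "m - d = int n * q" by (auto simp: dvd_def)
      have b: "\<bar>m\<bar> < int n" using m by auto
      have "\<bar>int n * q\<bar> < int n * 2" using q b dn by linarith
      then have "\<bar>q\<bar> < 2" using n by (simp add: abs_mult)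
      then have "q = -1 \<or> q = 0 \<or> q = 1" by linarith
      then show "m \<in> ?R" using q b dn by auto
    qed
  qed
  also have "(\<Sum>m\<in>\<dots>. u m) = u d + (if 0 < d then u (d - int n) else if d < 0 then u (d + int n) else 0)"
    using n by auto
  finally show ?thesis unfolding d_def by auto
qed

text \<open>Up to the factor \<open>n\<close>, the sum of the squared samples is the squared norm of the first column of
  the circulant matrix with these eigenvalues. The factor \<open>2\<close> arises because up to two
  coefficients are aliased into one entry.\<close>

lemma discrete_parseval_le:
  assumes n: "0 < n"
  shows "(\<Sum>l<n. (cmod (trig_sum n u (grid_point n (int l))))\<^sup>2) \<le>
    2 * real n * (\<Sum>k\<in>{- int n + 1 .. int n - 1}. (cmod (u k))\<^sup>2)"
proof -
  define v where "v l = trig_sum n u (grid_point n (int l))" for l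
  define e where "e = (unit_vec n 0 :: complex vec)"
  have e: "e \<in> carrier_vec n" unfolding e_def by simp
  have "sqnorm (circulant n v *\<^sub>v e) = (\<Sum>l<n. (cmod (v l))\<^sup>2 / real n)"
    unfolding sqnorm_circulant[OF e]
  proof (intro sum.cong refl)
    fix l assume "l \<in> {..<n}"
    then have l: "l < n" by simp
    have "(fourier_mat n *\<^sub>v e) $ l = fourier_mat n $$ (l, 0)"
      unfolding e_def using n l fourier_mat_carrier[of n] by (subst mat_unit_vec_col[of _ n n]) auto
    also have "\<dots> = complex_of_real (1 / sqrt (real n))"
      unfolding fourier_mat_index[OF l n] by (simp add: grid_point_def)
    finally show "(cmod (v l * (fourier_mat n *\<^sub>v e) $ l))\<^sup>2 = (cmod (v l))\<^sup>2 / real n"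
      using n by (simp add: norm_mult norm_divide power_mult_distrib power_divide)
  qed
  then have "(\<Sum>l<n. (cmod (v l))\<^sup>2) = real n * sqnorm (circulant n v *\<^sub>v e)"
    using n by (simp flip: sum_divide_distrib)
  also have "circulant n v *\<^sub>v e = col (circulant n v) 0"
    unfolding e_def using n by (intro mat_unit_vec_col[of _ n n]) simp_all
  also have "sqnorm (col (circulant n v) 0) = (\<Sum>j<n. (cmod (u (int j) + (if 0 < j then u (int j - int n) else 0)))\<^sup>2)"
    unfolding sqnorm_def using circulant_carrier[of n v] n circulant_trig_sum_index[of _ n 0 u]
    by (auto simp: v_def[abs_def] intro!: sum.cong)
  also have "\<dots> \<le> (\<Sum>j<n. 2 * (cmod (u (int j)))\<^sup>2 + 2 * (if 0 < j then (cmod (u (int j - int n)))\<^sup>2 else 0))"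
  proof (intro sum_mono)
    fix j
    have "(cmod (a + b))\<^sup>2 \<le> 2 * (cmod a)\<^sup>2 + 2 * (cmod b)\<^sup>2" for a b
    proof -
      have "(cmod (a + b))\<^sup>2 \<le> (cmod a + cmod b)\<^sup>2" by (intro power_mono norm_triangle_ineq) auto
      also have "\<dots> \<le> 2 * (cmod a)\<^sup>2 + 2 * (cmod b)\<^sup>2" using zero_le_power2[of "cmod a - cmod b"]
        by (simp add: power2_eq_square algebra_simps)
      finally show ?thesis .
    qed
    then show "(cmod (u (int j) + (if 0 < j then u (int j - int n) else 0)))\<^sup>2 \<le>
      2 * (cmod (u (int j)))\<^sup>2 + 2 * (if 0 < j then (cmod (u (int j - int n)))\<^sup>2 else 0)" by auto
  qed
  also have "\<dots> = 2 * (\<Sum>k\<in>{- int n + 1 .. int n - 1}. (cmod (u k))\<^sup>2)"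
  proof -
    have s: "{- int n + 1 .. int n - 1} = int ` {..<n} \<union> (\<lambda>j. int j - int n) ` {1..<n}" (is "?L = ?R")
    proof
      show "?R \<subseteq> ?L" using n by auto
      show "?L \<subseteq> ?R"
      proof
        fix k assume k: "k \<in> ?L"
        show "k \<in> ?R"
        proof (cases "0 \<le> k")
          case True then show ?thesis using k by (auto intro!: image_eqI[of _ _ "nat k"])
        next
          case False then show ?thesis using k by (auto intro!: image_eqI[of _ _ "nat (k + int n)"])
        qed
      qed
    qed
    have "(\<Sum>j<n. if 0 < j then (cmod (u (int j - int n)))\<^sup>2 else 0) = (\<Sum>j\<in>{1..<n}. (cmod (u (int j - int n)))\<^sup>2)"
      by (intro sum.mono_neutral_cong_right) auto
    moreover have "(\<Sum>k\<in>{- int n + 1 .. int n - 1}. (cmod (u k))\<^sup>2) =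
        (\<Sum>j<n. (cmod (u (int j)))\<^sup>2) + (\<Sum>j\<in>{1..<n}. (cmod (u (int j - int n)))\<^sup>2)"
      unfolding s by (subst sum.union_disjoint) (auto simp: sum.reindex inj_on_def)
    ultimately show ?thesis by (simp add: sum.distrib flip: sum_distrib_left)
  qed
  finally show ?thesis unfolding v_def using n by (simp add: mult_ac)
qed

lemma sum_subdiagonals:
  fixes a :: "nat \<Rightarrow> real"
  shows "(\<Sum>j<n. \<Sum>k<j. a (n - (j - k))) = (\<Sum>m<n. real m * a m)"
proof -
  have "(\<Sum>j<n. \<Sum>k<j. a (n - (j - k))) = (\<Sum>(j, k)\<in>(SIGMA j:{..<n}. {..<j}). a (n - (j - k)))"
    by (rule sum.Sigma) auto
  also have "\<dots> = (\<Sum>(m, k)\<in>(SIGMA m:{..<n}. {..<m}). a m)"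
    by (rule sum.reindex_bij_witness[where i = "\<lambda>(m, k). (n - m + k, k)" and j = "\<lambda>(j, k). (n - (j - k), k)"]) auto
  also have "\<dots> = (\<Sum>m<n. \<Sum>k<m. a m)" by (rule sum.Sigma[symmetric]) auto
  finally show ?thesis by simp
qed

lemma toeplitz_carrier [simp]: "toeplitz n h \<in> carrier_mat n n"
  unfolding toeplitz_def by simp

lemma toeplitz_dim [simp]: "dim_row (toeplitz n h) = n" "dim_col (toeplitz n h) = n"
  unfolding toeplitz_def by simp_all

lemma toeplitz_minus_circulant_index:
  assumes "j < n" "k < n"
  shows "(toeplitz n h - circulant n (\<lambda>l. fourier_expansion n h (grid_point n (int l)))) $$ (j, k) =
    - (if k < j then fourier_coeff h (int j - int k - int n)
       else if j < k then fourier_coeff h (int j - int k + int n) else 0)"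
proof -
  have "fourier_expansion n h = trig_sum n (fourier_coeff h)"
    unfolding fourier_expansion_def trig_sum_def by auto
  then have C: "circulant n (\<lambda>l. fourier_expansion n h (grid_point n (int l))) $$ (j, k) =
    fourier_coeff h (int j - int k) + (if k < j then fourier_coeff h (int j - int k - int n)
       else if j < k then fourier_coeff h (int j - int k + int n) else 0)"
    using circulant_trig_sum_index[OF assms, of "fourier_coeff h"] by simp
  have T: "toeplitz n h $$ (j, k) = fourier_coeff h (int j - int k)" using assms unfolding toeplitz_def by simp
  show ?thesis using assms C T by simp
qed

text \<open>The difference consists of the aliased coefficients only: \<open>t\<^sub>m\<close> appears on a diagonal of length
  \<open>\<bar>m\<bar>\<close>. Hence the low frequencies, which carry most of the mass, get small weights.\<close>

lemma toeplitz_minus_circulant_frobenius: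
  "(\<Sum>j<n. \<Sum>k<n. (cmod ((toeplitz n h - circulant n (\<lambda>l. fourier_expansion n h (grid_point n (int l)))) $$ (j, k)))\<^sup>2)
     = (\<Sum>m<n. real m * ((cmod (fourier_coeff h (int m)))\<^sup>2 + (cmod (fourier_coeff h (- int m)))\<^sup>2))"
proof -
  define a b where "a m = (cmod (fourier_coeff h (- int m)))\<^sup>2" and "b m = (cmod (fourier_coeff h (int m)))\<^sup>2" for m
  have "(\<Sum>j<n. \<Sum>k<n. (cmod ((toeplitz n h - circulant n (\<lambda>l. fourier_expansion n h (grid_point n (int l)))) $$ (j, k)))\<^sup>2)
      = (\<Sum>j<n. \<Sum>k<n. (if k < j then a (n - (j - k)) else 0) + (if j < k then b (n - (k - j)) else 0))"
  proof (intro sum.cong refl)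
    fix j k assume "j \<in> {..<n}" "k \<in> {..<n}"
    then have jk: "j < n" "k < n" by auto
    have "int j - int k - int n = - int (n - (j - k))" if "k < j" using that jk by auto
    moreover have "int j - int k + int n = int (n - (k - j))" if "j < k" using that jk by auto
    ultimately show "(cmod ((toeplitz n h - circulant n (\<lambda>l. fourier_expansion n h (grid_point n (int l)))) $$ (j, k)))\<^sup>2
      = (if k < j then a (n - (j - k)) else 0) + (if j < k then b (n - (k - j)) else 0)"
      unfolding toeplitz_minus_circulant_index[OF jk] a_def b_def by auto
  qed
  also have "\<dots> = (\<Sum>j<n. \<Sum>k<n. if k < j then a (n - (j - k)) else 0) + (\<Sum>j<n. \<Sum>k<n. if j < k then b (n - (k - j)) else 0)"
    by (simp add: sum.distrib)
  also have "(\<Sum>j<n. \<Sum>k<n. if k < j then a (n - (j - k)) else 0) = (\<Sum>j<n. \<Sum>k<j. a (n - (j - k)))"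
    by (intro sum.cong refl sum.mono_neutral_cong_right) auto
  also have "(\<Sum>j<n. \<Sum>k<n. if j < k then b (n - (k - j)) else 0) = (\<Sum>k<n. \<Sum>j<n. if j < k then b (n - (k - j)) else 0)"
    by (rule sum.swap)
  also have "\<dots> = (\<Sum>j<n. \<Sum>k<j. b (n - (j - k)))"
    by (intro sum.cong refl sum.mono_neutral_cong_right) auto
  finally show ?thesis unfolding sum_subdiagonals unfolding a_def b_def by (simp add: sum.distrib ring_distribs)
qed

text \<open>For a banded Toeplitz matrix the aliased coefficients occur only in the first and the last
  \<open>d\<close> rows. The size of the entries does not enter, so that the estimate is uniform in the
  symbol as long as its degree is bounded.\<close>

lemma toeplitz_circulant_banded:
  assumes band: "\<And>k. \<bar>k\<bar> > int d \<Longrightarrow> fourier_coeff h k = 0"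
    and C: "C = circulant n (\<lambda>l. fourier_expansion n h (grid_point n (int l)))"
  shows "holds_on_codim n (2 * real d) (\<lambda>x. toeplitz n h *\<^sub>v x = C *\<^sub>v x)"
proof -
  define D where "D = toeplitz n h - C"
  have Cc: "C \<in> carrier_mat n n" unfolding C by simp
  have D: "D \<in> carrier_mat n n" unfolding D_def using Cc by (intro minus_carrier_mat)
  define S where "S = {j. j < n \<and> (j < d \<or> n \<le> j + d)}"
  have "S \<subseteq> {..<d} \<union> {n - d..<n}" unfolding S_def by auto
  then have "card S \<le> card ({..<d} \<union> {n - d..<n})" by (intro card_mono) auto
  also have "\<dots> \<le> card {..<d} + card {n - d..<n}" by (rule card_Un_le)
  also have "\<dots> \<le> 2 * d" by simp
  finally have cS: "real (card S) \<le> 2 * real d" by linarith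
  have "holds_on_codim n (card S) (\<lambda>x. \<forall>i\<in>S. (D *\<^sub>v x) $ i = 0)"
    by (rule holds_on_codim_rows[OF _ D]) (auto simp: S_def)
  then show ?thesis
  proof (rule holds_on_codim_mono[OF _ cS])
    fix x assume x: "x \<in> carrier_vec n" and S0: "\<forall>i\<in>S. (D *\<^sub>v x) $ i = 0"
    have "(D *\<^sub>v x) $ i = 0" if i: "i < n" for i
    proof (cases "i \<in> S")
      case False
      have "D $$ (i, k) = 0" if k: "k < n" for k
        unfolding D_def C toeplitz_minus_circulant_index[OF i k]
        using False i k by (auto simp: S_def intro!: band)
      then have "Matrix.row D i = 0\<^sub>v n" using D i by (intro eq_vecI) auto
      then show ?thesis using D i x by simp
    qed (use S0 in blast)
    moreover have "(D *\<^sub>v x) $ i = (toeplitz n h *\<^sub>v x) $ i - (C *\<^sub>v x) $ i" if i: "i < n" for i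
      unfolding D_def minus_mult_distrib_mat_vec[OF toeplitz_carrier Cc x]
      using i Cc by simp
    ultimately show "toeplitz n h *\<^sub>v x = C *\<^sub>v x"
      using Cc by (intro eq_vecI) (auto simp del: index_mult_mat_vec)
  qed
qed

section \<open>Fourier coefficients and Bessel's inequality\<close>

text \<open>The terms with \<open>m < d\<close> have weights at most \<open>d / n\<close>, which tend to \<open>0\<close>, and the others are
  part of the tail of a convergent series.\<close>

lemma cesaro_weighted_tendsto_0:
  fixes a :: "nat \<Rightarrow> real"
  assumes nonneg: "\<And>m. 0 \<le> a m" and bdd: "\<And>n. (\<Sum>m<n. a m) \<le> B"
  shows "(\<lambda>n. (\<Sum>m<n. real m * a m) / real n) \<longlonglongrightarrow> 0"
proof (rule LIMSEQ_I)
  fix r :: real assume r: "0 < r"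
  have "summable a" by (rule summableI_nonneg_bounded[OF nonneg bdd])
  then have "\<exists>d. \<forall>m\<ge>d. \<forall>n. norm (sum a {m..<n}) < r / 2"
    unfolding summable_Cauchy by (elim allE[of _ "r / 2"]) (use r in simp)
  then obtain d where d: "\<And>m n. d \<le> m \<Longrightarrow> norm (sum a {m..<n}) < r / 2" by auto
  have B: "0 \<le> B" using bdd[of 0] by simp
  define N where "N = nat \<lceil>2 * real d * B / r\<rceil> + 1"
  have "norm ((\<Sum>m<n. real m * a m) / real n - 0) < r" if n: "N \<le> n" for n
  proof -
    have n0: "0 < real n" using n unfolding N_def by simp
    have "2 * real d * B / r < real n" using n unfolding N_def by linarith
    then have dB: "real d * B < r / 2 * real n" using r by (simp add: field_simps)
    have "(\<Sum>m<n. real m * a m) \<le> (\<Sum>m<n. real d * a m + (if d \<le> m then real n * a m else 0))"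
      using nonneg by (intro sum_mono) (auto intro!: mult_right_mono add_increasing simp: mult_nonneg_nonneg)
    also have "\<dots> = real d * (\<Sum>m<n. a m) + real n * (\<Sum>m\<in>{d..<n}. a m)"
    proof -
      have "(\<Sum>m<n. if d \<le> m then real n * a m else 0) = (\<Sum>m\<in>{d..<n}. real n * a m)"
        by (intro sum.mono_neutral_cong_right) auto
      then show ?thesis by (simp add: sum.distrib sum_distrib_left)
    qed
    also have "\<dots> \<le> real d * B + real n * (r / 2)"
      using bdd[of n] d[of d n] n0 by (intro add_mono mult_left_mono) auto
    also have "\<dots> < r * real n" using dB by (simp add: algebra_simps)
    finally have "(\<Sum>m<n. real m * a m) < r * real n" .
    moreover have "0 \<le> (\<Sum>m<n. real m * a m)" using nonneg by (intro sum_nonneg) auto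
    ultimately show ?thesis using n0 by (simp add: field_simps)
  qed
  then show "\<exists>N. \<forall>n\<ge>N. norm ((\<Sum>m<n. real m * a m) / real n - 0) < r" by blast
qed

lemma integral_exp_int:
  "(LBINT x:{-pi..pi}. exp (\<i> * of_int m * of_real x)) = (if m = 0 then 2 * of_real pi else 0)"
proof (cases "m = 0")
  case True
  then show ?thesis by (simp add: set_lebesgue_integral_def scaleR_conv_of_real mult.commute)
next
  case False
  define F where "F x = exp (\<i> * of_int m * of_real x) / (\<i> * of_int m)" for x :: real
  have "(F has_vector_derivative exp (\<i> * of_int m * of_real x)) (at x within {-pi..pi})" for x
    unfolding F_def
    by (rule has_vector_derivative_real_field)
       (use False in \<open>auto intro!: derivative_eq_intros\<close>)
  then have "(LBINT x:{-pi..pi}. exp (\<i> * of_int m * of_real x)) = F pi - F (- pi)"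
    unfolding set_lebesgue_integral_def
    by (intro integral_FTC_atLeastAtMost) (auto intro!: continuous_intros)
  also have "\<dots> = 0"
  proof -
    have "exp (\<i> * of_int m * of_real pi) = exp (\<i> * of_int m * of_real (- pi)) * exp (2 * of_int m * of_real pi * \<i>)"
      unfolding exp_add[symmetric] by (simp add: algebra_simps)
    also have "exp (2 * of_int m * of_real pi * \<i>) = (1 :: complex)"
      by (auto simp: exp_eq_1)
    finally show ?thesis unfolding F_def by simp
  qed
  finally show ?thesis using False by simp
qed

lemma set_integrable_mult_exp:
  assumes "set_integrable lborel {-pi..pi} h"
  shows "set_integrable lborel {-pi..pi} (\<lambda>x. h x * exp (\<i> * of_int m * of_real x))"
proof (rule set_integrable_bound[OF assms])
  have "(\<lambda>x. indicat_real {-pi..pi} x *\<^sub>R h x) \<in> borel_measurable lborel"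
    using assms unfolding set_integrable_def by (rule borel_measurable_integrable)
  moreover have "(\<lambda>x::real. exp (\<i> * of_int m * of_real x)) \<in> borel_measurable lborel"
    by (simp add: borel_measurable_continuous_onI continuous_intros)
  ultimately have "(\<lambda>x. indicat_real {-pi..pi} x *\<^sub>R h x * exp (\<i> * of_int m * of_real x)) \<in> borel_measurable lborel"
    by (rule borel_measurable_times)
  then show "set_borel_measurable lborel {-pi..pi} (\<lambda>x. h x * exp (\<i> * of_int m * of_real x))"
    unfolding set_borel_measurable_def by simp
  show "AE x in lborel. x \<in> {-pi..pi} \<longrightarrow> norm (h x * exp (\<i> * of_int m * of_real x)) \<le> norm (h x)"
    by (auto simp: norm_mult)
qed

lemma fourier_coeff_integral:
  "(LBINT x:{-pi..pi}. h x * exp (\<i> * of_int (- k) * of_real x)) = 2 * of_real pi * fourier_coeff h k"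
  unfolding fourier_coeff_def by simp

lemma fourier_coeff_diff:
  assumes "set_integrable lborel {-pi..pi} h" "set_integrable lborel {-pi..pi} g"
  shows "fourier_coeff (\<lambda>x. h x - g x) k = fourier_coeff h k - fourier_coeff g k"
proof -
  have "2 * of_real pi * fourier_coeff (\<lambda>x. h x - g x) k = 2 * of_real pi * (fourier_coeff h k - fourier_coeff g k)"
    unfolding fourier_coeff_integral[symmetric] right_diff_distrib left_diff_distrib
    by (rule set_integral_diff(2)) (intro set_integrable_mult_exp assms)+
  then show ?thesis by simp
qed

lemma set_integral_sum_exp:
  assumes h: "set_integrable lborel {-pi..pi} h" and I: "finite I"
  shows "set_integrable lborel {-pi..pi} (\<lambda>x. h x * (\<Sum>k\<in>I. c k * exp (\<i> * of_int (e k) * of_real x)))"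
    "(LBINT x:{-pi..pi}. h x * (\<Sum>k\<in>I. c k * exp (\<i> * of_int (e k) * of_real x))) =
      (\<Sum>k\<in>I. c k * (LBINT x:{-pi..pi}. h x * exp (\<i> * of_int (e k) * of_real x)))"
proof -
  have eq: "indicat_real {-pi..pi} x *\<^sub>R (h x * (\<Sum>k\<in>I. c k * exp (\<i> * of_int (e k) * of_real x))) =
     (\<Sum>k\<in>I. c k * (indicat_real {-pi..pi} x *\<^sub>R (h x * exp (\<i> * of_int (e k) * of_real x))))" for x
    by (simp add: sum_distrib_left scaleR_sum_right mult_ac)
  have int: "integrable lborel (\<lambda>x. indicat_real {-pi..pi} x *\<^sub>R (h x * exp (\<i> * of_int (e k) * of_real x)))" for k
    using set_integrable_mult_exp[OF h, of "e k"] unfolding set_integrable_def .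
  show "set_integrable lborel {-pi..pi} (\<lambda>x. h x * (\<Sum>k\<in>I. c k * exp (\<i> * of_int (e k) * of_real x)))"
    unfolding set_integrable_def eq by (intro Bochner_Integration.integrable_sum integrable_mult_right int)
  show "(LBINT x:{-pi..pi}. h x * (\<Sum>k\<in>I. c k * exp (\<i> * of_int (e k) * of_real x))) =
      (\<Sum>k\<in>I. c k * (LBINT x:{-pi..pi}. h x * exp (\<i> * of_int (e k) * of_real x)))"
    unfolding set_lebesgue_integral_def eq
    by (subst Bochner_Integration.integral_sum) (intro integrable_mult_right int sum.cong refl integral_mult_right_zero)+
qed

lemma fourier_coeff_trig_sum:
  assumes "finite I"
  shows "fourier_coeff (\<lambda>x. \<Sum>k\<in>I. c k * exp (\<i> * of_int k * of_real x)) m = (if m \<in> I then c m else 0)"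
proof -
  have h: "set_integrable lborel {-pi..pi} (\<lambda>x::real. exp (\<i> * of_int (- m) * of_real x))"
    by (intro borel_integrable_atLeastAtMost' continuous_intros)
  have "2 * of_real pi * fourier_coeff (\<lambda>x. \<Sum>k\<in>I. c k * exp (\<i> * of_int k * of_real x)) m =
      (\<Sum>k\<in>I. c k * (LBINT x:{-pi..pi}. exp (\<i> * of_int (- m) * of_real x) * exp (\<i> * of_int k * of_real x)))"
    unfolding fourier_coeff_integral[symmetric] set_integral_sum_exp(2)[OF h assms, of c "\<lambda>k. k", symmetric]
    by (simp only: mult.commute)
  also have "\<dots> = (\<Sum>k\<in>I. c k * (if k = m then 2 * of_real pi else 0))"
  proof (intro sum.cong refl)
    fix k
    have "exp (\<i> * of_int (- m) * of_real x) * exp (\<i> * of_int k * of_real x) = exp (\<i> * of_int (k - m) * of_real x)" for x :: real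
      unfolding exp_add[symmetric] by (simp add: algebra_simps)
    then show "c k * (LBINT x:{-pi..pi}. exp (\<i> * of_int (- m) * of_real x) * exp (\<i> * of_int k * of_real x)) =
       c k * (if k = m then 2 * of_real pi else 0)"
      by (simp only: integral_exp_int) simp
  qed
  also have "\<dots> = (\<Sum>k\<in>I. if k = m then 2 * of_real pi * c m else 0)" by (intro sum.cong) auto
  also have "\<dots> = 2 * of_real pi * (if m \<in> I then c m else 0)" using assms by simp
  finally show ?thesis by simp
qed

text \<open>Integrating \<open>\<bar>h - S\<bar>\<^sup>2 \<ge> 0\<close> for the partial sum \<open>S\<close>, in the form
  \<open>\<bar>h\<bar>\<^sup>2 \<ge> 2 Re (h S\<^sup>*) - \<bar>S\<bar>\<^sup>2\<close>. Both integrals on the right are instances of one formula, as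
  \<open>h\<close> and \<open>S\<close> have the same Fourier coefficients on \<open>I\<close>.\<close>

lemma bessel:
  assumes h: "set_integrable lborel {-pi..pi} h" and h2: "set_integrable lborel {-pi..pi} (\<lambda>x. (cmod (h x))\<^sup>2)"
    and I: "finite I"
  shows "2 * pi * (\<Sum>k\<in>I. (cmod (fourier_coeff h k))\<^sup>2) \<le> (LBINT x:{-pi..pi}. (cmod (h x))\<^sup>2)"
proof -
  define t where "t = fourier_coeff h"
  define S where "S x = (\<Sum>k\<in>I. t k * exp (\<i> * of_int k * of_real x))" for x :: real
  define E where "E = (\<Sum>k\<in>I. (cmod (t k))\<^sup>2)"
  have cnjS: "cnj (S x) = (\<Sum>k\<in>I. cnj (t k) * exp (\<i> * of_int (- k) * of_real x))" for x
    unfolding S_def by (simp add: exp_cnj)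
  have Sint: "set_integrable lborel {-pi..pi} S"
    unfolding S_def by (intro borel_integrable_atLeastAtMost' continuous_intros)
  have pair: "set_integrable lborel {-pi..pi} (\<lambda>x. g x * cnj (S x))"
      "(LBINT x:{-pi..pi}. g x * cnj (S x)) = of_real (2 * pi * E)"
    if g: "set_integrable lborel {-pi..pi} g" "\<And>k. k \<in> I \<Longrightarrow> fourier_coeff g k = t k" for g
  proof -
    show "set_integrable lborel {-pi..pi} (\<lambda>x. g x * cnj (S x))"
      unfolding cnjS by (rule set_integral_sum_exp(1)[OF g(1) I])
    have "(LBINT x:{-pi..pi}. g x * cnj (S x)) = (\<Sum>k\<in>I. cnj (t k) * (2 * of_real pi * t k))"
      unfolding cnjS set_integral_sum_exp(2)[OF g(1) I] fourier_coeff_integral using g(2) by simp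
    also have "\<dots> = of_real (2 * pi * E)"
      unfolding E_def by (simp add: sum_distrib_left complex_norm_square mult_ac del: of_real_power)
    finally show "(LBINT x:{-pi..pi}. g x * cnj (S x)) = of_real (2 * pi * E)" .
  qed
  have hS: "set_integrable lborel {-pi..pi} (\<lambda>x. h x * cnj (S x))"
    "(LBINT x:{-pi..pi}. h x * cnj (S x)) = of_real (2 * pi * E)"
    using pair[OF h] unfolding t_def by auto
  have "fourier_coeff S k = t k" if "k \<in> I" for k
    unfolding S_def[abs_def] fourier_coeff_trig_sum[OF I] using that by simp
  note SS = pair[OF Sint this]
  have Re: "set_integrable lborel {-pi..pi} (\<lambda>x. Re (g x))"
     "(LBINT x:{-pi..pi}. Re (g x)) = Re (LBINT x:{-pi..pi}. g x)"
    if "set_integrable lborel {-pi..pi} g" for g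
  proof -
    have eq: "indicat_real {-pi..pi} x *\<^sub>R Re (g x) = Re (indicat_real {-pi..pi} x *\<^sub>R g x)" for x by simp
    show "set_integrable lborel {-pi..pi} (\<lambda>x. Re (g x))"
      using that unfolding set_integrable_def eq by (rule integrable_Re)
    show "(LBINT x:{-pi..pi}. Re (g x)) = Re (LBINT x:{-pi..pi}. g x)"
      using that unfolding set_integrable_def set_lebesgue_integral_def eq by (rule integral_Re)
  qed
  have "(LBINT x:{-pi..pi}. 2 * Re (h x * cnj (S x)) - Re (S x * cnj (S x))) \<le> (LBINT x:{-pi..pi}. (cmod (h x))\<^sup>2)"
  proof (rule set_integral_mono)
    show "set_integrable lborel {-pi..pi} (\<lambda>x. 2 * Re (h x * cnj (S x)) - Re (S x * cnj (S x)))"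
      by (intro set_integral_diff(1) set_integrable_mult_right Re(1) hS SS)
    fix x
    have "0 \<le> (cmod (h x - S x))\<^sup>2" by simp
    then show "2 * Re (h x * cnj (S x)) - Re (S x * cnj (S x)) \<le> (cmod (h x))\<^sup>2"
      unfolding cmod_power2 by (simp add: power2_eq_square algebra_simps)
  qed (rule h2)
  also have "(LBINT x:{-pi..pi}. 2 * Re (h x * cnj (S x)) - Re (S x * cnj (S x))) = 2 * (2 * pi * E) - 2 * pi * E"
  proof -
    have "Re (LBINT x:{-pi..pi}. h x * cnj (S x)) = 2 * pi * E"
      by (rule trans[OF arg_cong[OF hS(2), of Re] Re_complex_of_real])
    moreover have "Re (LBINT x:{-pi..pi}. S x * cnj (S x)) = 2 * pi * E"
      by (rule trans[OF arg_cong[OF SS(2), of Re] Re_complex_of_real])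
    moreover have "(LBINT x:{-pi..pi}. 2 * Re (h x * cnj (S x)) - Re (S x * cnj (S x))) =
        (LBINT x:{-pi..pi}. 2 * Re (h x * cnj (S x))) - (LBINT x:{-pi..pi}. Re (S x * cnj (S x)))"
      by (intro set_integral_diff(2) set_integrable_mult_right Re(1) hS(1) SS(1))
    moreover have "(LBINT x:{-pi..pi}. 2 * Re (h x * cnj (S x))) = 2 * (LBINT x:{-pi..pi}. Re (h x * cnj (S x)))"
      by (rule set_integral_mult_right)
    ultimately show ?thesis using Re(2)[OF hS(1)] Re(2)[OF SS(1)] by presburger
  qed
  finally show ?thesis unfolding E_def t_def by simp
qed

section \<open>Trigonometric polynomials\<close>

text \<open>A Laurent polynomial in \<open>e\<^bsup>ix\<^esup>\<close> with exponents between \<open>-d\<close> and \<open>d\<close>, written as a shifted ordinary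
  polynomial: products of trigonometric polynomials then are products of polynomials, and no
  convolution of coefficients is needed.\<close>

definition trig_polynomial :: "nat \<Rightarrow> (real \<Rightarrow> complex) \<Rightarrow> bool" where
  "trig_polynomial d h \<longleftrightarrow>
     (\<exists>p. degree p \<le> 2 * d \<and> (\<forall>x. h x = cis (- real d * x) * poly p (cis x)))"

lemma trig_polynomial_const: "trig_polynomial 0 (\<lambda>x. c)"
  unfolding trig_polynomial_def by (intro exI[of _ "[:c:]"]) auto

lemma trig_polynomial_mult:
  assumes "trig_polynomial d h" "trig_polynomial e g"
  shows "trig_polynomial (d + e) (\<lambda>x. h x * g x)"
proof -
  obtain p q where p: "degree p \<le> 2 * d" "\<And>x. h x = cis (- real d * x) * poly p (cis x)"
    and q: "degree q \<le> 2 * e" "\<And>x. g x = cis (- real e * x) * poly q (cis x)"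
    using assms unfolding trig_polynomial_def by blast
  have "h x * g x = cis (- real (d + e) * x) * poly (p * q) (cis x)" for x
  proof -
    have "cis (- real (d + e) * x) = cis (- real d * x) * cis (- real e * x)"
      unfolding cis_mult by (simp add: algebra_simps)
    then show ?thesis unfolding p(2) q(2) by simp
  qed
  moreover have "degree (p * q) \<le> 2 * (d + e)"
  proof -
    have "degree (p * q) \<le> degree p + degree q" by (rule degree_mult_le)
    also have "\<dots> \<le> 2 * (d + e)" using p(1) q(1) by simp
    finally show ?thesis .
  qed
  ultimately show ?thesis unfolding trig_polynomial_def by blast
qed

lemma trig_polynomial_mono:
  assumes "trig_polynomial d h" "d \<le> e"
  shows "trig_polynomial e h"
proof -
  have "degree (monom (1::complex) (e - d)) \<le> 2 * (e - d)" using degree_monom_le[of "1::complex" "e - d"] by linarith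
  moreover have "cis (- real (e - d) * x) * poly (monom 1 (e - d)) (cis x) = 1" for x
    by (simp add: poly_monom Complex.DeMoivre cis_mult)
  ultimately have "trig_polynomial (e - d) (\<lambda>x. 1)" unfolding trig_polynomial_def by metis
  from trig_polynomial_mult[OF assms(1) this] show ?thesis using assms(2) by simp
qed

lemma trig_polynomial_add:
  assumes "trig_polynomial d h" "trig_polynomial e g"
  shows "trig_polynomial (max d e) (\<lambda>x. h x + g x)"
proof -
  obtain p q where p: "degree p \<le> 2 * max d e" "\<And>x. h x = cis (- real (max d e) * x) * poly p (cis x)"
    and q: "degree q \<le> 2 * max d e" "\<And>x. g x = cis (- real (max d e) * x) * poly q (cis x)"
    using assms[THEN trig_polynomial_mono, of "max d e"] unfolding trig_polynomial_def by auto
  show ?thesis unfolding trig_polynomial_def p(2) q(2)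
    by (rule exI[of _ "p + q"]) (use degree_add_le[OF p(1) q(1)] in \<open>simp add: ring_distribs\<close>)
qed

lemma trig_polynomial_power: "trig_polynomial d h \<Longrightarrow> trig_polynomial (k * d) (\<lambda>x. h x ^ k)"
  by (induction k) (auto intro: trig_polynomial_const trig_polynomial_mult)

lemma trig_polynomial_prod:
  "(\<And>i. i \<in> I \<Longrightarrow> trig_polynomial (d i) (h i)) \<Longrightarrow> trig_polynomial (\<Sum>i\<in>I. d i) (\<lambda>x. \<Prod>i\<in>I. h i x)"
  by (induction I rule: infinite_finite_induct) (auto intro: trig_polynomial_const trig_polynomial_mult)

lemma trig_polynomial_cos: "trig_polynomial 1 (\<lambda>x. complex_of_real (cos x))"
  unfolding trig_polynomial_def
proof (intro exI conjI allI)
  show "degree [:1/2, 0, 1/2::complex:] \<le> 2 * 1" by simp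
  fix x
  have "cis (- x) * cis x = 1" by (simp add: cis_mult)
  moreover have "complex_of_real (cos x) = (cis x + cis (- x)) / 2" by (simp add: complex_eq_iff)
  moreover have "cis (- real 1 * x) * poly [:1/2, 0, 1/2:] (cis x) = (cis (- x) + cis (- x) * cis x * cis x) / 2"
    by (simp add: field_simps)
  ultimately show "complex_of_real (cos x) = cis (- real 1 * x) * poly [:1/2, 0, 1/2:] (cis x)"
    by (simp only:) simp
qed

lemma trig_polynomial_sin: "trig_polynomial 1 (\<lambda>x. complex_of_real (sin x))"
  unfolding trig_polynomial_def
proof (intro exI conjI allI)
  show "degree [:\<i>/2, 0, -\<i>/2:] \<le> 2 * 1" by simp
  fix x
  have "cis (- x) * cis x = 1" by (simp add: cis_mult)
  moreover have "complex_of_real (sin x) = (\<i> * cis (- x) - \<i> * cis x) / 2" by (simp add: complex_eq_iff)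
  moreover have "cis (- real 1 * x) * poly [:\<i>/2, 0, -\<i>/2:] (cis x) =
      (\<i> * cis (- x) - \<i> * (cis (- x) * cis x * cis x)) / 2"
    by (simp add: field_simps)
  ultimately show "complex_of_real (sin x) = cis (- real 1 * x) * poly [:\<i>/2, 0, -\<i>/2:] (cis x)"
    by (simp only:) simp
qed

lemma trig_polynomial_coeffs:
  assumes "trig_polynomial d h"
  obtains c where "\<And>x. h x = (\<Sum>k\<in>{- int d..int d}. c k * exp (\<i> * of_int k * of_real x))"
proof -
  obtain p where p: "degree p \<le> 2 * d" "\<And>x. h x = cis (- real d * x) * poly p (cis x)"
    using assms unfolding trig_polynomial_def by blast
  have "h x = (\<Sum>k\<in>{- int d..int d}. coeff p (nat (k + int d)) * exp (\<i> * of_int k * of_real x))" for x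
  proof -
    have "poly p (cis x) = (\<Sum>i\<le>2 * d. coeff p i * cis x ^ i)"
      unfolding poly_altdef using p(1)
      by (intro sum.mono_neutral_left) (auto simp: coeff_eq_0)
    then have "h x = (\<Sum>i\<le>2 * d. coeff p i * (cis (- real d * x) * cis x ^ i))"
      unfolding p(2) by (simp add: sum_distrib_left mult_ac)
    also have "\<dots> = (\<Sum>k\<in>{- int d..int d}. coeff p (nat (k + int d)) * exp (\<i> * of_int k * of_real x))"
    proof (rule sum.reindex_bij_witness[where i = "\<lambda>k. nat (k + int d)" and j = "\<lambda>i. int i - int d"])
      fix i assume "i \<in> {..2 * d}"
      have "cis (- real d * x) * cis x ^ i = cis (of_int (int i - int d) * x)"
        unfolding Complex.DeMoivre cis_mult by (simp add: algebra_simps)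
      also have "\<dots> = exp (\<i> * of_int (int i - int d) * of_real x)"
        unfolding cis_conv_exp by (simp add: mult.assoc)
      finally show "coeff p (nat (int i - int d + int d)) * exp (\<i> * of_int (int i - int d) * of_real x) =
          coeff p i * (cis (- real d * x) * cis x ^ i)" by simp
    qed auto
    finally show ?thesis .
  qed
  then show ?thesis by (rule that)
qed

lemma trig_polynomial_fourier:
  assumes "trig_polynomial d h"
  shows "\<bar>k\<bar> > int d \<Longrightarrow> fourier_coeff h k = 0"
    and "d < n \<Longrightarrow> fourier_expansion n h = h"
    and "set_integrable lborel {-pi..pi} h"
proof -
  obtain c where c: "\<And>x. h x = (\<Sum>k\<in>{- int d..int d}. c k * exp (\<i> * of_int k * of_real x))"
    using trig_polynomial_coeffs[OF assms] by blast
  have h: "h = (\<lambda>x. \<Sum>k\<in>{- int d..int d}. c k * exp (\<i> * of_int k * of_real x))" using c by auto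
  have fc: "fourier_coeff h k = (if k \<in> {- int d..int d} then c k else 0)" for k
    unfolding h by (rule fourier_coeff_trig_sum) simp
  show "\<bar>k\<bar> > int d \<Longrightarrow> fourier_coeff h k = 0" unfolding fc by auto
  show "set_integrable lborel {-pi..pi} h"
    unfolding h by (intro borel_integrable_atLeastAtMost' continuous_intros)
  assume n: "d < n"
  show "fourier_expansion n h = h"
  proof
    fix x
    have "fourier_expansion n h x = (\<Sum>k\<in>{- int d..int d}. c k * exp (\<i> * of_int k * of_real x))"
      unfolding fourier_expansion_def fc using n by (intro sum.mono_neutral_cong_right) auto
    then show "fourier_expansion n h x = h x" using c by simp
  qed
qed

lemma trig_polynomial_real_polynomial:
  fixes p :: "complex \<Rightarrow> real"
  assumes "real_polynomial_function p"
  shows "\<exists>d. trig_polynomial d (\<lambda>x. complex_of_real (p (cis x)))"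
  using assms
proof (induction p rule: real_polynomial_function.induct)
  case (linear f)
  interpret bounded_linear f by (rule linear)
  have "cis x = cos x *\<^sub>R 1 + sin x *\<^sub>R \<i>" for x by (simp add: complex_eq_iff)
  then have "f (cis x) = f 1 * cos x + f \<i> * sin x" for x by (simp add: add scaleR)
  then have "(\<lambda>x. complex_of_real (f (cis x))) =
      (\<lambda>x. complex_of_real (f 1) * complex_of_real (cos x) + complex_of_real (f \<i>) * complex_of_real (sin x))"
    by auto
  then show ?case
    using trig_polynomial_add[OF trig_polynomial_mult[OF trig_polynomial_const trig_polynomial_cos]
        trig_polynomial_mult[OF trig_polynomial_const trig_polynomial_sin]] by metis
next
  case (const c)
  show ?case using trig_polynomial_const by blast
next
  case (add f g)
  then obtain d e where "trig_polynomial d (\<lambda>x. complex_of_real (f (cis x)))"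
    "trig_polynomial e (\<lambda>x. complex_of_real (g (cis x)))" by blast
  from trig_polynomial_add[OF this] show ?case by auto
next
  case (mult f g)
  then obtain d e where "trig_polynomial d (\<lambda>x. complex_of_real (f (cis x)))"
    "trig_polynomial e (\<lambda>x. complex_of_real (g (cis x)))" by blast
  from trig_polynomial_mult[OF this] show ?case by auto
qed

text \<open>Since \<open>cis\<close> maps the compact interval onto the circle, it is a quotient map, and \<open>h\<close> descends to
  a continuous function on the circle. The Stone-Weierstrass theorem approximates this function
  by polynomials in \<open>Re z\<close> and \<open>Im z\<close>, which on the circle are trigonometric polynomials.\<close>

lemma trig_polynomial_dense:
  assumes h: "continuous_on {-pi..pi} h" "h (- pi) = h pi" and \<epsilon>: "0 < \<epsilon>"
  obtains d Q where "trig_polynomial d Q" "\<And>x. x \<in> {-pi..pi} \<Longrightarrow> cmod (h x - Q x) < \<epsilon>"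
proof -
  let ?I = "{-pi..pi}" and ?S = "sphere 0 1 :: complex set"
  have img: "cis ` ?I = ?S"
  proof
    show "cis ` ?I \<subseteq> ?S" by auto
    show "?S \<subseteq> cis ` ?I"
    proof
      fix z assume "z \<in> ?S"
      then have "cmod z = 1" by simp
      then have "cis (Arg z) = z" by (subst cis_Arg) (auto simp: sgn_div_norm)
      moreover have "Arg z \<in> ?I" using Arg_bounded[of z] by simp
      ultimately show "z \<in> cis ` ?I" by (metis imageI)
    qed
  qed
  have ccis: "continuous_on A cis" for A by (intro continuous_intros)
  have qm: "quotient_map (top_of_set ?I) (top_of_set ?S) cis"
  proof (rule T1_Spaces.continuous_imp_quotient_map)
    show "continuous_map (top_of_set ?I) (top_of_set ?S) cis"
      using img ccis by (auto simp: continuous_map_in_subtopology)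
    show "compact_space (top_of_set ?I)" by (simp add: compact_space_subtopology)
    show "Hausdorff_space (top_of_set ?S)" by (intro Hausdorff_space_subtopology Hausdorff_space_euclidean)
  qed (use img in simp)
  have hc: "continuous_map (top_of_set ?I) euclidean h" using h(1) by simp
  have eq: "h x = h y" if "x \<in> topspace (top_of_set ?I)" "y \<in> topspace (top_of_set ?I)" "cis x = cis y" for x y
  proof -
    have xy: "x \<in> ?I" "y \<in> ?I" using that by auto
    have "cis (x - y) = 1" using that(3) by (simp add: cis_divide[symmetric])
    then have "cos (x - y) = 1" by (metis cis.sel(1) one_complex.sel(1))
    then obtain k :: int where k: "x - y = of_int k * 2 * pi" by (auto simp: cos_one_2pi_int)
    have "\<bar>x - y\<bar> \<le> 2 * pi" using xy by auto
    then have "\<bar>of_int k :: real\<bar> * (2 * pi) \<le> 1 * (2 * pi)" unfolding k by (simp add: abs_mult)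
    then have "\<bar>of_int k :: real\<bar> \<le> 1" by (subst (asm) mult_le_cancel_right) auto
    then have "k = -1 \<or> k = 0 \<or> k = 1" by linarith
    then have "x = y \<or> (x = pi \<and> y = -pi) \<or> (x = -pi \<and> y = pi)" using k xy by auto
    then show ?thesis using h(2) by auto
  qed
  obtain H where H: "continuous_map (top_of_set ?S) euclidean H"
    and "H ` topspace (top_of_set ?S) = h ` topspace (top_of_set ?I)"
    and Hc: "\<And>x. x \<in> topspace (top_of_set ?I) \<Longrightarrow> H (cis x) = h x"
    by (rule quotient_map_lift_exists[OF qm hc eq]) (assumption | rule that)+
  have "continuous_on ?S H" using H by simp
  then obtain g where g: "polynomial_function g" "\<And>z. z \<in> ?S \<Longrightarrow> cmod (H z - g z) < \<epsilon>"
    using Stone_Weierstrass_polynomial_function[of ?S H \<epsilon>] \<epsilon> by auto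
  have "real_polynomial_function (Re \<circ> g)" "real_polynomial_function (Im \<circ> g)"
    using g(1) bounded_linear_Re bounded_linear_Im unfolding polynomial_function_def by auto
  from this[THEN trig_polynomial_real_polynomial] obtain d e where
    de: "trig_polynomial d (\<lambda>x. complex_of_real (Re (g (cis x))))" "trig_polynomial e (\<lambda>x. complex_of_real (Im (g (cis x))))"
    by auto
  have "trig_polynomial (max d (0 + e)) (\<lambda>x. complex_of_real (Re (g (cis x))) + \<i> * complex_of_real (Im (g (cis x))))"
    by (rule trig_polynomial_add[OF de(1) trig_polynomial_mult[OF trig_polynomial_const de(2)]])
  then have "trig_polynomial (max d (0 + e)) (\<lambda>x. g (cis x))" by (simp only: complex_eq[symmetric])
  moreover have "cmod (h x - g (cis x)) < \<epsilon>" if "x \<in> ?I" for x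
    using g(2)[of "cis x"] Hc[of x] that by simp
  ultimately show ?thesis by (rule that)
qed

lemma piecewise_continuous_bounded:
  assumes "piecewise_continuous f"
  shows "\<exists>B. \<forall>x\<in>{-pi..pi}. cmod (f x) \<le> B"
proof -
  have "\<exists>e B. 0 < e \<and> (\<forall>y\<in>ball x e. cmod (f y) \<le> B)" for x
  proof -
    obtain l r where l: "(f \<longlongrightarrow> l) (at_left x)" and r: "(f \<longlongrightarrow> r) (at_right x)"
      using assms unfolding piecewise_continuous_def by blast
    have "eventually (\<lambda>y. dist (f y) l < 1) (at_left x)" "eventually (\<lambda>y. dist (f y) r < 1) (at_right x)"
      using tendstoD[OF l, of 1] tendstoD[OF r, of 1] by auto
    then obtain d e where d: "0 < d" "\<And>y. y < x \<Longrightarrow> dist y x < d \<Longrightarrow> dist (f y) l < 1"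
      and e: "0 < e" "\<And>y. y > x \<Longrightarrow> dist y x < e \<Longrightarrow> dist (f y) r < 1"
      unfolding eventually_at by auto
    have 1: "cmod a \<le> cmod b + 1" if "dist a b < 1" for a b :: complex
      using that norm_triangle_ineq2[of a b] by (simp add: dist_norm)
    have "cmod (f y) \<le> max (cmod (f x)) (max (cmod l + 1) (cmod r + 1))" if "y \<in> ball x (min d e)" for y
      using that d(2)[of y] e(2)[of y] 1[of "f y" l] 1[of "f y" r]
      by (cases y x rule: linorder_cases) (auto simp: dist_commute le_max_iff_disj)
    then show ?thesis using d(1) e(1)
      by (intro exI[of _ "min d e"] exI[of _ "max (cmod (f x)) (max (cmod l + 1) (cmod r + 1))"]) auto
  qed
  then obtain e B where eB: "\<And>x. 0 < e x" "\<And>x y. y \<in> ball x (e x) \<Longrightarrow> cmod (f y) \<le> B x" by metis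
  have "{-pi..pi} \<subseteq> (\<Union>x\<in>{-pi..pi}. ball x (e x))" using eB(1) by force
  then obtain C where C: "C \<subseteq> {-pi..pi}" "finite C" "{-pi..pi} \<subseteq> (\<Union>x\<in>C. ball x (e x))"
    using compactE_image[OF compact_Icc, of "{-pi..pi}" "\<lambda>x. ball x (e x)" "-pi" pi] by auto
  have "cmod (f y) \<le> (\<Sum>x\<in>C. \<bar>B x\<bar>)" if "y \<in> {-pi..pi}" for y
  proof -
    obtain x where x: "x \<in> C" "y \<in> ball x (e x)" using C(3) \<open>y \<in> {-pi..pi}\<close> by blast
    have "cmod (f y) \<le> \<bar>B x\<bar>" using eB(2)[OF x(2)] by simp
    also have "\<dots> \<le> (\<Sum>x\<in>C. \<bar>B x\<bar>)" using C(2) x(1) by (intro member_le_sum) auto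
    finally show ?thesis .
  qed
  then show ?thesis by blast
qed

lemma set_integrable_bounded:
  fixes h :: "real \<Rightarrow> 'a :: {banach, second_countable_topology}"
  assumes "set_borel_measurable lborel {-pi..pi} h" "\<And>x. x \<in> {-pi..pi} \<Longrightarrow> norm (h x) \<le> B"
  shows "set_integrable lborel {-pi..pi} h"
proof (rule set_integrable_bound[OF _ assms(1)])
  show "set_integrable lborel {-pi..pi} (\<lambda>x. B)"
    by (intro borel_integrable_atLeastAtMost' continuous_intros)
  show "AE x in lborel. x \<in> {-pi..pi} \<longrightarrow> norm (h x) \<le> norm B"
    using assms(2) by (intro AE_I2) fastforce
qed

lemma set_borel_measurable_finite_discontinuities:
  fixes f :: "real \<Rightarrow> complex"
  assumes D: "finite D" "-pi \<in> D" "pi \<in> D" and cont: "\<And>x. x \<in> {-pi..pi} \<Longrightarrow> x \<notin> D \<Longrightarrow> isCont f x"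
  shows "set_borel_measurable lborel {-pi..pi} f"
proof -
  have "continuous_on (- D) (\<lambda>x. indicat_real {-pi..pi} x *\<^sub>R f x)" (is "continuous_on _ ?g")
  proof (rule continuous_at_imp_continuous_on, rule ballI)
    fix x assume x: "x \<in> - D"
    show "isCont ?g x"
    proof (cases "x \<in> {-pi..pi}")
      case True
      then have xi: "x \<in> {-pi<..<pi}" using x D by (metis ComplD atLeastAtMost_iff greaterThanLessThan_iff less_eq_real_def)
      have "isCont f x" using cont[OF True] x by simp
      moreover have "eventually (\<lambda>y. ?g y = f y) (nhds x)"
        by (rule eventually_nhds_in_open[THEN eventually_mono, of "{-pi<..<pi}"]) (use xi in auto)
      ultimately show ?thesis using isCont_cong by metis
    next
      case False
      have "eventually (\<lambda>y. y \<in> - {-pi..pi}) (nhds x)"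
        by (rule eventually_nhds_in_open) (use False in auto)
      then have "eventually (\<lambda>y. ?g y = 0) (nhds x)"
        by (rule eventually_mono) auto
      then show ?thesis using isCont_cong[of ?g "\<lambda>_. 0" x] by simp
    qed
  qed
  then have "?g \<in> borel_measurable borel"
    using D(1) by (intro borel_measurable_continuous_countable_exceptions[of D]) (auto intro: countable_finite)
  then show ?thesis unfolding set_borel_measurable_def by simp
qed

lemma set_borel_measurable_cmod2:
  assumes "set_borel_measurable lborel A h"
  shows "set_borel_measurable lborel A (\<lambda>x. (cmod (h x))\<^sup>2)"
proof -
  have eq: "indicat_real A x *\<^sub>R (cmod (h x))\<^sup>2 = (cmod (indicat_real A x *\<^sub>R h x))\<^sup>2" for x
    by (simp add: indicator_def)
  show ?thesis using assms unfolding set_borel_measurable_def eq by measurable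
qed

text \<open>Multiplying \<open>f\<close> by a cutoff function that vanishes on \<open>D\<close> makes it continuous and, because \<open>\<plusminus>\<pi>\<close>
  belong to \<open>D\<close>, equal at both ends. An approximation of the product is uniformly close to \<open>f\<close>
  away from \<open>D\<close>, and close in the mean because \<open>f\<close> is bounded and the cutoff region is small.\<close>

lemma trig_polynomial_approx:
  assumes D: "finite D" "D \<subseteq> {-pi..pi}" "-pi \<in> D" "pi \<in> D"
    and cont: "\<And>x. x \<in> {-pi..pi} \<Longrightarrow> x \<notin> D \<Longrightarrow> isCont f x"
    and bdd: "\<And>x. x \<in> {-pi..pi} \<Longrightarrow> cmod (f x) \<le> B" and r: "0 < r" and \<sigma>: "0 < \<sigma>"
  obtains d Q where "trig_polynomial d Q"
    "\<And>x. x \<in> {-pi..pi} \<Longrightarrow> r \<le> infdist x D \<Longrightarrow> cmod (f x - Q x) \<le> \<sigma>"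
    "set_integrable lborel {-pi..pi} (\<lambda>x. f x - Q x)"
    "set_integrable lborel {-pi..pi} (\<lambda>x. (cmod (f x - Q x))\<^sup>2)"
    "(LBINT x:{-pi..pi}. (cmod (f x - Q x))\<^sup>2) \<le> \<sigma>"
proof -
  have B: "0 \<le> B" using order_trans[OF norm_ge_zero bdd[of 0]] by simp
  have cD: "closed D" "D \<noteq> {}" using D finite_imp_closed by auto
  \<comment> \<open>the width of the cutoff: the exceptional intervals contribute at most \<open>\<sigma> / 2\<close> to the integral\<close>
  define r' where "r' = min r (\<sigma> / (4 * real (card D) * (B + 1)\<^sup>2))"
  have cardD: "0 < real (card D)" using D(1) cD(2) by (simp add: card_gt_0_iff)
  have r': "0 < r'" "r' \<le> r" unfolding r'_def using r \<sigma> cardD B by auto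
  have r'2: "real (card D) * ((B + 1)\<^sup>2 * (2 * r')) \<le> \<sigma> / 2"
  proof -
    have p: "0 < real (card D) * (B + 1)\<^sup>2" using cardD B by simp
    have "r' \<le> \<sigma> / (4 * real (card D) * (B + 1)\<^sup>2)" unfolding r'_def by simp
    then show ?thesis using p by (simp add: field_simps)
  qed
  \<comment> \<open>so that the integral of \<open>\<epsilon>\<^sup>2\<close> over the whole interval is at most \<open>\<sigma> / 2\<close>\<close>
  define \<epsilon> where "\<epsilon> = min 1 (min \<sigma> (\<sigma> / (4 * pi)))"
  have \<epsilon>: "0 < \<epsilon>" "\<epsilon> \<le> 1" "\<epsilon> \<le> \<sigma>" unfolding \<epsilon>_def using \<sigma> by auto
  have \<epsilon>2: "2 * pi * \<epsilon>\<^sup>2 \<le> \<sigma> / 2"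
  proof -
    have "\<epsilon>\<^sup>2 \<le> \<epsilon>" using \<epsilon> by (simp add: power2_eq_square mult_left_le)
    also have "\<epsilon> \<le> \<sigma> / (4 * pi)" unfolding \<epsilon>_def by simp
    finally show ?thesis by (simp add: field_simps)
  qed
  define \<phi> where "\<phi> x = min 1 (infdist x D / r')" for x
  have \<phi>: "0 \<le> \<phi> x" "\<phi> x \<le> 1" for x unfolding \<phi>_def using r' infdist_nonneg[of x D] by auto
  have \<phi>c: "isCont \<phi> x" for x unfolding \<phi>_def by (intro continuous_intros) (use r' in auto)
  have \<phi>0: "\<phi> x = 0" if "x \<in> D" for x unfolding \<phi>_def using that by simp
  have \<phi>1: "\<phi> x = 1" if "r' \<le> infdist x D" for x unfolding \<phi>_def using that r' by simp
  define h where "h x = f x * complex_of_real (\<phi> x)" for x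
  have "continuous_on {-pi..pi} h"
  proof (rule continuous_on_eq_continuous_within[THEN iffD2], rule ballI)
    fix x assume x: "x \<in> {-pi..pi}"
    show "continuous (at x within {-pi..pi}) h"
    proof (cases "x \<in> D")
      case False
      then have "isCont h x" unfolding h_def using cont[OF x] \<phi>c[of x] by (intro continuous_intros) auto
      then show ?thesis by (rule continuous_at_imp_continuous_at_within)
    next
      case True
      have "(h \<longlongrightarrow> 0) (at x within {-pi..pi})"
      proof (rule Lim_null_comparison)
        show "eventually (\<lambda>y. norm (h y) \<le> B * \<phi> y) (at x within {-pi..pi})"
          unfolding eventually_at_filter
          by (intro always_eventually allI impI) (use bdd \<phi> in \<open>auto simp: h_def norm_mult intro!: mult_right_mono\<close>)
        have "((\<lambda>y. B * \<phi> y) \<longlongrightarrow> B * \<phi> x) (at x within {-pi..pi})"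
          using \<phi>c[of x] by (intro tendsto_intros) (simp add: isCont_def tendsto_within_subset[OF _ subset_UNIV])
        then show "((\<lambda>y. B * \<phi> y) \<longlongrightarrow> 0) (at x within {-pi..pi})" using \<phi>0[OF True] by simp
      qed
      then show ?thesis unfolding continuous_within h_def using \<phi>0[OF True] by simp
    qed
  qed
  moreover have "h (- pi) = h pi" unfolding h_def using \<phi>0 D by simp
  ultimately obtain d Q where Q: "trig_polynomial d Q" "\<And>x. x \<in> {-pi..pi} \<Longrightarrow> cmod (h x - Q x) < \<epsilon>"
    using trig_polynomial_dense[OF _ _ \<epsilon>(1)] by blast
  have far: "cmod (f x - Q x) \<le> \<epsilon>" if "x \<in> {-pi..pi}" "r' \<le> infdist x D" for x
    using Q(2)[OF that(1)] \<phi>1[OF that(2)] unfolding h_def by simp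
  have all: "cmod (f x - Q x) \<le> B + 1" if x: "x \<in> {-pi..pi}" for x
  proof -
    have "cmod (f x - h x) = cmod (f x) * \<bar>1 - \<phi> x\<bar>"
    proof -
      have "f x - h x = f x * complex_of_real (1 - \<phi> x)" unfolding h_def by (simp add: algebra_simps)
      then show ?thesis by (simp only: norm_mult norm_of_real)
    qed
    also have "\<dots> \<le> B * 1" using bdd[OF x] \<phi>[of x] B by (intro mult_mono) auto
    finally have "cmod (f x - h x) \<le> B" by simp
    then show ?thesis using Q(2)[OF x] \<epsilon>(2) norm_triangle_ineq[of "f x - h x" "h x - Q x"] by simp
  qed
  have mf: "set_borel_measurable lborel {-pi..pi} (\<lambda>x. f x - Q x)"
  proof -
    have "set_borel_measurable lborel {-pi..pi} f"
      by (rule set_borel_measurable_finite_discontinuities[OF D(1,3,4) cont])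
    moreover have "set_borel_measurable lborel {-pi..pi} Q"
      using trig_polynomial_fourier(3)[OF Q(1)] unfolding set_integrable_def set_borel_measurable_def
      by (rule borel_measurable_integrable)
    ultimately show ?thesis
      unfolding set_borel_measurable_def scaleR_diff_right by (rule borel_measurable_diff)
  qed
  note mf2 = set_borel_measurable_cmod2[OF mf]
  have i1: "set_integrable lborel {-pi..pi} (\<lambda>x. f x - Q x)"
    by (rule set_integrable_bounded[OF mf all])
  have i2: "set_integrable lborel {-pi..pi} (\<lambda>x. (cmod (f x - Q x))\<^sup>2)"
    by (rule set_integrable_bounded[OF mf2, of "(B + 1)\<^sup>2"]) (use all in \<open>auto intro!: power_mono\<close>)
  define G where "G x = indicat_real {-pi..pi} x * \<epsilon>\<^sup>2 + (\<Sum>d\<in>D. (B + 1)\<^sup>2 * indicat_real {d - r'..d + r'} x)" for x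
  have ii: "integrable lborel (indicat_real {a..b})" for a b :: real
    by (intro integrable_real_indicator) (simp_all add: emeasure_lborel_Icc_eq)
  have iG: "integrable lborel G" unfolding G_def
    by (intro Bochner_Integration.integrable_add Bochner_Integration.integrable_sum integrable_mult_right integrable_mult_left ii)
  have "(LBINT x:{-pi..pi}. (cmod (f x - Q x))\<^sup>2) \<le> integral\<^sup>L lborel G"
    unfolding set_lebesgue_integral_def
  proof (rule integral_mono[OF i2[unfolded set_integrable_def] iG])
    fix x
    show "indicat_real {-pi..pi} x *\<^sub>R (cmod (f x - Q x))\<^sup>2 \<le> G x"
    proof (cases "x \<in> {-pi..pi}")
      case False
      then show ?thesis unfolding G_def by (auto intro!: sum_nonneg)
    next
      case True
      show ?thesis
      proof (cases "r' \<le> infdist x D")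
        case far': True
        have "(cmod (f x - Q x))\<^sup>2 \<le> \<epsilon>\<^sup>2" using far[OF True far'] by (intro power_mono) auto
        moreover have "0 \<le> (\<Sum>d\<in>D. (B + 1)\<^sup>2 * indicat_real {d - r'..d + r'} x)" by (intro sum_nonneg) auto
        ultimately show ?thesis using True unfolding G_def by simp
      next
        case False
        obtain d where d: "d \<in> D" "infdist x D = dist x d" using infdist_attains_inf[OF cD] by blast
        then have xd: "x \<in> {d - r'..d + r'}" using False by (auto simp: dist_real_def)
        have "(cmod (f x - Q x))\<^sup>2 \<le> (B + 1)\<^sup>2 * indicat_real {d - r'..d + r'} x"
          using all[OF True] xd by (auto intro!: power_mono)
        also have "\<dots> \<le> (\<Sum>d\<in>D. (B + 1)\<^sup>2 * indicat_real {d - r'..d + r'} x)"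
          using D(1) d(1) by (intro member_le_sum) auto
        finally show ?thesis using True unfolding G_def by (simp add: add_increasing)
      qed
    qed
  qed
  also have "integral\<^sup>L lborel G = 2 * pi * \<epsilon>\<^sup>2 + (\<Sum>d\<in>D. (B + 1)\<^sup>2 * (2 * r'))"
  proof -
    have "integral\<^sup>L lborel G = integral\<^sup>L lborel (\<lambda>x. indicat_real {-pi..pi} x * \<epsilon>\<^sup>2) +
       integral\<^sup>L lborel (\<lambda>x. \<Sum>d\<in>D. (B + 1)\<^sup>2 * indicat_real {d - r'..d + r'} x)"
      unfolding G_def
      by (intro Bochner_Integration.integral_add Bochner_Integration.integrable_sum integrable_mult_right integrable_mult_left ii)
    also have "integral\<^sup>L lborel (\<lambda>x. \<Sum>d\<in>D. (B + 1)\<^sup>2 * indicat_real {d - r'..d + r'} x)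
       = (\<Sum>d\<in>D. integral\<^sup>L lborel (\<lambda>x. (B + 1)\<^sup>2 * indicat_real {d - r'..d + r'} x))"
      by (intro Bochner_Integration.integral_sum integrable_mult_right ii)
    finally show ?thesis using r'(1) by simp
  qed
  also have "\<dots> \<le> \<sigma>" using \<epsilon>2 r'2 by simp
  finally have "(LBINT x:{-pi..pi}. (cmod (f x - Q x))\<^sup>2) \<le> \<sigma>" .
  moreover have "cmod (f x - Q x) \<le> \<sigma>" if "x \<in> {-pi..pi}" "r \<le> infdist x D" for x
    using far[OF that(1)] that(2) r'(2) \<epsilon>(3) by simp
  ultimately show ?thesis using that[OF Q(1) _ i1 i2] by blast
qed

section \<open>Fourier expansions on the grid\<close>

lemma card_grid_points_near:
  assumes n: "0 < n" and r: "0 < r"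
  shows "real (card {j. j < n \<and> \<bar>grid_point n (int j) - d\<bar> < r}) \<le> r * real n / pi + 1"
proof -
  define a b where "a = real n * (d - r) / (2 * pi)" and "b = real n * (d + r) / (2 * pi)"
  have ab: "b - a = r * real n / pi" unfolding a_def b_def by (simp add: field_simps)
  have "int ` {j. j < n \<and> \<bar>grid_point n (int j) - d\<bar> < r} \<subseteq> {\<lfloor>a\<rfloor> + 1..\<lceil>b\<rceil> - 1}"
  proof safe
    fix j assume j: "\<bar>grid_point n (int j) - d\<bar> < r"
    have g: "grid_point n (int j) = 2 * real j * pi / real n" unfolding grid_point_def by simp
    have "d - r < 2 * real j * pi / real n" "2 * real j * pi / real n < d + r" using j unfolding g abs_less_iff by linarith+
    then have "a < real j" "real j < b" unfolding a_def b_def using n by (auto simp: field_simps)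
    then show "int j \<in> {\<lfloor>a\<rfloor> + 1..\<lceil>b\<rceil> - 1}" by (simp add: less_ceiling_iff floor_less_iff zle_diff1_eq add1_zle_eq)
  qed
  then have "card (int ` {j. j < n \<and> \<bar>grid_point n (int j) - d\<bar> < r}) \<le> card {\<lfloor>a\<rfloor> + 1..\<lceil>b\<rceil> - 1}"
    by (intro card_mono) auto
  then have "card {j. j < n \<and> \<bar>grid_point n (int j) - d\<bar> < r} \<le> nat (\<lceil>b\<rceil> - 1 - \<lfloor>a\<rfloor>)"
    by (simp add: card_image)
  also have "real (nat (\<lceil>b\<rceil> - 1 - \<lfloor>a\<rfloor>)) \<le> b - a + 1"
  proof -
    have "0 \<le> b - a" unfolding ab using r by simp
    then show ?thesis by linarith
  qed
  finally show ?thesis unfolding ab by simp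
qed

lemma card_cos_grid_point:
  "card {j. j < n \<and> cos (grid_point n (int j)) = c} \<le> 2"
proof -
  have "{j. j < n \<and> cos (grid_point n (int j)) = c} \<subseteq>
     {j. grid_point n (int j) = arccos c \<and> j < n} \<union> {j. grid_point n (int j) = 2 * pi - arccos c \<and> j < n}"
  proof safe
    fix j assume j: "j < n" "c = cos (grid_point n (int j))" 
      and no: "grid_point n (int j) \<noteq> 2 * pi - arccos (cos (grid_point n (int j)))"
    have g: "grid_point n (int j) = 2 * pi * (real j / real n)" unfolding grid_point_def by simp
    have "real j / real n < 1" using j by simp
    then have "2 * pi * (real j / real n) < 2 * pi * 1" by (intro mult_strict_left_mono) auto
    then have r: "0 \<le> grid_point n (int j)" "grid_point n (int j) < 2 * pi" unfolding g by auto
    show "grid_point n (int j) = arccos (cos (grid_point n (int j)))"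
    proof (cases "grid_point n (int j) \<le> pi")
      case True then show ?thesis using r by (simp add: arccos_cos)
    next
      case False
      have "arccos (cos (2 * pi - grid_point n (int j))) = 2 * pi - grid_point n (int j)"
        using False r by (intro arccos_cos) auto
      then show ?thesis using no by (simp add: cos_diff)
    qed
  qed
  moreover have "card {j. grid_point n (int j) = t \<and> j < n} \<le> 1" for t
  proof -
    have "i = j" if "grid_point n (int i) = grid_point n (int j)" "i < n" for i j
      using that unfolding grid_point_def by simp
    then show ?thesis by (intro card_le_Suc0_iff_eq[THEN iffD2, simplified One_nat_def[symmetric]]) auto
  qed
  ultimately have "card {j. j < n \<and> cos (grid_point n (int j)) = c} \<le>
      card ({j. grid_point n (int j) = arccos c \<and> j < n} \<union> {j. grid_point n (int j) = 2 * pi - arccos c \<and> j < n})"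
    by (intro card_mono) auto
  also have "\<dots> \<le> card {j. grid_point n (int j) = arccos c \<and> j < n} + card {j. grid_point n (int j) = 2 * pi - arccos c \<and> j < n}"
    by (rule card_Un_le)
  also have "\<dots> \<le> 1 + 1" by (intro add_mono) fact+
  finally show ?thesis by simp
qed

lemma trig_polynomial_periodic:
  assumes "trig_polynomial d h"
  shows "h (x - 2 * pi) = h x"
proof -
  obtain p where p: "\<And>x. h x = cis (- real d * x) * poly p (cis x)"
    using assms unfolding trig_polynomial_def by blast
  have 1: "cis (y + 2 * pi * of_int k) = cis y" for y and k :: int
    using cis_multiple_2pi[of "of_int k"] by (simp add: cis_mult[symmetric])
  have "- real d * (x - 2 * pi) = - real d * x + 2 * pi * of_int (int d)" "x - 2 * pi = x + 2 * pi * of_int (-1)"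
    by (simp_all add: algebra_simps)
  then show ?thesis unfolding p by (simp only: 1)
qed

text \<open>For \<open>n > d\<close> the polynomial \<open>Q\<close> is its own Fourier expansion, so the difference is the Fourier
  expansion of \<open>f - Q\<close>, to which the discrete Parseval estimate and Bessel's inequality apply.\<close>

lemma fourier_expansion_close:
  assumes f: "set_integrable lborel {-pi..pi} f" and Q: "trig_polynomial d Q" and n: "d < n"
    and i1: "set_integrable lborel {-pi..pi} (\<lambda>x. f x - Q x)"
    and i2: "set_integrable lborel {-pi..pi} (\<lambda>x. (cmod (f x - Q x))\<^sup>2)"
  shows "(\<Sum>l<n. (cmod (fourier_expansion n f (grid_point n (int l)) - Q (grid_point n (int l))))\<^sup>2)
     \<le> real n / pi * (LBINT x:{-pi..pi}. (cmod (f x - Q x))\<^sup>2)"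
proof -
  let ?I = "{- int n + 1 .. int n - 1}"
  define u where "u = fourier_coeff (\<lambda>x. f x - Q x)"
  have n0: "0 < n" using n by simp
  have "fourier_expansion n f x - Q x = trig_sum n u x" for x
  proof -
    have "fourier_expansion n f x - fourier_expansion n Q x = trig_sum n u x"
      unfolding fourier_expansion_def trig_sum_def u_def fourier_coeff_diff[OF f trig_polynomial_fourier(3)[OF Q]]
      by (simp add: sum_subtractf left_diff_distrib)
    then show ?thesis unfolding trig_polynomial_fourier(2)[OF Q n] .
  qed
  then have "(\<Sum>l<n. (cmod (fourier_expansion n f (grid_point n (int l)) - Q (grid_point n (int l))))\<^sup>2)
     \<le> 2 * real n * (\<Sum>k\<in>?I. (cmod (u k))\<^sup>2)"
    using discrete_parseval_le[OF n0, of u] by simp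
  also have "\<dots> = real n / pi * (2 * pi * (\<Sum>k\<in>?I. (cmod (u k))\<^sup>2))" by simp
  also have "\<dots> \<le> real n / pi * (LBINT x:{-pi..pi}. (cmod (f x - Q x))\<^sup>2)"
    unfolding u_def by (intro mult_left_mono bessel i1 i2) auto
  finally show ?thesis .
qed

text \<open>The Fourier expansions of \<open>f\<close> need not converge to \<open>f\<close> at the grid points, not even for continuous
  \<open>f\<close>, but they are close to \<open>f\<close> at most of them. Away from \<open>D\<close> the function is bounded below
  in modulus by \<open>4 \<eta>\<close>, and so is, up to \<open>\<eta>\<close>, a suitable trigonometric polynomial \<open>Q\<close>. At a grid
  point where the expansion is smaller than \<open>2 \<eta>\<close> it therefore differs from \<open>Q\<close> by at least \<open>\<eta>\<close>,
  which by the mean square estimate happens rarely, unless the point lies near \<open>D\<close>.\<close>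

lemma fourier_expansion_rarely_small:
  assumes D: "finite D" "D \<subseteq> {-pi..pi}" "-pi \<in> D" "pi \<in> D"
    and cont: "\<And>x. x \<in> {-pi..pi} \<Longrightarrow> x \<notin> D \<Longrightarrow> isCont f x"
    and nz: "\<And>x. x \<in> {-pi..pi} \<Longrightarrow> x \<notin> D \<Longrightarrow> f x \<noteq> 0"
    and bdd: "\<And>x. x \<in> {-pi..pi} \<Longrightarrow> cmod (f x) \<le> B" and \<kappa>: "0 < \<kappa>"
  shows "\<exists>\<eta>>0. \<forall>\<^sub>F n in sequentially.
     real (card {j. j < n \<and> cmod (fourier_expansion n f (grid_point n (int j))) < \<eta>}) \<le> \<kappa> * real n"
proof -
  define c where "c = real (card D)"
  have c: "0 < c" unfolding c_def using D by (auto simp: card_gt_0_iff)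
  define r where "r = \<kappa> * pi / (8 * c)"
  have r: "0 < r" unfolding r_def using \<kappa> c by simp
  define K where "K = {x \<in> {-pi..pi}. r \<le> infdist x D}"
  have "compact K"
  proof -
    have "closed {x. r \<le> infdist x D}" by (intro closed_Collect_le continuous_intros)
    then have "compact ({-pi..pi} \<inter> {x. r \<le> infdist x D})" by (intro compact_Int_closed compact_Icc)
    also have "{-pi..pi} \<inter> {x. r \<le> infdist x D} = K" unfolding K_def by auto
    finally show ?thesis .
  qed
  have KD: "x \<notin> D" if "x \<in> K" for x using that r unfolding K_def by auto
  have "\<exists>\<eta>>0. \<forall>x\<in>K. 4 * \<eta> \<le> cmod (f x)"
  proof (cases "K = {}")
    case True then show ?thesis by (intro exI[of _ 1]) auto
  next
    case False
    have "continuous_on K (\<lambda>x. cmod (f x))"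
    proof (intro continuous_on_norm continuous_at_imp_continuous_on ballI)
      fix x assume "x \<in> K"
      then show "isCont f x" using cont[OF _ KD] unfolding K_def by simp
    qed
    then obtain a where a: "a \<in> K" "\<And>x. x \<in> K \<Longrightarrow> cmod (f a) \<le> cmod (f x)"
      using continuous_attains_inf[OF \<open>compact K\<close> False] by blast
    have "f a \<noteq> 0" using nz[OF _ KD[OF a(1)]] a(1) unfolding K_def by simp
    then show ?thesis using a(2) by (intro exI[of _ "cmod (f a) / 4"]) auto
  qed
  then obtain \<eta> where \<eta>: "0 < \<eta>" "\<And>x. x \<in> K \<Longrightarrow> 4 * \<eta> \<le> cmod (f x)" by blast
  define \<sigma> where "\<sigma> = min \<eta> (\<kappa> * \<eta>\<^sup>2)"
  have \<sigma>: "0 < \<sigma>" "\<sigma> \<le> \<eta>" "\<sigma> \<le> \<kappa> * \<eta>\<^sup>2" unfolding \<sigma>_def using \<eta> \<kappa> by auto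
  obtain d Q where Q: "trig_polynomial d Q"
    and close: "\<And>x. x \<in> {-pi..pi} \<Longrightarrow> r \<le> infdist x D \<Longrightarrow> cmod (f x - Q x) \<le> \<sigma>"
    and i1: "set_integrable lborel {-pi..pi} (\<lambda>x. f x - Q x)"
    and i2: "set_integrable lborel {-pi..pi} (\<lambda>x. (cmod (f x - Q x))\<^sup>2)"
    and le: "(LBINT x:{-pi..pi}. (cmod (f x - Q x))\<^sup>2) \<le> \<sigma>"
    using trig_polynomial_approx[OF D cont bdd r \<sigma>(1)] by blast
  have fint: "set_integrable lborel {-pi..pi} f"
    by (rule set_integrable_bounded[OF set_borel_measurable_finite_discontinuities[OF D(1,3,4) cont] bdd])
  \<comment> \<open>grid points lie in \<open>[0, 2\<pi>)\<close> rather than in \<open>[-\<pi>, \<pi>]\<close>, so the points of \<open>D\<close> are also needed shifted by \<open>2\<pi>\<close>\<close>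
  define D' where "D' = D \<union> (\<lambda>x. x + 2 * pi) ` D"
  have D': "finite D'" "real (card D') \<le> 2 * c"
  proof -
    show "finite D'" unfolding D'_def using D(1) by simp
    have "card D' \<le> card D + card ((\<lambda>x. x + 2 * pi) ` D)" unfolding D'_def by (rule card_Un_le)
    also have "\<dots> \<le> card D + card D" using card_image_le[OF D(1)] by (intro add_mono) auto
    finally show "real (card D') \<le> 2 * c" unfolding c_def by linarith
  qed
  have main: "real (card {j. j < n \<and> cmod (fourier_expansion n f (grid_point n (int j))) < 2 * \<eta>}) \<le> \<kappa> * real n"
    if n: "d < n" "8 * c \<le> \<kappa> * real n" for n
  proof -
    let ?th = "\<lambda>j. grid_point n (int j)" and ?F = "fourier_expansion n f"
    have n0: "0 < n" using n by simp
    define N1 where "N1 = (\<Union>a\<in>D'. {j. j < n \<and> \<bar>?th j - a\<bar> < r})"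
    define N2 where "N2 = {j. j < n \<and> \<eta> \<le> cmod (?F (?th j) - Q (?th j))}"
    have fin: "finite N1" "finite N2" unfolding N1_def N2_def using D'(1) by auto
    have "{j. j < n \<and> cmod (?F (?th j)) < 2 * \<eta>} \<subseteq> N1 \<union> N2"
    proof
      fix j assume "j \<in> {j. j < n \<and> cmod (?F (?th j)) < 2 * \<eta>}"
      then have j: "j < n" "cmod (?F (?th j)) < 2 * \<eta>" by auto
      have g: "?th j = 2 * pi * (real j / real n)" unfolding grid_point_def by simp
      have "real j / real n < 1" using j by simp
      then have "2 * pi * (real j / real n) < 2 * pi * 1" by (intro mult_strict_left_mono) auto
      then have th: "0 \<le> ?th j" "?th j < 2 * pi" unfolding g by auto
      define t where "t = (if ?th j \<le> pi then ?th j else ?th j - 2 * pi)"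
      have t: "t \<in> {-pi..pi}" unfolding t_def using th pi_gt_zero by auto
      have Qt: "Q t = Q (?th j)" unfolding t_def using trig_polynomial_periodic[OF Q] by simp
      show "j \<in> N1 \<union> N2"
      proof (cases "r \<le> infdist t D")
        case True
        then have "t \<in> K" using t unfolding K_def by simp
        have "4 * \<eta> \<le> cmod (f t)" by (rule \<eta>(2)[OF \<open>t \<in> K\<close>])
        also have "\<dots> \<le> cmod (f t - Q t) + cmod (Q t)" using norm_triangle_ineq[of "f t - Q t" "Q t"] by simp
        also have "\<dots> \<le> \<eta> + cmod (Q (?th j))" using close[OF t True] \<sigma>(2) Qt by simp
        also have "cmod (Q (?th j)) \<le> cmod (?F (?th j)) + cmod (?F (?th j) - Q (?th j))"
          using norm_triangle_ineq4[of "?F (?th j)" "?F (?th j) - Q (?th j)"] by simp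
        finally have "\<eta> \<le> cmod (?F (?th j) - Q (?th j))" using j(2) by simp
        then show ?thesis using j(1) unfolding N2_def by simp
      next
        case False
        have "closed D" "D \<noteq> {}" using D finite_imp_closed by auto
        then obtain a where a: "a \<in> D" "infdist t D = dist t a" using infdist_attains_inf[of D t] by blast
        then have "\<bar>t - a\<bar> < r" using False by (simp add: dist_real_def)
        then have "\<exists>a\<in>D'. \<bar>?th j - a\<bar> < r"
        proof (cases "?th j \<le> pi")
          case True
          then show ?thesis using a(1) \<open>\<bar>t - a\<bar> < r\<close> unfolding D'_def t_def by auto
        next
          case False
          then have "\<bar>?th j - (a + 2 * pi)\<bar> < r" using \<open>\<bar>t - a\<bar> < r\<close> unfolding t_def by (simp add: algebra_simps)
          then show ?thesis using a(1) unfolding D'_def by blast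
        qed
        then show ?thesis using j(1) unfolding N1_def by auto
      qed
    qed
    then have "card {j. j < n \<and> cmod (?F (?th j)) < 2 * \<eta>} \<le> card (N1 \<union> N2)"
      using fin by (intro card_mono) auto
    also have "\<dots> \<le> card N1 + card N2" by (rule card_Un_le)
    finally have 0: "real (card {j. j < n \<and> cmod (?F (?th j)) < 2 * \<eta>}) \<le> real (card N1) + real (card N2)" by linarith
    have "real (card N1) \<le> (\<Sum>a\<in>D'. real (card {j. j < n \<and> \<bar>?th j - a\<bar> < r}))"
      unfolding N1_def of_nat_sum[symmetric] of_nat_le_iff by (rule card_UN_le[OF D'(1)])
    also have "\<dots> \<le> (\<Sum>a\<in>D'. r * real n / pi + 1)" by (intro sum_mono card_grid_points_near n0 r)
    also have "\<dots> = real (card D') * (r * real n / pi + 1)" by simp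
    also have "\<dots> \<le> 2 * c * (r * real n / pi + 1)" using D'(2) r by (intro mult_right_mono) auto
    also have "\<dots> = \<kappa> * real n / 4 + 2 * c" unfolding r_def using c by (simp add: field_simps)
    also have "\<dots> \<le> \<kappa> * real n / 2" using n(2) by simp
    finally have 1: "real (card N1) \<le> \<kappa> * real n / 2" .
    have "\<eta>\<^sup>2 * real (card N2) = (\<Sum>l\<in>N2. \<eta>\<^sup>2)" by simp
    also have "\<dots> \<le> (\<Sum>l\<in>N2. (cmod (?F (?th l) - Q (?th l)))\<^sup>2)"
      using \<eta>(1) by (intro sum_mono power_mono) (auto simp: N2_def)
    also have "\<dots> \<le> (\<Sum>l<n. (cmod (?F (?th l) - Q (?th l)))\<^sup>2)"
      by (intro sum_mono2) (auto simp: N2_def)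
    also have "\<dots> \<le> real n / pi * (LBINT x:{-pi..pi}. (cmod (f x - Q x))\<^sup>2)"
      by (rule fourier_expansion_close[OF fint Q n(1) i1 i2])
    also have "\<dots> \<le> real n / pi * (\<kappa> * \<eta>\<^sup>2)" using le \<sigma>(3) by (intro mult_left_mono) auto
    also have "\<dots> \<le> real n / 2 * (\<kappa> * \<eta>\<^sup>2)"
      using \<kappa> \<eta>(1) pi_ge_two by (intro mult_right_mono divide_left_mono) auto
    finally have "real (card N2) \<le> \<kappa> * real n / 2" using \<eta>(1) by (simp add: field_simps)
    then show ?thesis using 0 1 by simp
  qed
  have "\<forall>\<^sub>F n in sequentially. d < n \<and> 8 * c \<le> \<kappa> * real n"
  proof (intro eventually_conj)
    show "\<forall>\<^sub>F n in sequentially. d < n" by (rule eventually_gt_at_top)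
    have "\<forall>\<^sub>F n in sequentially. nat \<lceil>8 * c / \<kappa>\<rceil> \<le> n" by (rule eventually_ge_at_top)
    then show "\<forall>\<^sub>F n in sequentially. 8 * c \<le> \<kappa> * real n"
    proof eventually_elim
      case (elim n)
      then have "8 * c / \<kappa> \<le> real n" by linarith
      then show ?case using \<kappa> by (simp add: field_simps)
    qed
  qed
  then have "\<forall>\<^sub>F n in sequentially.
     real (card {j. j < n \<and> cmod (fourier_expansion n f (grid_point n (int j))) < 2 * \<eta>}) \<le> \<kappa> * real n"
    by eventually_elim (use main in blast)
  then show ?thesis using \<eta>(1) by (intro exI[of _ "2 * \<eta>"]) auto
qed

section \<open>The preconditioned matrix\<close>

lemma toeplitz_circulant_close:
  assumes f: "set_integrable lborel {-pi..pi} f" "set_integrable lborel {-pi..pi} (\<lambda>x. (cmod (f x))\<^sup>2)"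
  shows "(\<lambda>n. (\<Sum>j<n. \<Sum>k<n. (cmod ((toeplitz n f -
            circulant n (\<lambda>l. fourier_expansion n f (grid_point n (int l)))) $$ (j, k)))\<^sup>2) / real n) \<longlonglongrightarrow> 0"
  unfolding toeplitz_minus_circulant_frobenius
proof (rule cesaro_weighted_tendsto_0)
  define N where "N = (LBINT x:{-pi..pi}. (cmod (f x))\<^sup>2) / (2 * pi)"
  have b: "(\<Sum>k\<in>I. (cmod (fourier_coeff f k))\<^sup>2) \<le> N" if "finite I" for I
    using bessel[OF f that] unfolding N_def by (simp add: field_simps)
  fix n
  have "(\<Sum>m<n. (cmod (fourier_coeff f (int m)))\<^sup>2) = (\<Sum>k\<in>int ` {..<n}. (cmod (fourier_coeff f k))\<^sup>2)"
    by (simp add: sum.reindex)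
  moreover have "(\<Sum>m<n. (cmod (fourier_coeff f (- int m)))\<^sup>2) = (\<Sum>k\<in>(\<lambda>m. - int m) ` {..<n}. (cmod (fourier_coeff f k))\<^sup>2)"
    by (simp add: sum.reindex inj_on_def)
  ultimately show "(\<Sum>m<n. (cmod (fourier_coeff f (int m)))\<^sup>2 + (cmod (fourier_coeff f (- int m)))\<^sup>2) \<le> N + N"
    unfolding sum.distrib using b[of "int ` {..<n}"] b[of "(\<lambda>m. - int m) ` {..<n}"] by simp
qed simp

text \<open>The algebraic core. With \<open>y = M x - x\<close> the hypothesis on \<open>M\<close> gives
  \<open>T\<^sub>g C\<^sub>v y = T\<^sub>f x - T\<^sub>g C\<^sub>v x\<close>. On a subspace of small codimension \<open>T\<^sub>g C\<^sub>v\<close> may be replaced by \<open>C\<^sub>u\<close>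
  on both sides, which leaves \<open>C\<^sub>u y = (T\<^sub>f - C\<^sub>u) x\<close>. If moreover the Fourier transform of \<open>y\<close>
  vanishes where \<open>u\<close> is small, then \<open>\<eta> \<parallel>y\<parallel> \<le> \<parallel>C\<^sub>u y\<parallel>\<close>. Conditions on \<open>y\<close> are conditions on \<open>x\<close>, because
  \<open>y\<close> depends linearly on \<open>x\<close>; in this way no bound for the inverse matrices is needed.\<close>

lemma preconditioned_near_identity:
  fixes n :: nat and u v w :: "nat \<Rightarrow> complex"
  assumes Tf: "Tf \<in> carrier_mat n n" and Tg: "Tg \<in> carrier_mat n n" and M: "M \<in> carrier_mat n n"
    and eq: "Tg * circulant n v * M = Tf"
    and G: "holds_on_codim n k (\<lambda>x. Tg *\<^sub>v x = circulant n w *\<^sub>v x)"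
    and N: "holds_on_codim n l (\<lambda>x. sqnorm ((Tf - circulant n u) *\<^sub>v x) \<le> (\<delta> * \<eta>)\<^sup>2 * sqnorm x)"
    and agree: "\<And>i. i < n \<Longrightarrow> i \<notin> Z \<Longrightarrow> w i * v i = u i" and Z: "Z \<subseteq> {..<n}"
    and S: "S = {i. i < n \<and> cmod (u i) < \<eta>}" and \<eta>: "0 < \<eta>"
  shows "holds_on_codim n (2 * k + l + 2 * real (card Z) + real (card S)) (\<lambda>x. sqnorm (M *\<^sub>v x - x) \<le> \<delta>\<^sup>2 * sqnorm x)"
proof -
  let ?F = "fourier_mat n" and ?C = "circulant n"
  have F: "?F \<in> carrier_mat n n" by simp
  have Cv: "?C v \<in> carrier_mat n n" and Cw: "?C w \<in> carrier_mat n n" and Cu: "?C u \<in> carrier_mat n n" by simp_all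
  define P where "P x \<longleftrightarrow> Tg *\<^sub>v (?C v *\<^sub>v x) = ?C w *\<^sub>v (?C v *\<^sub>v x) \<and> (\<forall>i\<in>Z. (?F *\<^sub>v x) $ i = 0)" for x
  have hP: "holds_on_codim n (k + real (card Z)) P"
    unfolding P_def
    by (intro holds_on_codim_conj holds_on_codim_preimage[OF G Cv] holds_on_codim_rows[OF Z F])
  have PD: "Tg *\<^sub>v (?C v *\<^sub>v x) = ?C u *\<^sub>v x" if x: "x \<in> carrier_vec n" and "P x" for x
  proof -
    have Cvx: "?C v *\<^sub>v x \<in> carrier_vec n" by (rule mult_mat_vec_carrier[OF Cv x])
    have "?C w *\<^sub>v (?C v *\<^sub>v x) = ?C u *\<^sub>v x"
    proof (rule vec_eq_fourier_mat)
      fix i assume i: "i < n"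
      have "(?F *\<^sub>v (?C w *\<^sub>v (?C v *\<^sub>v x))) $ i = w i * v i * (?F *\<^sub>v x) $ i"
        unfolding fourier_mat_circulant[OF Cvx i] fourier_mat_circulant[OF x i] by simp
      moreover have "(?F *\<^sub>v (?C u *\<^sub>v x)) $ i = u i * (?F *\<^sub>v x) $ i" by (rule fourier_mat_circulant[OF x i])
      moreover have "w i * v i * (?F *\<^sub>v x) $ i = u i * (?F *\<^sub>v x) $ i"
        using agree[OF i] \<open>P x\<close> unfolding P_def by (cases "i \<in> Z") auto
      ultimately show "(?F *\<^sub>v (?C w *\<^sub>v (?C v *\<^sub>v x))) $ i = (?F *\<^sub>v (?C u *\<^sub>v x)) $ i" by simp
    qed (use mult_mat_vec_carrier[OF Cw Cvx] mult_mat_vec_carrier[OF Cu x] in auto)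
    then show ?thesis using \<open>P x\<close> unfolding P_def by simp
  qed
  define Y where "Y y \<longleftrightarrow> P y \<and> (\<forall>i\<in>S. (?F *\<^sub>v y) $ i = 0)" for y
  have hY: "holds_on_codim n (k + real (card Z) + real (card S)) Y"
    unfolding Y_def by (intro holds_on_codim_conj[OF hP] holds_on_codim_rows[OF _ F]) (auto simp: S)
  have M1: "M - 1\<^sub>m n \<in> carrier_mat n n" by (intro minus_carrier_mat) simp
  have hM: "holds_on_codim n (k + real (card Z) + real (card S)) (\<lambda>x. Y ((M - 1\<^sub>m n) *\<^sub>v x))"
    by (rule holds_on_codim_preimage[OF hY M1])
  show ?thesis
  proof (rule holds_on_codim_mono[OF holds_on_codim_conj[OF holds_on_codim_conj[OF hP hM] N]])
    fix x assume x: "x \<in> carrier_vec n"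
      and A: "(P x \<and> Y ((M - 1\<^sub>m n) *\<^sub>v x)) \<and> sqnorm ((Tf - ?C u) *\<^sub>v x) \<le> (\<delta> * \<eta>)\<^sup>2 * sqnorm x"
    have Mx: "M *\<^sub>v x \<in> carrier_vec n" by (rule mult_mat_vec_carrier[OF M x])
    define y where "y = M *\<^sub>v x - x"
    have y: "y \<in> carrier_vec n" unfolding y_def using Mx x by (intro minus_carrier_vec)
    have My: "(M - 1\<^sub>m n) *\<^sub>v x = y"
      unfolding y_def using minus_mult_distrib_mat_vec[OF M one_carrier_mat x] x by simp
    have Yy: "Y y" and Px: "P x" using A My by auto
    have B: "Tg * ?C v \<in> carrier_mat n n" by (rule mult_carrier_mat[OF Tg Cv])
    have "(Tg * ?C v) *\<^sub>v y = (Tg * ?C v) *\<^sub>v (M *\<^sub>v x) - (Tg * ?C v) *\<^sub>v x"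
      unfolding y_def by (rule mult_minus_distrib_mat_vec[OF B Mx x])
    also have "(Tg * ?C v) *\<^sub>v (M *\<^sub>v x) = Tf *\<^sub>v x"
      unfolding eq[symmetric] by (rule assoc_mult_mat_vec[OF B M x, symmetric])
    finally have "(Tg * ?C v) *\<^sub>v y = Tf *\<^sub>v x - (Tg * ?C v) *\<^sub>v x" .
    then have "?C u *\<^sub>v y = Tf *\<^sub>v x - ?C u *\<^sub>v x"
      unfolding assoc_mult_mat_vec[OF Tg Cv y] assoc_mult_mat_vec[OF Tg Cv x] PD[OF x Px]
      using PD[OF y] Yy unfolding Y_def by simp
    also have "\<dots> = (Tf - ?C u) *\<^sub>v x" by (rule minus_mult_distrib_mat_vec[OF Tf Cu x, symmetric])
    finally have "sqnorm (?C u *\<^sub>v y) \<le> (\<delta> * \<eta>)\<^sup>2 * sqnorm x" using A by simp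
    moreover have "\<eta>\<^sup>2 * sqnorm y \<le> sqnorm (?C u *\<^sub>v y)"
    proof -
      have "\<eta>\<^sup>2 * sqnorm y = \<eta>\<^sup>2 * sqnorm (?F *\<^sub>v y)" by (simp only: sqnorm_fourier_mat[OF y])
      also have "\<dots> = (\<Sum>i<n. \<eta>\<^sup>2 * (cmod ((?F *\<^sub>v y) $ i))\<^sup>2)"
        unfolding sqnorm_def by (simp add: sum_distrib_left)
      also have "\<dots> \<le> sqnorm (?C u *\<^sub>v y)"
        unfolding sqnorm_circulant[OF y]
      proof (intro sum_mono)
        fix i assume "i \<in> {..<n}"
        show "\<eta>\<^sup>2 * (cmod ((?F *\<^sub>v y) $ i))\<^sup>2 \<le> (cmod (u i * (?F *\<^sub>v y) $ i))\<^sup>2"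
        proof (cases "i \<in> S")
          case True
          then show ?thesis using Yy unfolding Y_def by simp
        next
          case False
          then have "\<eta> \<le> cmod (u i)" using \<open>i \<in> {..<n}\<close> unfolding S by simp
          then have "\<eta>\<^sup>2 \<le> (cmod (u i))\<^sup>2" using \<eta> by (intro power_mono) auto
          then show ?thesis unfolding norm_mult power_mult_distrib by (rule mult_right_mono) simp
        qed
      qed
      finally show ?thesis .
    qed
    ultimately have "\<eta>\<^sup>2 * sqnorm y \<le> \<eta>\<^sup>2 * (\<delta>\<^sup>2 * sqnorm x)" by (simp add: power_mult_distrib mult_ac)
    then show "sqnorm (M *\<^sub>v x - x) \<le> \<delta>\<^sup>2 * sqnorm x" unfolding y_def[symmetric] using \<eta> by simp
  qed simp
qed

lemma inv_mat_right:
  assumes A: "A \<in> carrier_mat n n" and inv: "invertible_mat A"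
  shows "inv_mat A \<in> carrier_mat n n" "A * inv_mat A = 1\<^sub>m n"
proof -
  obtain B where B: "inverts_mat A B" "inverts_mat B A" using inv unfolding invertible_mat_def by blast
  have AB: "A * B = 1\<^sub>m n" "B * A = 1\<^sub>m (dim_row B)" using A B unfolding inverts_mat_def by auto
  have "dim_col B = n" using arg_cong[OF AB(1), of dim_col] by simp
  moreover have "dim_row B = n" using arg_cong[OF AB(2), of dim_col] A by simp
  ultimately have Bc: "B \<in> carrier_mat n n" "B * A = 1\<^sub>m n" using AB(2) by auto
  have "A \<in> Units (ring_mat TYPE(complex) n ())"
    unfolding Units_def using A Bc AB(1) by (auto simp: ring_mat_simps)
  then have "mat_inverse A \<noteq> None" using mat_inverse(1)[OF A, of "()"] by blast
  then obtain C where "mat_inverse A = Some C" by auto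
  with mat_inverse(2)[OF A this] show "inv_mat A \<in> carrier_mat n n" "A * inv_mat A = 1\<^sub>m n"
    unfolding inv_mat_def by auto
qed

lemma trig_polynomial_eliminator:
  "trig_polynomial (max (m1 0 div 2 + (\<Sum>i=1..\<rho>. m1 i)) (m2 0 + (\<Sum>i=1..\<rho>. m2 i))) (eliminator \<rho> m1 m2 y s1 s2)"
proof -
  let ?d1 = "m1 0 div 2 + (\<Sum>i=1..\<rho>. m1 i)" and ?d2 = "m2 0 + (\<Sum>i=1..\<rho>. m2 i)"
  have lin: "trig_polynomial 1 (\<lambda>x. complex_of_real (a - b * cos x))" for a b
  proof -
    have "trig_polynomial (max 0 (0 + 1)) (\<lambda>x. complex_of_real a + complex_of_real (- b) * complex_of_real (cos x))"
      by (intro trig_polynomial_add trig_polynomial_mult trig_polynomial_const trig_polynomial_cos)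
    then show ?thesis by simp
  qed
  have pr: "trig_polynomial (\<Sum>i=1..\<rho>. m i) (\<lambda>x. \<Prod>i=1..\<rho>. complex_of_real (a i - cos x) ^ m i)" for m a
  proof (rule trig_polynomial_prod)
    fix i
    show "trig_polynomial (m i) (\<lambda>x. complex_of_real (a i - cos x) ^ m i)"
      using trig_polynomial_power[OF lin[of "a i" 1], of "m i"] by simp
  qed
  have t1: "trig_polynomial (0 + m1 0 div 2 * 1 + (\<Sum>i=1..\<rho>. m1 i)) (\<lambda>x. complex_of_real s1 *
      complex_of_real (2 - 2 * cos x) ^ (m1 0 div 2) * (\<Prod>i=1..\<rho>. complex_of_real (y i - cos x) ^ m1 i))" for y
    by (intro trig_polynomial_mult trig_polynomial_const trig_polynomial_power lin pr)
  have t2: "trig_polynomial (0 + m2 0 * 1 + (\<Sum>i=1..\<rho>. m2 i)) (\<lambda>x. complex_of_real s2 *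
      complex_of_real (sin x) ^ m2 0 * (\<Prod>i=1..\<rho>. complex_of_real (y i - cos x) ^ m2 i))" for y
    by (intro trig_polynomial_mult trig_polynomial_const trig_polynomial_power trig_polynomial_sin pr)
  show ?thesis
  proof (cases "\<forall>i\<le>\<rho>. m1 i \<le> m2 i")
    case True
    have "eliminator \<rho> m1 m2 y s1 s2 = (\<lambda>x. complex_of_real s1 *
      complex_of_real (2 - 2 * cos x) ^ (m1 0 div 2) * (\<Prod>i=1..\<rho>. complex_of_real (cos (y i) - cos x) ^ m1 i))"
      using True by (simp add: eliminator_def fun_eq_iff)
    then show ?thesis using trig_polynomial_mono[OF t1[of "\<lambda>i. cos (y i)"]] by simp
  next
    case False
    have "eliminator \<rho> m1 m2 y s1 s2 = (\<lambda>x. complex_of_real s1 *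
      complex_of_real (2 - 2 * cos x) ^ (m1 0 div 2) * (\<Prod>i=1..\<rho>. complex_of_real (cos (y i) - cos x) ^ m1 i)
      + \<i> * (complex_of_real s2 *
      complex_of_real (sin x) ^ m2 0 * (\<Prod>i=1..\<rho>. complex_of_real (cos (y i) - cos x) ^ m2 i)))"
      using False by (simp only: eliminator_def Let_def fun_eq_iff if_False) simp
    then show ?thesis
      using trig_polynomial_add[OF t1 trig_polynomial_mult[OF trig_polynomial_const t2], of "\<lambda>i. cos (y i)" \<i> "\<lambda>i. cos (y i)"]
      by simp
  qed
qed

text \<open>The second summand of the eliminator is purely imaginary, so a zero is a zero of the first.\<close>

lemma eliminator_zero:
  assumes "s1 \<noteq> 0" "eliminator \<rho> m1 m2 y s1 s2 x = 0"
  shows "cos x = 1 \<or> (\<exists>i\<in>{1..\<rho>}. cos x = cos (y i))"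
proof -
  have "Re (eliminator \<rho> m1 m2 y s1 s2 x) =
      s1 * (2 - 2 * cos x) ^ (m1 0 div 2) * (\<Prod>i=1..\<rho>. (cos (y i) - cos x) ^ m1 i)"
  proof -
    have "Re (complex_of_real a + \<i> * complex_of_real b) = a" for a b by simp
    then show ?thesis
      unfolding eliminator_def Let_def by (simp only: if_distrib[of Re] Re_complex_of_real if_cancel)
  qed
  then have "s1 * (2 - 2 * cos x) ^ (m1 0 div 2) * (\<Prod>i=1..\<rho>. (cos (y i) - cos x) ^ m1 i) = 0"
    using assms(2) by simp
  then show ?thesis using assms(1) by (auto simp: prod_zero_iff) (metis One_nat_def atLeastAtMost_iff)
qed

lemma card_eliminator_zeros:
  assumes "s1 \<noteq> 0"
  shows "card {j. j < n \<and> eliminator \<rho> m1 m2 y s1 s2 (grid_point n (int j)) = 0} \<le> 2 + 2 * \<rho>"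
proof -
  let ?E = "\<lambda>c. {j. j < n \<and> cos (grid_point n (int j)) = c}"
  have "{j. j < n \<and> eliminator \<rho> m1 m2 y s1 s2 (grid_point n (int j)) = 0} \<subseteq> ?E 1 \<union> (\<Union>i\<in>{1..\<rho>}. ?E (cos (y i)))"
  proof
    fix j assume "j \<in> {j. j < n \<and> eliminator \<rho> m1 m2 y s1 s2 (grid_point n (int j)) = 0}"
    then have "j < n" and "eliminator \<rho> m1 m2 y s1 s2 (grid_point n (int j)) = 0" by auto
    with eliminator_zero[OF assms this(2)]
    show "j \<in> ?E 1 \<union> (\<Union>i\<in>{1..\<rho>}. ?E (cos (y i)))" by auto
  qed
  then have "card {j. j < n \<and> eliminator \<rho> m1 m2 y s1 s2 (grid_point n (int j)) = 0} \<le> card (?E 1 \<union> (\<Union>i\<in>{1..\<rho>}. ?E (cos (y i))))"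
    by (intro card_mono) auto
  also have "\<dots> \<le> card (?E 1) + card (\<Union>i\<in>{1..\<rho>}. ?E (cos (y i)))" by (rule card_Un_le)
  also have "card (\<Union>i\<in>{1..\<rho>}. ?E (cos (y i))) \<le> (\<Sum>i\<in>{1..\<rho>}. card (?E (cos (y i))))" by (rule card_UN_le) simp
  also have "\<dots> \<le> (\<Sum>i\<in>{1..\<rho>}. 2)" by (intro sum_mono card_cos_grid_point)
  finally show ?thesis using card_cos_grid_point[of n 1] by simp
qed

theorem mainTheorem19:
  fixes f :: "real \<Rightarrow> complex" and f1 f2 :: "real \<Rightarrow> real"
    and \<rho> :: nat and x :: "nat \<Rightarrow> real" and m1 m2 :: "nat \<Rightarrow> nat"
    and xt err :: "nat \<Rightarrow> nat \<Rightarrow> real" and \<tau> s1 s2 :: "nat \<Rightarrow> real"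
    and F g :: "nat \<Rightarrow> real \<Rightarrow> complex" and v :: "nat \<Rightarrow> nat \<Rightarrow> complex"
    and M :: "nat \<Rightarrow> complex mat"
  assumes f_def: "\<And>t. f t = Complex (f1 t) (f2 t)"
    and periodic: "\<And>t. f (t + 2 * pi) = f t"
    and f1_even: "\<And>t. f1 (- t) = f1 t"
    and f2_odd: "\<And>t. f2 (- t) = - f2 t"
    and roots_inj: "inj_on x {1..\<rho>}"
    and roots_range: "\<And>i. i \<in> {1..\<rho>} \<Longrightarrow> 0 < x i \<and> x i \<le> pi"
    and roots: "\<And>i. i \<in> {1..\<rho>} \<Longrightarrow> f1 (x i) = 0 \<or> f2 (x i) = 0"
    and roots_complete: "\<And>t. 0 < t \<Longrightarrow> t \<le> pi \<Longrightarrow> f t = 0 \<Longrightarrow> t \<in> x ` {1..\<rho>}"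
    and mult: "\<And>i. i \<in> {1..\<rho>} \<Longrightarrow> has_multiplicity f1 (x i) (m1 i) \<and> has_multiplicity f2 (x i) (m2 i)"
    and mult_zero: "has_multiplicity f1 0 (m1 0)" "has_multiplicity f2 0 (m2 0)"
    and trig_poly: "even (m1 0)"
    and F_def: "\<And>n. F n = fourier_expansion n f"
    and tolerance: "\<And>n. \<tau> n > 0"
    and estimates: "\<forall>\<^sub>F n in sequentially. \<forall>i\<in>{1..\<rho>}.
            0 < xt n i \<and> xt n i \<le> pi \<and> estimated_root n (\<tau> n) (F n) (xt n i)"
    and error: "\<And>n i. i \<in> {1..\<rho>} \<Longrightarrow> err n i = xt n i - x i"
    and signs: "\<And>n. s1 n \<in> {1, -1}" "\<And>n. s2 n \<in> {1, -1}"
    and g_def: "\<And>n. g n = eliminator \<rho> m1 m2 (xt n) (s1 n) (s2 n)"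
    and positive: "\<forall>\<^sub>F n in sequentially. positive_quotient n (F n) (g n)"
    and samples: "\<forall>\<^sub>F n in sequentially. quotient_samples n (F n) (g n) (v n)"
    and invertible: "\<forall>\<^sub>F n in sequentially.
            invertible_mat (circulant n (v n)) \<and> invertible_mat (toeplitz n (g n))"
    and M_def: "\<And>n. M n = inv_mat (circulant n (v n)) * inv_mat (toeplitz n (g n)) * toeplitz n f"
  shows "(continuous_on UNIV f \<longrightarrow>
            (\<exists>a b. (\<forall>n. a n \<le> 1 \<and> 1 \<le> b n) \<and> (\<lambda>n. b n - a n) \<longlonglongrightarrow> 0 \<and>
                   sv_cluster M (\<lambda>n. {a n..b n})))
       \<and> (piecewise_continuous f \<longrightarrow> sv_cluster M (\<lambda>n. {0.6847..1.2374}))"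
proof -
  define d where "d = max (m1 0 div 2 + (\<Sum>i=1..\<rho>. m1 i)) (m2 0 + (\<Sum>i=1..\<rho>. m2 i))"
  have gtrig: "trig_polynomial d (g n)" for n unfolding g_def d_def by (rule trig_polynomial_eliminator)
  define Z where "Z n = {j. j < n \<and> g n (grid_point n (int j)) = 0}" for n
  have cZ: "card (Z n) \<le> 2 + 2 * \<rho>" for n
    unfolding Z_def g_def by (rule card_eliminator_zeros) (use signs(1)[of n] in auto)
  \<comment> \<open>the symmetry of \<open>f\<close> reflects the roots in \<open>(0, \<pi>]\<close> to the negative half of the period\<close>
  have zeros: "finite {t \<in> {-pi..pi}. f t = 0}"
  proof (rule finite_subset)
    show "{t \<in> {-pi..pi}. f t = 0} \<subseteq> {0} \<union> x ` {1..\<rho>} \<union> uminus ` (x ` {1..\<rho>})"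
    proof
      fix t assume "t \<in> {t \<in> {-pi..pi}. f t = 0}"
      then have t: "-pi \<le> t" "t \<le> pi" "f t = 0" by auto
      have "f (- t) = 0" using t(3) f_def[of t] f_def[of "- t"] f1_even[of t] f2_odd[of t] by (simp add: complex_eq_iff)
      then show "t \<in> {0} \<union> x ` {1..\<rho>} \<union> uminus ` (x ` {1..\<rho>})"
        using roots_complete[of t] roots_complete[of "- t"] t
        by (cases t "0 :: real" rule: linorder_cases) (auto intro: image_eqI[of t uminus "- t"])
    qed
  qed simp
  have near_1: "(\<lambda>n. real (size {#s \<in># singular_values (M n). \<bar>s - 1\<bar> > \<epsilon>#})) \<in> o(\<lambda>n. real n)"
    if pc: "piecewise_continuous f" and \<epsilon>: "0 < \<epsilon>" for \<epsilon>
  proof (rule landau_o.smallI)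
    fix c :: real assume c: "0 < c"
    define D where "D = {t \<in> {-pi..pi}. \<not> isCont f t} \<union> {t \<in> {-pi..pi}. f t = 0} \<union> {-pi, pi}"
    have D: "finite D" "D \<subseteq> {-pi..pi}" "-pi \<in> D" "pi \<in> D"
      using pc zeros unfolding D_def piecewise_continuous_def by auto
    have cont: "isCont f t" and nz: "f t \<noteq> 0" if "t \<in> {-pi..pi}" "t \<notin> D" for t
      using that unfolding D_def by auto
    obtain B where B: "\<And>t. t \<in> {-pi..pi} \<Longrightarrow> cmod (f t) \<le> B"
      using piecewise_continuous_bounded[OF pc] by blast
    have fm: "set_borel_measurable lborel {-pi..pi} f"
      by (rule set_borel_measurable_finite_discontinuities[OF D(1,3,4) cont])
    have f_int: "set_integrable lborel {-pi..pi} f" by (rule set_integrable_bounded[OF fm B])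
    have f2_int: "set_integrable lborel {-pi..pi} (\<lambda>t. (cmod (f t))\<^sup>2)"
      by (rule set_integrable_bounded[OF set_borel_measurable_cmod2[OF fm], of "B\<^sup>2"]) (use B in \<open>auto intro!: power_mono\<close>)
    obtain \<eta> where \<eta>: "0 < \<eta>" and rare: "\<forall>\<^sub>F n in sequentially.
        real (card {j. j < n \<and> cmod (fourier_expansion n f (grid_point n (int j))) < \<eta>}) \<le> c / 8 * real n"
      using fourier_expansion_rarely_small[OF D cont nz B, of "c / 8"] c by auto
    \<comment> \<open>the squared Frobenius norm of the error made in replacing the Toeplitz by the circulant matrix\<close>
    define b where "b n = (\<Sum>j<n. \<Sum>k<n. (cmod ((toeplitz n f -
            circulant n (\<lambda>l. fourier_expansion n f (grid_point n (int l)))) $$ (j, k)))\<^sup>2)" for n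
    have "(\<lambda>n. b n / real n) \<longlonglongrightarrow> 0" unfolding b_def by (rule toeplitz_circulant_close[OF f_int f2_int])
    moreover have "0 < c / 8 * (\<epsilon> * \<eta>)\<^sup>2" using c \<epsilon> \<eta> by simp
    ultimately have small: "\<forall>\<^sub>F n in sequentially. b n / real n < c / 8 * (\<epsilon> * \<eta>)\<^sup>2" by (rule order_tendstoD(2))
    define K where "K = 8 * real d + 4 * (2 + 2 * real \<rho>)"
    have "\<forall>\<^sub>F n in sequentially. nat \<lceil>2 * K / c\<rceil> \<le> n" by (rule eventually_ge_at_top)
    then have const: "\<forall>\<^sub>F n in sequentially. K \<le> c / 2 * real n"
    proof eventually_elim
      case (elim n)
      then have "2 * K / c \<le> real n" by linarith
      then show ?case using c by (simp add: field_simps)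
    qed
    show "\<forall>\<^sub>F n in sequentially. norm (real (size {#s \<in># singular_values (M n). \<bar>s - 1\<bar> > \<epsilon>#})) \<le> c * norm (real n)"
      using rare small const samples invertible eventually_gt_at_top[of d]
    proof eventually_elim
      case (elim n)
      have n0: "0 < n" using elim(6) by simp
      define u where "u l = fourier_expansion n f (grid_point n (int l))" for l
      define w where "w l = g n (grid_point n (int l))" for l
      define S where "S = {j. j < n \<and> cmod (u j) < \<eta>}"
      have Ci: "inv_mat (circulant n (v n)) \<in> carrier_mat n n" "circulant n (v n) * inv_mat (circulant n (v n)) = 1\<^sub>m n"
        using inv_mat_right[OF circulant_carrier] elim(5) by auto
      have Ti: "inv_mat (toeplitz n (g n)) \<in> carrier_mat n n" "toeplitz n (g n) * inv_mat (toeplitz n (g n)) = 1\<^sub>m n"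
        using inv_mat_right[OF toeplitz_carrier] elim(5) by auto
      have M: "M n \<in> carrier_mat n n"
        unfolding M_def using Ci(1) Ti(1) by (intro mult_carrier_mat[of _ n n] toeplitz_carrier)
      have eq: "toeplitz n (g n) * circulant n (v n) * M n = toeplitz n f"
      proof -
        let ?T = "toeplitz n (g n)" and ?C = "circulant n (v n)" and ?Tf = "toeplitz n f"
        have "?T * ?C * M n = ?T * (?C * inv_mat ?C) * (inv_mat ?T * ?Tf)"
          unfolding M_def using Ci(1) Ti(1)
          by (simp add: assoc_mult_mat[of _ n n _ n _ n] mult_carrier_mat[of _ n n _ n])
        also have "\<dots> = (?T * inv_mat ?T) * ?Tf"
          unfolding Ci(2) using Ti(1)
          by (simp add: right_mult_one_mat[of _ n n] assoc_mult_mat[of _ n n _ n _ n])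
        finally show ?thesis unfolding Ti(2) by simp
      qed
      have G: "holds_on_codim n (2 * real d) (\<lambda>x. toeplitz n (g n) *\<^sub>v x = circulant n w *\<^sub>v x)"
        by (rule toeplitz_circulant_banded)
           (simp_all add: trig_polynomial_fourier(1)[OF gtrig] trig_polynomial_fourier(2)[OF gtrig elim(6)] w_def[abs_def])
      have N: "holds_on_codim n (b n / (\<epsilon> * \<eta>)\<^sup>2)
          (\<lambda>x. sqnorm ((toeplitz n f - circulant n u) *\<^sub>v x) \<le> (\<epsilon> * \<eta>)\<^sup>2 * sqnorm x)"
        by (rule frobenius_small_on_codim) (use \<epsilon> \<eta> in \<open>simp_all add: b_def u_def[abs_def] minus_carrier_mat\<close>)
      have agree: "w i * v n i = u i" if "i < n" "i \<notin> Z n" for i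
      proof -
        have nz: "g n (grid_point n (int i)) \<noteq> 0" using that unfolding Z_def by simp
        then have "v n i = F n (grid_point n (int i)) / g n (grid_point n (int i))"
          using elim(4) that(1) unfolding quotient_samples_def Let_def by auto
        then show ?thesis using nz unfolding w_def u_def F_def by simp
      qed
      have "holds_on_codim n (2 * (2 * real d) + b n / (\<epsilon> * \<eta>)\<^sup>2 + 2 * real (card (Z n)) + real (card S))
          (\<lambda>x. sqnorm (M n *\<^sub>v x - x) \<le> \<epsilon>\<^sup>2 * sqnorm x)"
        by (rule preconditioned_near_identity[OF toeplitz_carrier toeplitz_carrier M eq G N agree _ S_def \<eta>])
           (auto simp: Z_def)
      from singular_values_near_1[OF M \<epsilon> this]
      have "real (size {#s \<in># singular_values (M n). \<bar>s - 1\<bar> > \<epsilon>#}) \<le>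
          8 * real d + 2 * (b n / (\<epsilon> * \<eta>)\<^sup>2) + 4 * real (card (Z n)) + 2 * real (card S)" by simp
      moreover have "real (card S) \<le> c / 8 * real n" using elim(1) unfolding S_def u_def .
      moreover have "b n / (\<epsilon> * \<eta>)\<^sup>2 \<le> c / 8 * real n"
        using elim(2) n0 \<epsilon> \<eta> by (simp add: field_simps)
      moreover have "4 * real (card (Z n)) \<le> 4 * (2 + 2 * real \<rho>)" using of_nat_mono[OF cZ[of n], where 'a = real] by simp
      ultimately have "real (size {#s \<in># singular_values (M n). \<bar>s - 1\<bar> > \<epsilon>#}) \<le> c * real n"
        using elim(3) unfolding K_def by linarith
      then show ?case by simp
    qed
  qed
  have cluster: "sv_cluster M I" if pc: "piecewise_continuous f" and I: "\<And>n. 1 \<in> I n" for I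
    unfolding sv_cluster_def
  proof (intro allI impI)
    fix \<epsilon> :: real assume "0 < \<epsilon>"
    from near_1[OF pc this]
    show "(\<lambda>n. real (size {#s \<in># singular_values (M n). infdist s (I n) > \<epsilon>#})) \<in> o(\<lambda>n. real n)"
    proof (rule landau_o.big_small_trans[rotated])
      show "(\<lambda>n. real (size {#s \<in># singular_values (M n). infdist s (I n) > \<epsilon>#})) \<in>
          O(\<lambda>n. real (size {#s \<in># singular_values (M n). \<bar>s - 1\<bar> > \<epsilon>#}))"
      proof (intro landau_o.bigI[of 1] always_eventually allI)
        fix n
        have "infdist s (I n) \<le> \<bar>s - 1\<bar>" for s using infdist_le[OF I[of n], of s] by (simp add: dist_real_def)
        then have "{#s \<in># singular_values (M n). infdist s (I n) > \<epsilon>#} \<subseteq># {#s \<in># singular_values (M n). \<bar>s - 1\<bar> > \<epsilon>#}"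
          by (intro filter_mset_mono_strong) (auto intro: less_le_trans)
        from size_mset_mono[OF this]
        show "norm (real (size {#s \<in># singular_values (M n). infdist s (I n) > \<epsilon>#})) \<le>
          1 * norm (real (size {#s \<in># singular_values (M n). \<bar>s - 1\<bar> > \<epsilon>#}))" by simp
      qed simp
    qed
  qed
  show ?thesis
  proof (intro conjI impI)
    assume "continuous_on UNIV f"
    then have c: "isCont f t" for t using continuous_on_eq_continuous_at[of UNIV f] by simp
    have "(f \<longlongrightarrow> f t) (at t within A)" for t A
      using c[of t] unfolding isCont_def by (rule tendsto_within_subset) simp
    then have "piecewise_continuous f" unfolding piecewise_continuous_def using c by auto
    \<comment> \<open>the cluster is even a point, so the interval can be chosen of length \<open>0\<close>\<close>
    then have "sv_cluster M (\<lambda>n. {1..1})" by (rule cluster) simp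
    then show "\<exists>a b. (\<forall>n. a n \<le> 1 \<and> 1 \<le> b n) \<and> (\<lambda>n. b n - a n) \<longlonglongrightarrow> 0 \<and> sv_cluster M (\<lambda>n. {a n..b n})"
      by (intro exI[of _ "\<lambda>_. 1"]) simp
  next
    assume "piecewise_continuous f"
    then show "sv_cluster M (\<lambda>n. {0.6847..1.2374})" by (rule cluster) simp
  qed
qed

end
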